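(* The commutator subgroup $[T_B,T_B]$ is the index-two subgroup of $T_B$ consisting of all elements that preserve the two-coloring of the components of the basilica. This group is generated by the elements $\{\beta,\gamma,\delta,\beta^\alpha,\gamma^\alpha,\delta^\alpha\}$.
   Context: Identify the unit circle $S^1$ with $\mathbb{R}/\mathbb{Z}$. An arc $\{a,b\}$ is a hyperbolic geodesic of the closed unit disk joining two distinct points $a,b\in S^1$. The primary arc of a closed interval $[a,b]$ of the circle is the arc joining $a+\tfrac14(b-a)$ and $b-\tfrac14(b-a)$ (so it cuts the interval into three pieces with length ratio $1:2:1$). Arc diagrams: start with the two arcs $\{1/3,2/3\}$ and $\{1/6,5/6\}$, whose endpoints divide the circle into the four intervals $[1/6,1/3]$, $[1/3,2/3]$, $[2/3,5/6]$, $[-1/6,1/6]$. Finitely many times (possibly zero), choose one of the current intervals and add its primary arc, which replaces that interval by three intervals. Any finite collection of arcs obtained this way is an arc diagram. It is regarded as a 2-complex on the closed disk: the vertices are the arc endpoints, the edges are the arcs and the circle intervals between consecutive endpoints, and the faces are the complementary regions. Two arc diagrams are isomorphic if there is an orientation-preserving isomorphism of these 2-complexes (so circle intervals go to circle intervals and arcs to arcs). Given an isomorphism $\varphi\colon\mathcal{D}\to\mathcal{R}$ of arc diagrams, let $f\colon S^1\to S^1$ be the orientation-preserving piecewise-linear homeomorphism sending each interval of $\mathcal{D}$ linearly onto the corresponding interval of $\mathcal{R}$. Such an $f$ is called a dyadic rearrangement of the basilica, and $T_B$ is the set of all of them; it is a group under composition. The elements $\alpha,\beta,\gamma,\delta\in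 T_B$ are the following orientation-preserving piecewise-linear homeomorphisms: - $\alpha$ maps $1/3,2/3$ to $1/6,5/6$ respectively and is linear on $[-1/3,1/3]$ (onto $[-1/6,1/6]$) and on $[1/3,2/3]$ (onto $[1/6,5/6]$); - $\beta$ is the identity on $[-1/6,1/6]$, maps $1/6,\,2/3,\,17/24,\,5/6$ to $1/6,\,7/24,\,1/3,\,5/6$ respectively, and is linear on each interval between consecutive listed points of $[1/6,5/6]$; - $\gamma$ is the identity outside $[1/6,1/3]$, maps $1/6,\,7/24,\,29/96,\,1/3$ to $1/6,\,19/96,\,5/24,\,1/3$ respectively, and is linear on each interval between consecutive listed points of $[1/6,1/3]$; - $\delta(\theta)=\theta+1/2$. For $g\in T_B$, $g^\alpha$ denotes the conjugate $\alpha^{-1}\circ g\circ\alpha$. Components and coloring: the basilica lamination consists of all arcs that occur in some arc diagram (these arcs are pairwise disjoint in the disk); its gaps are the complementary components of the union of these arcs in the open unit disk. The basilica (the Julia set of $p(z)=z^2-1$) is the quotient of $S^1$ obtained by identifying the two endpoints of each arc of the lamination, and gaps correspond bijectively to the bounded complementary regions of the basilica, called its components; two components are adjacent (have a common boundary point) exactly when the corresponding gaps border a common arc. Each $f\in T_B$ permutes the arcs of the lamination, and hence permutes the gaps (components): the image of the gap with set of bordering arcs $L$ is the gap with set of bordering arcs $f(L)$. The two-coloring colors each component according to the parity of the number of arcs of the lamination separating its gap from the central gap (the gap containing the center of the disk); thus adjacent components have different colors. Equivalently, the colors are the basins of attraction of the attracting fixed points $0$ and $-1$ of $p\circ p$.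 An element of $T_B$ preserves the two-coloring if it maps each component to a component of the same color. *)

theory Defs
  imports "HOL-Analysis.Analysis" "HOL-Algebra.Bij" "HOL-Algebra.Generated_Groups"
begin

text \<open>
  The circle \<open>\<real>/\<int>\<close> is the unit circle of the complex plane, a real \<open>\<theta>\<close> standing for the
  point \<open>exp (2\<pi>i\<theta>)\<close>.  An interval \<open>[a, b]\<close> of the circle is the image of a real interval,
  traversed counterclockwise from \<open>a\<close> to \<open>b\<close>; it may be shifted by an integer.
\<close>

abbreviation circle :: "complex set" where
  "circle \<equiv> sphere 0 1"

definition point :: "real \<Rightarrow> complex" where
  "point \<theta> = cis (2 * pi * \<theta>)"

definition segment :: "real \<Rightarrow> real \<Rightarrow> complex set" where
  "segment a b = point ` {a..b}"

text \<open>
  An arc is given by its set \<open>e = {point a, point b}\<close> of endpoints, so that the image of an arc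
  under a bijection \<open>f\<close> of the circle is \<open>f ` e\<close>.  The curve \<open>geodesic e\<close> is the
  hyperbolic geodesic of the closed unit disk with these endpoints.  If \<open>cos (\<pi>(a - b)) \<noteq> 0\<close>, its
  equation describes the circle with centre \<open>cis (\<pi>(a + b)) / cos (\<pi>(a - b))\<close> orthogonal to the
  unit circle; if \<open>cos (\<pi>(a - b)) = 0\<close>, the endpoints are antipodal and it describes the diameter
  joining them.  The equation is invariant under swapping \<open>a\<close> and \<open>b\<close> and under integer shifts of
  either of them (\<open>geodesic_eq\<close>, \<open>geodesic_orthogonal_circle\<close> below).
\<close>

definition geodesic :: "complex set \<Rightarrow> complex set" where
  "geodesic e = {z \<in> cball 0 1. \<exists>a b. e = {point a, point b} \<and>
     cos (pi * (a - b)) * (1 + (norm z)\<^sup>2) = 2 * Re (z * cis (- (pi * (a + b))))}"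

lemma point_eq_iff: "point a = point b \<longleftrightarrow> (\<exists>n::int. a = b + of_int n)"
proof
  assume "point a = point b"
  then have "sin (2*pi*a) = sin (2*pi*b) \<and> cos (2*pi*a) = cos (2*pi*b)"
    by (simp add: point_def cis.ctr)
  then obtain n :: int where "2*pi*a = 2*pi*b + 2*pi*n"
    using sin_cos_eq_iff by blast
  then have "2*pi*a = 2*pi*(b + n)" by (simp add: algebra_simps)
  then show "\<exists>n::int. a = b + of_int n" by (auto simp only: mult_cancel_left) auto
next
  assume "\<exists>n::int. a = b + of_int n"
  then obtain n :: int where "a = b + n" by blast
  then have "2*pi*a = 2*pi*b + 2*pi*n" by (simp add: algebra_simps)
  then show "point a = point b"
    using sin_cos_eq_iff by (metis point_def cis.ctr)
qed

lemma geodesic_eq: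
  "geodesic {point a, point b} =
     {z \<in> cball 0 1. cos (pi * (a - b)) * (1 + (norm z)\<^sup>2) = 2 * Re (z * cis (- (pi * (a + b))))}"
proof -
  let ?E = "\<lambda>a b z. cos (pi * (a - b)) * (1 + (norm z)\<^sup>2) = 2 * Re (z * cis (- (pi * (a + b))))"
  have E: "?E a b z \<longleftrightarrow>
      cos (pi * a - pi * b) * (1 + (norm z)\<^sup>2) = 2 * (Re z * cos (pi * a + pi * b) + Im z * sin (pi * a + pi * b))"
    for a b z by (simp only: cis.simps times_complex.simps sin_minus cos_minus distrib_left right_diff_distrib) simp
  have swap: "?E a b z \<longleftrightarrow> ?E b a z" for a b z
    unfolding E by (simp add: cos_diff cos_add sin_add mult.commute add.commute)
  have shift: "?E (a + of_int n) b z \<longleftrightarrow> ?E a b z" for a b z and n :: int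
  proof -
    have p: "pi * (a + of_int n) - pi * b = (pi * a - pi * b) + pi * of_int n"
      "pi * (a + of_int n) + pi * b = (pi * a + pi * b) + pi * of_int n"
      by (simp_all add: algebra_simps)
    have s: "sin (pi * of_int n) = 0" by (simp add: sin_zero_iff_int2 mult.commute)
    have "cos (pi * of_int n) = 1 \<or> cos (pi * of_int n) = -1"
      using s sin_zero_abs_cos_one by (metis abs_eq_iff abs_1)
    then show ?thesis
      unfolding E p cos_add[of _ "pi * of_int n"] sin_add[of _ "pi * of_int n"] s by auto
  qed
  have "?E c d z \<longleftrightarrow> ?E a b z" if "{point a, point b} = {point c, point d}" for c d z
  proof -
    have "(point a = point c \<and> point b = point d) \<or> (point a = point d \<and> point b = point c)"
      using that by (auto simp: doubleton_eq_iff)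
    then show ?thesis
      unfolding point_eq_iff using shift swap by (elim disjE conjE exE) metis+
  qed
  then show ?thesis unfolding geodesic_def by blast
qed

lemma geodesic_orthogonal_circle:
  assumes "cos (pi * (a - b)) \<noteq> 0"
  defines "c \<equiv> cis (pi * (a + b)) / of_real (cos (pi * (a - b)))"
  shows "geodesic {point a, point b} = {z \<in> cball 0 1. (norm (z - c))\<^sup>2 + 1 = (norm c)\<^sup>2}"
proof -
  let ?k = "cos (pi * (a - b))"
  have "(?k * (1 + (norm z)\<^sup>2) = 2 * Re (z * cis (- (pi * (a + b))))) \<longleftrightarrow>
        (norm (z - c))\<^sup>2 + 1 = (norm c)\<^sup>2" for z
  proof -
    have n: "(norm (z - c))\<^sup>2 = (norm z)\<^sup>2 - 2 * Re (z * cnj c) + (norm c)\<^sup>2"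
      by (simp add: cmod_power2 power2_diff)
    have r: "z * cnj c = z * cis (- (pi * (a + b))) / of_real ?k"
      by (simp add: c_def cis_cnj)
    have "Re (z * cnj c) = Re (z * cis (- (pi * (a + b)))) / ?k"
      unfolding r by (rule Re_divide_of_real)
    moreover have "k * (1 + x) = 2 * u \<longleftrightarrow> x - 2 * v + y + 1 = y" if "v = u / k" "k \<noteq> 0" for k x y u v :: real
    proof -
      have "k * (1 + x) = 2 * u \<longleftrightarrow> k * (1 + x) = k * (2 * v)" using that by simp
      also have "\<dots> \<longleftrightarrow> 1 + x = 2 * v" using that(2) by (simp only: mult_cancel_left) simp
      finally show ?thesis by linarith
    qed
    ultimately show ?thesis unfolding n using assms(1) by blast
  qed
  then show ?thesis unfolding geodesic_eq by blast
qed


subsection \<open>Arc diagrams and their 2-complexes\<close>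

text \<open>A diagram is a set of arcs; its vertices are the elements of \<open>\<Union>D\<close>.  The condition below
  says that \<open>[a, b]\<close> is an interval between consecutive vertices.\<close>

definition circle_interval :: "complex set set \<Rightarrow> real \<Rightarrow> real \<Rightarrow> bool" where
  "circle_interval D a b \<longleftrightarrow>
     a < b \<and> point a \<in> \<Union>D \<and> point b \<in> \<Union>D \<and> point ` {a<..<b} \<inter> \<Union>D = {}"

definition primary_arc :: "real \<Rightarrow> real \<Rightarrow> complex set" where
  "primary_arc a b = {point (a + (b - a) / 4), point (b - (b - a) / 4)}"

inductive arc_diagram :: "complex set set \<Rightarrow> bool" where
  base: "arc_diagram {{point (1/3), point (2/3)}, {point (1/6), point (5/6)}}"
| step: "arc_diagram D \<Longrightarrow> circle_interval D a b \<Longrightarrow> arc_diagram (insert (primary_arc a b) D)"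

definition complementary_regions :: "complex set set \<Rightarrow> complex set set" where
  "complementary_regions L = components (ball 0 1 - (\<Union>e\<in>L. geodesic e))"

text \<open>The closed cells of the 2-complex of a diagram; incidence of cells is inclusion.\<close>

definition vertex_cells :: "complex set set \<Rightarrow> complex set set" where
  "vertex_cells D = {{v} | v. v \<in> \<Union>D}"

definition arc_cells :: "complex set set \<Rightarrow> complex set set" where
  "arc_cells D = geodesic ` D"

definition interval_cells :: "complex set set \<Rightarrow> complex set set" where
  "interval_cells D = {segment a b | a b. circle_interval D a b}"

definition face_cells :: "complex set set \<Rightarrow> complex set set" where
  "face_cells D = closure ` complementary_regions D"

definition cells :: "complex set set \<Rightarrow> complex set set" where
  "cells D = vertex_cells D \<union> arc_cells D \<union> interval_cells D \<union> face_cells D"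

definition complex_iso ::
  "complex set set \<Rightarrow> complex set set \<Rightarrow> (complex set \<Rightarrow> complex set) \<Rightarrow> bool" where
  "complex_iso D R \<phi> \<longleftrightarrow>
     bij_betw \<phi> (vertex_cells D) (vertex_cells R) \<and>
     bij_betw \<phi> (arc_cells D) (arc_cells R) \<and>
     bij_betw \<phi> (interval_cells D) (interval_cells R) \<and>
     bij_betw \<phi> (face_cells D) (face_cells R) \<and>
     (\<forall>s\<in>cells D. \<forall>t\<in>cells D. s \<subseteq> t \<longleftrightarrow> \<phi> s \<subseteq> \<phi> t)"

text \<open>The isomorphism respects the counterclockwise direction of the boundary circle: initial
  vertices of circle intervals go to initial vertices, terminal ones to terminal ones.\<close>

definition orientation_preserving ::
  "complex set set \<Rightarrow> complex set set \<Rightarrow> (complex set \<Rightarrow> complex set) \<Rightarrow> bool" where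
  "orientation_preserving D R \<phi> \<longleftrightarrow>
     (\<forall>a b. circle_interval D a b \<longrightarrow>
       (\<exists>c d. circle_interval R c d \<and> \<phi> (segment a b) = segment c d \<and>
              \<phi> {point a} = {point c} \<and> \<phi> {point b} = {point d}))"


subsection \<open>Dyadic rearrangements\<close>

definition maps_linearly ::
  "(complex \<Rightarrow> complex) \<Rightarrow> real \<Rightarrow> real \<Rightarrow> real \<Rightarrow> real \<Rightarrow> bool" where
  "maps_linearly f a b c d \<longleftrightarrow>
     (\<forall>t\<in>{0..1}. f (point (a + t * (b - a))) = point (c + t * (d - c)))"

text \<open>\<open>Bij circle\<close> is the set of bijections of the circle, with value \<open>undefined\<close> off the circle.
  Continuity and preservation of the orientation follow from the linearity on the intervals.\<close>

definition dyadic_rearrangements :: "(complex \<Rightarrow> complex) set" where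
  "dyadic_rearrangements = {f \<in> Bij circle. \<exists>D R \<phi>. arc_diagram D \<and> arc_diagram R \<and>
     complex_iso D R \<phi> \<and> orientation_preserving D R \<phi> \<and>
     (\<forall>a b c d. circle_interval D a b \<and> circle_interval R c d \<and> \<phi> (segment a b) = segment c d
        \<longrightarrow> maps_linearly f a b c d)}"

definition T_B :: "(complex \<Rightarrow> complex) monoid" where
  "T_B = (BijGroup circle)\<lparr>carrier := dyadic_rearrangements\<rparr>"

text \<open>The map given by a list of breakpoints and their images, the list covering the circle
  exactly once (its last entry is the first one shifted by 1 in both coordinates).\<close>

definition pl_map :: "(real \<times> real) list \<Rightarrow> complex \<Rightarrow> complex" where
  "pl_map ps = (THE f. f \<in> extensional circle \<and>
     successively (\<lambda>(a, c) (b, d). maps_linearly f a b c d) ps)"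

definition \<alpha>\<^sub>B :: "complex \<Rightarrow> complex" where
  "\<alpha>\<^sub>B = pl_map [(-1/3, -1/6), (1/3, 1/6), (2/3, 5/6)]"

definition \<beta>\<^sub>B :: "complex \<Rightarrow> complex" where
  "\<beta>\<^sub>B = pl_map [(-1/6, -1/6), (1/6, 1/6), (2/3, 7/24), (17/24, 1/3), (5/6, 5/6)]"

definition \<gamma>\<^sub>B :: "complex \<Rightarrow> complex" where
  "\<gamma>\<^sub>B = pl_map [(-2/3, -2/3), (1/6, 1/6), (7/24, 19/96), (29/96, 5/24), (1/3, 1/3)]"

definition \<delta>\<^sub>B :: "complex \<Rightarrow> complex" where
  "\<delta>\<^sub>B = pl_map [(0, 1/2), (1, 3/2)]"

definition conj_\<alpha> :: "(complex \<Rightarrow> complex) \<Rightarrow> complex \<Rightarrow> complex" where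
  "conj_\<alpha> g = inv\<^bsub>BijGroup circle\<^esub> \<alpha>\<^sub>B \<otimes>\<^bsub>BijGroup circle\<^esub> g \<otimes>\<^bsub>BijGroup circle\<^esub> \<alpha>\<^sub>B"


subsection \<open>Components of the basilica and their coloring\<close>

definition lamination :: "complex set set" where
  "lamination = \<Union>{D. arc_diagram D}"

text \<open>The components of the basilica are represented by the gaps of the lamination.\<close>

definition gaps :: "complex set set" where
  "gaps = complementary_regions lamination"

definition bordering_arcs :: "complex set \<Rightarrow> complex set set" where
  "bordering_arcs G = {e \<in> lamination. geodesic e \<subseteq> closure G}"

definition central_gap :: "complex set" where
  "central_gap = (THE G. G \<in> gaps \<and> 0 \<in> G)"

definition separates :: "complex set \<Rightarrow> complex set \<Rightarrow> complex set \<Rightarrow> bool" where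
  "separates e G H \<longleftrightarrow>
     (\<forall>x\<in>G. \<forall>y\<in>H. \<not> connected_component (ball 0 1 - geodesic e) x y)"

definition color :: "complex set \<Rightarrow> bool" where
  "color G \<longleftrightarrow> even (card {e \<in> lamination. separates e G central_gap})"

definition gap_image :: "(complex \<Rightarrow> complex) \<Rightarrow> complex set \<Rightarrow> complex set" where
  "gap_image f G = (THE H. H \<in> gaps \<and> bordering_arcs H = (`) f ` bordering_arcs G)"

definition preserves_coloring :: "(complex \<Rightarrow> complex) \<Rightarrow> bool" where
  "preserves_coloring f \<longleftrightarrow> (\<forall>G\<in>gaps. color (gap_image f G) = color G)"

end

theory Submission imports Defs begin

text \<open>
  The theorem rests on three facts about a dyadic rearrangement: it can be described by
  combinatorial data on the circle alone, it is a product of \<open>\<alpha>, \<beta>, \<gamma>, \<delta>\<close>, and it either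
  preserves the colours of all gaps or changes the colours of all gaps.

  \<^item> Geometry.  The map \<open>z \<mapsto> 2z / (1 + |z|\<^sup>2)\<close> from the disk to the Klein model fixes the circle
  and turns geodesics into chords.  Hence the complementary regions of a family of geodesics are
  intersections of half-planes there, and they, their closures and the arcs bordering them are
  described by the signs of linear functions (\<open>connected_component_region\<close>,
  \<open>closure_region\<close>).  An arc or a face of a diagram is determined by its trace on the circle
  (\<open>inner_cell_trace\<close>), because the closure of a region contains two arcs of the lamination.
  Therefore an isomorphism of the 2-complexes carries no more information than a bijection of the
  circle that maps arcs to arcs and is linear on the intervals (\<open>dyadic_iff_rearranges\<close>).  With
  this description a common refinement of two diagrams shows that \<open>T\<^sub>B\<close> is a group.

  \<^item> Generation.  The intervals of a diagram are the leaves of two ternary trees, one for each of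
  the intervals \<open>[1/3, 2/3]\<close> and \<open>[2/3, 4/3]\<close>.  Let \<open>K\<close> be a subgroup that contains the four
  generators.  It acts transitively on the intervals of each of two types
  (\<open>piece_linked\<close>), and therefore contains a tree rotation supported in every interval
  (\<open>piece_rotation\<close>).  Rotations bring every tree into a normal form, in which all left children
  are leaves.  An element of the stabilizer of the two endpoints of \<open>{1/3, 2/3}\<close> that maps the
  leaves of normal trees to those of normal trees is the identity (\<open>normal_trees_agree\<close>), since
  it fixes one endpoint after the other.  So \<open>K\<close> contains all of \<open>T\<^sub>B\<close> (\<open>dyadic_in_K\<close>).

  \<^item> The commutator subgroup contains \<open>\<beta>, \<gamma>, \<delta>\<close>.  Rotations of an interval and of its two
  outer quarters satisfy the pentagon relation \<open>f\<^sup>2 = r f l\<close>.  If \<open>l\<close> and \<open>r\<close> are conjugate to \<open>f\<close>,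
  then \<open>f\<close> is trivial in the abelianization, which settles \<open>\<gamma>\<close>; if they are conjugate to
  \<open>\<gamma>\<^sup>-\<^sup>1\<close>, then again \<open>f\<close> is trivial, which settles \<open>\<beta>\<close>.  Finally \<open>\<delta>\<^sup>2 = (\<delta>\<beta>)\<^sup>3 = 1\<close> gives \<open>\<delta>\<close>.
  The commutator subgroup is normal, so it contains the group \<open>H\<close> generated by the six elements.
  As \<open>\<alpha>\<^sup>2\<close> belongs to \<open>H\<close> and \<open>\<alpha>\<close> normalizes \<open>H\<close>, the union \<open>H \<union> \<alpha> H\<close> is a subgroup, hence all
  of \<open>T\<^sub>B\<close> (\<open>T_B_cosets\<close>).

  \<^item> Colours.  A rearrangement maps the arcs that separate two gaps to the arcs that separate
  their images, so it acts on the two colours, and this action is a homomorphism from \<open>T\<^sub>B\<close> to a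
  group of order two (\<open>preserves_coloring_compose\<close>).  Its kernel \<open>E\<close> contains the commutator
  subgroup but not \<open>\<alpha>\<close>, which maps the central gap to a neighbour (\<open>\<alpha>_not_preserves_coloring\<close>).
  Thus \<open>H\<close> is contained in the commutator subgroup, the commutator subgroup is contained in \<open>E\<close>,
  and an element of \<open>E\<close> cannot lie in \<open>\<alpha> H\<close>; the three groups coincide and have index two.
\<close>

section \<open>Points of the circle and linear maps\<close>

lemma point_in_circle [simp]: "point x \<in> circle"
  by (simp add: point_def)

lemma norm_point [simp]: "norm (point x) = 1"
  by (simp add: point_def)

lemma point_add_int [simp]: "point (x + of_int n) = point x"
  using point_eq_iff by blast

lemma point_add_one [simp]: "point (x + 1) = point x"
  using point_add_int[of x 1] by simp

lemma point_inj: "point x = point y \<Longrightarrow> \<bar>x - y\<bar> < 1 \<Longrightarrow> x = y"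
proof -
  assume a: "point x = point y" and b: "\<bar>x - y\<bar> < 1"
  obtain n :: int where n: "x = y + of_int n" using a point_eq_iff by blast
  have "\<bar>real_of_int n\<bar> < 1" using n b by simp
  hence "n = 0" by linarith
  thus ?thesis using n by simp
qed

lemma circle_point:
  assumes "z \<in> circle"
  obtains x where "p \<le> x" "x < p + 1" "z = point x"
proof -
  have "cmod z = 1" using assms by simp
  hence z: "z = cis (Arg z)" by (metis norm_eq_zero of_real_1 rcis_cmod_Arg rcis_def mult_1 zero_neq_one)
  define y where "y = Arg z / (2 * pi)"
  have zy: "z = point y" using z by (simp add: y_def point_def)
  define x where "x = y + of_int (- \<lfloor>y - p\<rfloor>)"
  have "point x = z" unfolding x_def using zy point_add_int by metis
  moreover have "p \<le> x" "x < p + 1" unfolding x_def by (simp_all, linarith+)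
  ultimately show ?thesis using that by metis
qed

lemma maps_linearlyI:
  assumes "a < b" "\<And>x. a \<le> x \<Longrightarrow> x \<le> b \<Longrightarrow> f (point x) = point (c + (x - a) * (d - c) / (b - a))"
  shows "maps_linearly f a b c d"
  unfolding maps_linearly_def
proof
  fix t :: real assume t: "t \<in> {0..1}"
  have "t * (b - a) \<le> b - a" using t assms(1) by (simp add: mult_left_le_one_le)
  moreover have "0 \<le> t * (b - a)" using t assms(1) by simp
  ultimately have "f (point (a + t * (b - a))) = point (c + (a + t * (b - a) - a) * (d - c) / (b - a))"
    by (intro assms(2)) linarith+
  thus "f (point (a + t * (b - a))) = point (c + t * (d - c))" using assms(1) by simp
qed

lemma maps_linearlyD:
  assumes "maps_linearly f a b c d" "a < b" "a \<le> x" "x \<le> b"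
  shows "f (point x) = point (c + (x - a) * (d - c) / (b - a))"
proof -
  define t where "t = (x - a) / (b - a)"
  have t: "t \<in> {0..1}" "a + t * (b - a) = x" using assms by (auto simp: t_def divide_simps)
  have "f (point (a + t * (b - a))) = point (c + t * (d - c))" using assms(1) t(1) unfolding maps_linearly_def by blast
  thus ?thesis unfolding t(2) by (simp add: t_def)
qed

lemma maps_linearly_ends:
  assumes "maps_linearly f a b c d" shows "f (point a) = point c" "f (point b) = point d"
  using assms unfolding maps_linearly_def by (metis add.right_neutral atLeastAtMost_iff mult_zero_left order_refl zero_le_one,
    metis add_diff_cancel_left' atLeastAtMost_iff diff_add_cancel mult_1 order_refl zero_le_one add.commute)

lemma maps_linearly_sub:
  assumes "maps_linearly f a b c d" "0 \<le> s" "s \<le> t" "t \<le> 1"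
  shows "maps_linearly f (a + s * (b - a)) (a + t * (b - a)) (c + s * (d - c)) (c + t * (d - c))"
  unfolding maps_linearly_def
proof
  fix u :: real assume u: "u \<in> {0..1}"
  let ?v = "s + u * (t - s)"
  have "u * (t - s) \<le> t - s" "0 \<le> u * (t - s)" using u assms by (simp_all add: mult_left_le_one_le)
  hence "?v \<in> {0..1}" using assms by auto
  hence "f (point (a + ?v * (b - a))) = point (c + ?v * (d - c))" using assms(1) unfolding maps_linearly_def by blast
  thus "f (point (a + s * (b - a) + u * (a + t * (b - a) - (a + s * (b - a))))) =
         point (c + s * (d - c) + u * (c + t * (d - c) - (c + s * (d - c))))"
    by (simp add: algebra_simps)
qed

lemma maps_linearly_shift [simp]:
  "maps_linearly f (a + of_int m) (b + of_int m) c d = maps_linearly f a b c d"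
  "maps_linearly f a b (c + of_int m) (d + of_int m) = maps_linearly f a b c d"
proof -
  have *: "x + of_int m + t * (y + of_int m - (x + of_int m)) = x + t * (y - x) + of_int m" for x y t :: real by simp
  show "maps_linearly f (a + of_int m) (b + of_int m) c d = maps_linearly f a b c d"
    "maps_linearly f a b (c + of_int m) (d + of_int m) = maps_linearly f a b c d"
    unfolding maps_linearly_def * point_add_int by auto
qed

lemma maps_linearly_image:
  assumes "maps_linearly f a b c d" "a < b" "c < d"
  shows "f ` segment a b = segment c d"
proof -
  have seg: "segment x y = (\<lambda>t. point (x + t * (y - x))) ` {0..1}" if "x < y" for x y
  proof -
    have "{x..y} = (\<lambda>t. x + t * (y - x)) ` {0..1}"
    proof (intro equalityI subsetI)
      fix z assume "z \<in> {x..y}"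
      hence "z = x + ((z - x) / (y - x)) * (y - x)" "(z - x) / (y - x) \<in> {0..1}" using that by (auto simp: divide_simps)
      thus "z \<in> (\<lambda>t. x + t * (y - x)) ` {0..1}" by blast
    next
      fix z assume "z \<in> (\<lambda>t. x + t * (y - x)) ` {0..1}"
      then obtain t where "t \<in> {0..1}" "z = x + t * (y - x)" by blast
      moreover from this have "t * (y - x) \<le> y - x" "0 \<le> t * (y - x)" using that by (simp_all add: mult_left_le_one_le)
      ultimately show "z \<in> {x..y}" by simp
    qed
    thus ?thesis by (simp add: segment_def image_image)
  qed
  show ?thesis unfolding seg[OF assms(2)] seg[OF assms(3)] image_image
    using assms(1) by (intro image_cong) (auto simp: maps_linearly_def)
qed

lemma maps_linearly_comp:
  assumes "maps_linearly f a b c d" "maps_linearly g c d u v"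
  shows "maps_linearly (compose circle g f) a b u v"
  using assms unfolding maps_linearly_def compose_def restrict_def by simp

section \<open>Consecutive elements of a periodic set of angles\<close>

definition vertex_angles :: "complex set set \<Rightarrow> real set" where
  "vertex_angles D = {x. point x \<in> \<Union>D}"

definition periodic :: "real set \<Rightarrow> bool" where
  "periodic V \<longleftrightarrow> (\<forall>x. \<forall>n::int. x + of_int n \<in> V \<longleftrightarrow> x \<in> V)"

definition consecutive :: "real set \<Rightarrow> real \<Rightarrow> real \<Rightarrow> bool" where
  "consecutive V a b \<longleftrightarrow> a < b \<and> a \<in> V \<and> b \<in> V \<and> V \<inter> {a<..<b} = {}"

lemma circle_interval_consecutive: "circle_interval D a b \<longleftrightarrow> consecutive (vertex_angles D) a b"
  unfolding circle_interval_def consecutive_def vertex_angles_def by auto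

lemma periodic_vertex_angles [simp]: "periodic (vertex_angles D)"
  by (simp add: periodic_def vertex_angles_def)

lemma periodicD: "periodic V \<Longrightarrow> x + of_int n \<in> V \<longleftrightarrow> x \<in> V"
  by (simp add: periodic_def)

lemma consecutive_shift:
  assumes "periodic V" shows "consecutive V (a + of_int n) (b + of_int n) \<longleftrightarrow> consecutive V a b"
proof -
  have "V \<inter> {a + of_int n<..<b + of_int n} = {} \<longleftrightarrow> V \<inter> {a<..<b} = {}"
  proof -
    have "x \<in> V \<inter> {a<..<b} \<Longrightarrow> x + of_int n \<in> V \<inter> {a + of_int n<..<b + of_int n}" for x
      using periodicD[OF assms] by auto
    moreover have "x \<in> V \<inter> {a + of_int n<..<b + of_int n} \<Longrightarrow> x + of_int (-n) \<in> V \<inter> {a<..<b}" for x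
      using periodicD[OF assms, of x "-n"] by auto
    ultimately show ?thesis by blast
  qed
  thus ?thesis using periodicD[OF assms] by (auto simp: consecutive_def)
qed

lemma circle_interval_shift [simp]:
  "circle_interval D (a + of_int n) (b + of_int n) \<longleftrightarrow> circle_interval D a b"
  by (simp add: circle_interval_consecutive consecutive_shift)

lemma consecutive_overlap:
  assumes "consecutive V a b" "consecutive V c d" "a < d" "c < b"
  shows "a = c \<and> b = d"
proof -
  have "\<not> (c < a \<and> a < d)" "\<not> (a < c \<and> c < b)" "\<not> (c < b \<and> b < d)" "\<not> (a < d \<and> d < b)"
    using assms(1,2) unfolding consecutive_def by auto
  thus ?thesis using assms unfolding consecutive_def by force
qed

text \<open>Adding two points \<open>p < q\<close> inside \<open>[a, b]\<close>, together with their integer translates, only affects the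
translates of \<open>[a, b]\<close>: consecutive points are at distance at most 1, so no translate of \<open>p\<close> or \<open>q\<close>
other than itself lies in \<open>[a, b]\<close>.\<close>

lemma consecutive_insert:
  assumes per: "periodic V" and con: "consecutive V a b" and o: "a < p" "p < q" "q < b"
  defines "V' \<equiv> V \<union> {x. \<exists>n::int. x = p + of_int n \<or> x = q + of_int n}"
  shows "consecutive V' c d \<longleftrightarrow>
    (consecutive V c d \<and> \<not> (\<exists>n::int. c = a + of_int n \<and> d = b + of_int n)) \<or>
    (\<exists>n::int. (c + of_int n, d + of_int n) \<in> {(a, p), (p, q), (q, b)})"
proof -
  have per': "periodic V'"
    unfolding periodic_def V'_def using periodicD[OF per]
    by (auto simp: algebra_simps) (metis add_diff_eq add_diff_cancel_left' of_int_diff of_int_add add.commute diff_add_cancel)+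
  have ab1: "b \<le> a + 1"
  proof -
    have "a + 1 \<in> V" using periodicD[OF per, of a 1] con by (simp add: consecutive_def)
    thus ?thesis using con by (auto simp: consecutive_def)
  qed
  have noshift: "x + of_int n \<notin> {a<..<b}" if "x \<in> {a<..<b}" "n \<noteq> 0" for x and n :: int
  proof -
    have "n \<ge> 1 \<or> n \<le> -1" using that(2) by linarith
    hence "real_of_int n \<ge> 1 \<or> real_of_int n \<le> -1" by linarith
    thus ?thesis using that(1) ab1 by auto
  qed
  have V'in: "x \<in> V' \<and> a < x \<and> x < b \<longleftrightarrow> x = p \<or> x = q" for x
  proof
    assume x: "x \<in> V' \<and> a < x \<and> x < b"
    hence "x \<notin> V" using con by (auto simp: consecutive_def)
    then obtain n :: int where "x = p + of_int n \<or> x = q + of_int n" using x unfolding V'_def by auto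
    thus "x = p \<or> x = q" using noshift[of p n] noshift[of q n] o x by (cases "n = 0") auto
  next
    assume "x = p \<or> x = q"
    moreover have "p \<in> V'" "q \<in> V'" unfolding V'_def by (auto intro: exI[of _ "0::int"])
    ultimately show "x \<in> V' \<and> a < x \<and> x < b" using o by auto
  qed
  have sub: "V \<subseteq> V'" by (auto simp: V'_def)
  have mem: "a \<in> V'" "b \<in> V'" "p \<in> V'" "q \<in> V'" using con sub V'in by (auto simp: consecutive_def)
  have gap: "V' \<inter> {u<..<v} = {}" if "a \<le> u" "v \<le> b" "\<not> (u < p \<and> p < v)" "\<not> (u < q \<and> q < v)" for u v
  proof -
    have "x \<notin> V'" if "u < x" "x < v" for x
      using V'in[of x] that \<open>a \<le> u\<close> \<open>v \<le> b\<close> \<open>\<not> (u < p \<and> p < v)\<close> \<open>\<not> (u < q \<and> q < v)\<close> by force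
    thus ?thesis by auto
  qed
  have ch: "consecutive V' a p" "consecutive V' p q" "consecutive V' q b"
    unfolding consecutive_def using mem o gap[of a p] gap[of p q] gap[of q b] by simp_all
  show ?thesis
  proof
    assume cd: "consecutive V' c d"
    show "(consecutive V c d \<and> \<not> (\<exists>n::int. c = a + of_int n \<and> d = b + of_int n)) \<or>
    (\<exists>n::int. (c + of_int n, d + of_int n) \<in> {(a, p), (p, q), (q, b)})"
    proof (cases "c \<in> V \<and> d \<in> V")
      case True
      hence "consecutive V c d" using cd sub unfolding consecutive_def by auto
      moreover have "\<not> (c = a + of_int n \<and> d = b + of_int n)" for n :: int
      proof
        assume e: "c = a + of_int n \<and> d = b + of_int n"
        hence "consecutive V' a b" using cd consecutive_shift[OF per'] by simp
        thus False using V'in[of p] o by (auto simp: consecutive_def)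
      qed
      ultimately show ?thesis by blast
    next
      case False
      have new: "\<exists>n::int. x + of_int n = p \<or> x + of_int n = q" if new: "x \<in> V'" "x \<notin> V" for x
      proof -
        obtain n :: int where "x = p + of_int n \<or> x = q + of_int n" using new unfolding V'_def by blast
        hence "x + of_int (-n) = p \<or> x + of_int (-n) = q" by auto
        thus ?thesis by blast
      qed
      have cd': "consecutive V' (c + of_int n) (d + of_int n)" for n :: int
        using cd consecutive_shift[OF per'] by simp
      have lt: "c + of_int n < d + of_int n" for n :: int using cd by (simp add: consecutive_def)
      from False cd new[of c] new[of d] obtain n :: int where
        "c + of_int n = p \<or> c + of_int n = q \<or> d + of_int n = p \<or> d + of_int n = q"
        unfolding consecutive_def by blast
      hence "(c + of_int n, d + of_int n) \<in> {(a, p), (p, q), (q, b)}"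
        using consecutive_overlap[OF cd'[of n] ch(1)] consecutive_overlap[OF cd'[of n] ch(2)]
          consecutive_overlap[OF cd'[of n] ch(3)] o lt[of n] by (elim disjE) auto
      thus ?thesis by blast
    qed
  next
    assume "(consecutive V c d \<and> \<not> (\<exists>n::int. c = a + of_int n \<and> d = b + of_int n)) \<or>
    (\<exists>n::int. (c + of_int n, d + of_int n) \<in> {(a, p), (p, q), (q, b)})"
    thus "consecutive V' c d"
    proof
      assume as: "consecutive V c d \<and> \<not> (\<exists>n::int. c = a + of_int n \<and> d = b + of_int n)"
      have "x \<notin> {c<..<d}" if new: "x \<in> V'" for x
      proof
        assume xc: "x \<in> {c<..<d}"
        hence "x \<notin> V" using as by (auto simp: consecutive_def)
        then obtain n :: int where n: "x = p + of_int n \<or> x = q + of_int n" using new unfolding V'_def by blast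
        have "consecutive V (a + of_int n) (b + of_int n)" using con consecutive_shift[OF per] by simp
        hence "a + of_int n = c \<and> b + of_int n = d" using consecutive_overlap n xc o as by fastforce
        thus False using as by auto
      qed
      thus ?thesis using as sub unfolding consecutive_def by auto
    next
      assume "\<exists>n::int. (c + of_int n, d + of_int n) \<in> {(a, p), (p, q), (q, b)}"
      then obtain n :: int where "(c + of_int n, d + of_int n) \<in> {(a, p), (p, q), (q, b)}" by blast
      hence "consecutive V' (c + of_int n) (d + of_int n)" using ch by auto
      thus ?thesis using consecutive_shift[OF per'] by simp
    qed
  qed
qed

section \<open>Pieces and arc diagrams\<close>

text \<open>The interval \<open>[2/3, 4/3]\<close> and the intervals that occur in diagrams, lifted to \<open>[1/3, 4/3]\<close>, with the
number of subdivisions that produce them.  The Boolean value tells whether the two endpoints are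
joined by an arc of the lamination: this is so for the two initial intervals, where the arc is
\<open>{1/3, 2/3}\<close>, and for the middle interval of each subdivision.  These are the two orbits of
intervals under the group.\<close>

inductive piece :: "nat \<Rightarrow> bool \<Rightarrow> real \<Rightarrow> real \<Rightarrow> bool" where
  pieceA: "piece 0 True (1/3) (2/3)"
| pieceB: "piece 0 True (2/3) (4/3)"
| left: "piece n t a b \<Longrightarrow> piece (Suc n) False a (a + (b - a) / 4)"
| middle: "piece n t a b \<Longrightarrow> piece (Suc n) True (a + (b - a) / 4) (b - (b - a) / 4)"
| right: "piece n t a b \<Longrightarrow> piece (Suc n) False (b - (b - a) / 4) b"

abbreviation children :: "real \<Rightarrow> real \<Rightarrow> (real \<times> real) set" where
  "children a b \<equiv> {(a, a + (b - a) / 4), (a + (b - a) / 4, b - (b - a) / 4), (b - (b - a) / 4, b)}"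

definition in_child :: "real \<Rightarrow> real \<Rightarrow> real \<Rightarrow> real \<Rightarrow> bool" where
  "in_child c d a b \<longleftrightarrow> (\<exists>(u, v) \<in> children a b. u \<le> c \<and> d \<le> v)"

lemma piece_bounds: "piece n t a b \<Longrightarrow> 1/3 \<le> a \<and> a < b \<and> b \<le> 4/3"
  by (induction rule: piece.induct) (simp_all add: field_simps)

lemma piece_length: "piece n t a b \<Longrightarrow> b - a \<le> (2/3) / 2 ^ n"
  by (induction rule: piece.induct) (auto simp: field_simps)

lemma children_bounds: "(c, d) \<in> children a b \<Longrightarrow> a < b \<Longrightarrow> a \<le> c \<and> c < d \<and> d \<le> b"
  by (auto simp: field_simps)

lemma children_disjoint:
  "(c, d) \<in> children a b \<Longrightarrow> (c', d') \<in> children a b \<Longrightarrow> a < b \<Longrightarrow>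
    (c = c' \<and> d = d') \<or> d \<le> c' \<or> d' \<le> c"
  by (auto simp: field_simps)

lemma piece_Suc:
  assumes "piece (Suc n) t a b"
  obtains s u v where "piece n s u v" "(a, b) \<in> children u v" "t \<longleftrightarrow> (a, b) = (u + (v - u) / 4, v - (v - u) / 4)"
  using assms
proof (cases rule: piece.cases)
  case (left s b')
  thus ?thesis using that[of s a b'] piece_bounds[of n s a b'] by auto
next
  case (middle t a' b')
  thus ?thesis using that[of t a' b'] by auto
next
  case (right s a')
  thus ?thesis using that[of s a' b] piece_bounds[of n s a' b] by auto
qed

lemma finite_pieces: "finite {(a, b). \<exists>t. piece n t a b}"
proof (induction n)
  case 0
  have "{(a, b). \<exists>t. piece 0 t a b} \<subseteq> {(1/3, 2/3), (2/3, 4/3)}" by (auto elim: piece.cases)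
  thus ?case using finite_subset by blast
next
  case (Suc n)
  have "{(a, b). \<exists>t. piece (Suc n) t a b} \<subseteq> (\<Union>(a, b) \<in> {(a, b). \<exists>t. piece n t a b}. children a b)"
    by clarify (erule piece_Suc, blast)
  moreover have "finite (\<Union>(a, b) \<in> {(a, b). \<exists>t. piece n t a b}. children a b)" using Suc by auto
  ultimately show ?case using finite_subset by blast
qed

lemma piece_same_level:
  "piece n t a b \<Longrightarrow> piece n t' c d \<Longrightarrow> (a = c \<and> b = d \<and> t = t') \<or> b \<le> c \<or> d \<le> a"
proof (induction n arbitrary: t a b t' c d)
  case 0 thus ?case by (auto elim!: piece.cases[of 0])
next
  case (Suc n)
  obtain s u v where 1: "piece n s u v" "(a, b) \<in> children u v" "t \<longleftrightarrow> (a, b) = (u + (v - u) / 4, v - (v - u) / 4)"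
    using Suc.prems(1) piece_Suc by blast
  obtain s' u' v' where 2: "piece n s' u' v'" "(c, d) \<in> children u' v'" "t' \<longleftrightarrow> (c, d) = (u' + (v' - u') / 4, v' - (v' - u') / 4)"
    using Suc.prems(2) piece_Suc by blast
  have uv: "u < v" "u' < v'" using piece_bounds 1 2 by auto
  from Suc.IH[OF 1(1) 2(1)] consider "u = u'" "v = v'" | "v \<le> u'" | "v' \<le> u" by blast
  thus ?case
  proof cases
    case 1
    have "(a = c \<and> b = d) \<or> b \<le> c \<or> d \<le> a"
      using children_disjoint[OF \<open>(a, b) \<in> children u v\<close>, of c d] 2 uv 1 by blast
    thus ?thesis using 1 2(3) \<open>t \<longleftrightarrow> (a, b) = _\<close> by (elim disjE) simp_all
  qed (use children_bounds[OF 1(2) uv(1)] children_bounds[OF 2(2) uv(2)] in linarith)+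
qed

lemma in_child_self: "(c, d) \<in> children a b \<Longrightarrow> in_child c d a b"
  unfolding in_child_def by blast

lemma in_child_subset: "in_child c d a b \<Longrightarrow> a < b \<Longrightarrow> a \<le> c \<and> d \<le> b"
  unfolding in_child_def by (auto simp: field_simps)

lemma in_child_trans:
  assumes "u \<le> c" "d \<le> v" "in_child u v a b" shows "in_child c d a b"
  using assms order_trans unfolding in_child_def by blast

lemma piece_ancestor: "piece m t c d \<Longrightarrow> n < m \<Longrightarrow> \<exists>t' a b. piece n t' a b \<and> in_child c d a b"
proof (induction m arbitrary: t c d)
  case (Suc m)
  obtain s u v where 1: "piece m s u v" "(c, d) \<in> children u v"
    using Suc.prems(1) piece_Suc by blast
  have uv: "u \<le> c" "d \<le> v" using children_bounds[OF 1(2)] piece_bounds[OF 1(1)] by auto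
  show ?case
  proof (cases "n = m")
    case True thus ?thesis using 1 in_child_self by blast
  next
    case False
    hence "n < m" using Suc.prems by simp
    thus ?thesis using Suc.IH[OF 1(1)] in_child_trans[OF uv] by blast
  qed
qed simp

text \<open>Pieces of equal depth have disjoint interiors, and a piece lies in a child of each of its proper
ancestors.\<close>

lemma piece_nested:
  assumes "piece n t a b" "piece m t' c d"
  shows "(a = c \<and> b = d \<and> n = m \<and> t = t') \<or> b \<le> c \<or> d \<le> a \<or> in_child c d a b \<or> in_child a b c d"
proof (rule linorder_cases[of n m])
  assume "n = m" thus ?thesis using assms piece_same_level by blast
next
  assume "n < m"
  then obtain s u v where s: "piece n s u v" "in_child c d u v" using piece_ancestor assms(2) by blast
  show ?thesis using piece_same_level[OF assms(1) s(1)] s(2) in_child_subset[OF s(2)] piece_bounds[OF s(1)] by auto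
next
  assume "m < n"
  then obtain s u v where s: "piece m s u v" "in_child a b u v" using piece_ancestor assms(1) by blast
  show ?thesis using piece_same_level[OF assms(2) s(1)] s(2) in_child_subset[OF s(2)] piece_bounds[OF s(1)] by auto
qed

abbreviation arcA :: "complex set" where "arcA \<equiv> {point (1/3), point (2/3)}"

lemma primary_arc_shift [simp]: "primary_arc (a + of_int n) (b + of_int n) = primary_arc a b"
proof -
  have "a + of_int n + (b + of_int n - (a + of_int n)) / 4 = (a + (b - a) / 4) + of_int n"
    "b + of_int n - (b + of_int n - (a + of_int n)) / 4 = (b - (b - a) / 4) + of_int n" by (simp_all add: field_simps)
  thus ?thesis unfolding primary_arc_def by (simp only: point_add_int)
qed

lemma primary_arc_B: "primary_arc (2/3) (4/3) = {point (1/6), point (5/6)}"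
  using point_add_one[of "1/6"] by (auto simp: primary_arc_def)

lemma base_diagram: "arc_diagram (insert (primary_arc (2/3) (4/3)) {arcA})"
  using arc_diagram.base unfolding primary_arc_B by (simp add: insert_commute)

lemma vertex_angles_insert:
  "vertex_angles (insert (primary_arc a b) D) =
    vertex_angles D \<union> {x. \<exists>n::int. x = (a + (b - a) / 4) + of_int n \<or> x = (b - (b - a) / 4) + of_int n}"
  unfolding vertex_angles_def primary_arc_def by (auto simp: point_eq_iff)

lemma circle_interval_less: "circle_interval D a b \<Longrightarrow> a < b"
  by (simp add: circle_interval_def)

lemma circle_interval_insert:
  assumes "circle_interval D a b"
  shows "circle_interval (insert (primary_arc a b) D) c d \<longleftrightarrow>
    (circle_interval D c d \<and> \<not> (\<exists>n::int. c = a + of_int n \<and> d = b + of_int n)) \<or>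
    (\<exists>n::int. (c + of_int n, d + of_int n) \<in> children a b)"
proof -
  have "a < a + (b - a) / 4" "a + (b - a) / 4 < b - (b - a) / 4" "b - (b - a) / 4 < b"
    using circle_interval_less[OF assms] by (simp_all add: field_simps)
  thus ?thesis
    unfolding circle_interval_consecutive vertex_angles_insert
    by (intro consecutive_insert) (simp_all add: assms[unfolded circle_interval_consecutive])
qed

text \<open>The recursion starts from the single arc \<open>{1/3, 2/3}\<close> with its two intervals.  The second initial
arc \<open>{1/6, 5/6}\<close> is the primary arc of \<open>[2/3, 4/3]\<close>, so it fits into the general step.\<close>

lemma circle_interval_arcA:
  "circle_interval {arcA} c d \<longleftrightarrow> (\<exists>n::int. (c + of_int n, d + of_int n) \<in> {(1/3, 2/3), (2/3, 4/3)})"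
proof -
  let ?V = "vertex_angles {arcA}"
  have V: "x \<in> ?V \<longleftrightarrow> (\<exists>n::int. x = 1/3 + of_int n \<or> x = 2/3 + of_int n)" for x
    unfolding vertex_angles_def by (auto simp: point_eq_iff)
  have V0: "x = 1/3 \<or> x = 2/3" if x: "x \<in> ?V" "1/3 \<le> x" "x < 4/3" for x
  proof -
    obtain n :: int where n: "x = 1/3 + of_int n \<or> x = 2/3 + of_int n" using x(1) V by blast
    hence "real_of_int n < 1" "real_of_int n > -1" using x by auto
    hence "n = 0" by linarith
    thus ?thesis using n by simp
  qed
  have mem: "1/3 \<in> ?V" "2/3 \<in> ?V" "4/3 \<in> ?V"
    unfolding V by (rule exI[of _ 0], simp, rule exI[of _ 0], simp, rule exI[of _ 1], simp)
  have con: "consecutive ?V (1/3) (2/3)" "consecutive ?V (2/3) (4/3)"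
    unfolding consecutive_def using mem V0 by force+
  show ?thesis
  proof
    assume "circle_interval {arcA} c d"
    hence cd: "consecutive ?V c d" by (simp add: circle_interval_consecutive)
    hence "c \<in> ?V" by (simp add: consecutive_def)
    then obtain n :: int where n: "c = 1/3 + of_int n \<or> c = 2/3 + of_int n" using V by blast
    have cd': "consecutive ?V (c + of_int (-n)) (d + of_int (-n))"
      using cd consecutive_shift[OF periodic_vertex_angles] by blast
    have lt: "c + of_int (-n) < d + of_int (-n)" using cd by (simp add: consecutive_def)
    have "(c + of_int (-n), d + of_int (-n)) \<in> {(1/3, 2/3), (2/3, 4/3)}"
      using n lt consecutive_overlap[OF cd' con(1)] consecutive_overlap[OF cd' con(2)] by auto
    thus "\<exists>n::int. (c + of_int n, d + of_int n) \<in> {(1/3, 2/3), (2/3, 4/3)}" by blast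
  next
    assume "\<exists>n::int. (c + of_int n, d + of_int n) \<in> {(1/3, 2/3), (2/3, 4/3)}"
    then obtain n :: int where n: "(c + of_int n, d + of_int n) \<in> {(1/3, 2/3), (2/3, 4/3)}" by blast
    have "case p of (c, d) \<Rightarrow> consecutive ?V c d" if "p \<in> {(1/3, 2/3), (2/3, 4/3)}" for p using that con by auto
    from this[OF n] have "consecutive ?V (c + of_int n) (d + of_int n)" by simp
    thus "circle_interval {arcA} c d" by (simp add: circle_interval_consecutive consecutive_shift)
  qed
qed

section \<open>Diagrams and pairs of ternary trees\<close>

datatype tree = Leaf | Node tree tree tree

fun leaves :: "tree \<Rightarrow> real \<Rightarrow> real \<Rightarrow> (real \<times> real) list" where
  "leaves Leaf a b = [(a, b)]"
| "leaves (Node l m r) a b = leaves l a (a + (b - a) / 4) @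
    leaves m (a + (b - a) / 4) (b - (b - a) / 4) @ leaves r (b - (b - a) / 4) b"

fun chain :: "real \<Rightarrow> (real \<times> real) list \<Rightarrow> real \<Rightarrow> bool" where
  "chain p [] q \<longleftrightarrow> p = q"
| "chain p ((a, b) # xs) q \<longleftrightarrow> a = p \<and> a < b \<and> chain b xs q"

lemma chain_append: "chain p (xs @ ys) q \<longleftrightarrow> (\<exists>r. chain p xs r \<and> chain r ys q)"
  by (induction xs arbitrary: p) auto

lemma chain_leaves: "a < b \<Longrightarrow> chain a (leaves \<tau> a b) b"
proof (induction \<tau> arbitrary: a b)
  case (Node l m r)
  have "a < a + (b - a) / 4" "a + (b - a) / 4 < b - (b - a) / 4" "b - (b - a) / 4 < b"
    using Node.prems by (simp_all add: field_simps)
  thus ?case using Node.IH unfolding leaves.simps chain_append by blast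
qed simp

lemma chain_le: "chain p xs q \<Longrightarrow> p \<le> q \<and> (\<forall>(x, y) \<in> set xs. p \<le> x \<and> x < y \<and> y \<le> q)"
  by (induction p xs q rule: chain.induct) force+

lemma leaves_expand:
  "(c, d) \<in> set (leaves \<tau> a b) \<Longrightarrow> \<exists>\<tau>' us vs. leaves \<tau> a b = us @ (c, d) # vs \<and>
    leaves \<tau>' a b = us @ [(c, c + (d - c) / 4), (c + (d - c) / 4, d - (d - c) / 4), (d - (d - c) / 4, d)] @ vs"
proof (induction \<tau> arbitrary: a b)
  case Leaf
  thus ?case by (intro exI[of _ "Node Leaf Leaf Leaf"] exI[of _ "[]"]) auto
next
  case (Node l m r)
  let ?p = "a + (b - a) / 4" and ?q = "b - (b - a) / 4"
  let ?L = "leaves l a ?p" and ?M = "leaves m ?p ?q" and ?R = "leaves r ?q b"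
  let ?ch = "[(c, c + (d - c) / 4), (c + (d - c) / 4, d - (d - c) / 4), (d - (d - c) / 4, d)]"
  from Node.prems consider "(c, d) \<in> set ?L" | "(c, d) \<in> set ?M" | "(c, d) \<in> set ?R" by auto
  thus ?case
  proof cases
    case 1
    from Node.IH(1)[OF this] obtain \<tau>' us vs where "?L = us @ (c, d) # vs" "leaves \<tau>' a ?p = us @ ?ch @ vs" by blast
    hence "leaves (Node l m r) a b = us @ (c, d) # (vs @ ?M @ ?R) \<and>
      leaves (Node \<tau>' m r) a b = us @ ?ch @ (vs @ ?M @ ?R)" by simp
    thus ?thesis by blast
  next
    case 2
    from Node.IH(2)[OF this] obtain \<tau>' us vs where "?M = us @ (c, d) # vs" "leaves \<tau>' ?p ?q = us @ ?ch @ vs" by blast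
    hence "leaves (Node l m r) a b = (?L @ us) @ (c, d) # (vs @ ?R) \<and>
      leaves (Node l \<tau>' r) a b = (?L @ us) @ ?ch @ (vs @ ?R)" by simp
    thus ?thesis by blast
  next
    case 3
    from Node.IH(3)[OF this] obtain \<tau>' us vs where "?R = us @ (c, d) # vs" "leaves \<tau>' ?q b = us @ ?ch @ vs" by blast
    hence "leaves (Node l m r) a b = (?L @ ?M @ us) @ (c, d) # vs \<and>
      leaves (Node l m \<tau>') a b = (?L @ ?M @ us) @ ?ch @ vs" by simp
    thus ?thesis by blast
  qed
qed

abbreviation leaves2 :: "tree \<Rightarrow> tree \<Rightarrow> (real \<times> real) list" where
  "leaves2 \<tau> \<sigma> \<equiv> leaves \<tau> (1/3) (2/3) @ leaves \<sigma> (2/3) (4/3)"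

lemma chain_leaves2: "chain (1/3) (leaves2 \<tau> \<sigma>) (4/3)"
  using chain_leaves[of "1/3" "2/3" \<tau>] chain_leaves[of "2/3" "4/3" \<sigma>] by (auto simp: chain_append)

lemma leaves2_expand:
  assumes "(c, d) \<in> set (leaves2 \<tau> \<sigma>)"
  shows "\<exists>\<tau>' \<sigma>' us vs. leaves2 \<tau> \<sigma> = us @ (c, d) # vs \<and>
    leaves2 \<tau>' \<sigma>' = us @ [(c, c + (d - c) / 4), (c + (d - c) / 4, d - (d - c) / 4), (d - (d - c) / 4, d)] @ vs"
proof -
  let ?L = "leaves \<tau> (1/3) (2/3)" and ?R = "leaves \<sigma> (2/3) (4/3)"
  let ?ch = "[(c, c + (d - c) / 4), (c + (d - c) / 4, d - (d - c) / 4), (d - (d - c) / 4, d)]"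
  from assms consider "(c, d) \<in> set ?L" | "(c, d) \<in> set ?R" by auto
  thus ?thesis
  proof cases
    case 1
    from leaves_expand[OF this] obtain \<tau>' us vs where
      "?L = us @ (c, d) # vs" "leaves \<tau>' (1/3) (2/3) = us @ ?ch @ vs" by blast
    hence "leaves2 \<tau> \<sigma> = us @ (c, d) # (vs @ ?R) \<and> leaves2 \<tau>' \<sigma> = us @ ?ch @ (vs @ ?R)" by simp
    thus ?thesis by blast
  next
    case 2
    from leaves_expand[OF this] obtain \<sigma>' us vs where
      "?R = us @ (c, d) # vs" "leaves \<sigma>' (2/3) (4/3) = us @ ?ch @ vs" by blast
    hence "leaves2 \<tau> \<sigma> = (?L @ us) @ (c, d) # vs \<and> leaves2 \<tau> \<sigma>' = (?L @ us) @ ?ch @ vs" by simp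
    thus ?thesis by blast
  qed
qed

text \<open>The list is a fundamental domain for the integer translations: \<open>circle_interval\<close> is invariant under
them.\<close>

definition has_intervals :: "complex set set \<Rightarrow> (real \<times> real) list \<Rightarrow> bool" where
  "has_intervals D xs \<longleftrightarrow> (\<forall>c d. circle_interval D c d \<longleftrightarrow> (\<exists>n::int. (c + of_int n, d + of_int n) \<in> set xs))"

lemma has_intervals_arcA: "has_intervals {arcA} [(1/3, 2/3), (2/3, 4/3)]"
  unfolding has_intervals_def circle_interval_arcA by (simp del: Pair_inject)

lemma has_intervals_member: "has_intervals D xs \<Longrightarrow> (a, b) \<in> set xs \<Longrightarrow> circle_interval D a b"
  unfolding has_intervals_def by (metis add.right_neutral of_int_0)

lemma has_intervals_insert:
  assumes int: "has_intervals D (us @ (a, b) # vs)" and ch: "chain p (us @ (a, b) # vs) (p + 1)"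
  shows "has_intervals (insert (primary_arc a b) D)
    (us @ [(a, a + (b - a) / 4), (a + (b - a) / 4, b - (b - a) / 4), (b - (b - a) / 4, b)] @ vs)"
proof -
  have ci: "circle_interval D a b" using has_intervals_member[OF int] by simp
  from ch have ch1: "chain p us a" and ch2: "chain b vs (p + 1)" and ab: "a < b" by (auto simp: chain_append)
  have nm: "x \<noteq> a + of_int k" if xy: "(x, y) \<in> set us \<union> set vs" for x y and k :: int
  proof
    assume x: "x = a + of_int k"
    have r: "p \<le> x \<and> x < p + 1 \<and> x \<noteq> a" "p \<le> a" "a < p + 1"
      using xy chain_le[OF ch1] chain_le[OF ch2] ab by fastforce+
    hence "real_of_int k < 1" "real_of_int k > -1" using x by auto
    hence "k = 0" by linarith
    thus False using x r by simp
  qed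
  have "circle_interval (insert (primary_arc a b) D) c d \<longleftrightarrow> (\<exists>n::int. (c + of_int n, d + of_int n) \<in>
    set (us @ [(a, a + (b - a) / 4), (a + (b - a) / 4, b - (b - a) / 4), (b - (b - a) / 4, b)] @ vs))" for c d
  proof -
    have int': "circle_interval D c d \<longleftrightarrow> (\<exists>n::int. (c + of_int n, d + of_int n) \<in> set us \<union> set vs \<union> {(a, b)})" for c d
      using int unfolding has_intervals_def by auto
    have 1: "(circle_interval D c d \<and> \<not> (\<exists>n::int. c = a + of_int n \<and> d = b + of_int n)) \<longleftrightarrow>
      (\<exists>n::int. (c + of_int n, d + of_int n) \<in> set us \<union> set vs)"
    proof
      assume as: "circle_interval D c d \<and> \<not> (\<exists>n::int. c = a + of_int n \<and> d = b + of_int n)"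
      then obtain n :: int where n: "(c + of_int n, d + of_int n) \<in> set us \<union> set vs \<union> {(a, b)}" unfolding int' by blast
      have "\<not> (c = a + of_int (-n) \<and> d = b + of_int (-n))" using as by blast
      hence "(c + of_int n, d + of_int n) \<noteq> (a, b)" by auto
      thus "\<exists>n::int. (c + of_int n, d + of_int n) \<in> set us \<union> set vs" using n by blast
    next
      assume "\<exists>n::int. (c + of_int n, d + of_int n) \<in> set us \<union> set vs"
      then obtain n :: int where n: "(c + of_int n, d + of_int n) \<in> set us \<union> set vs" by blast
      have "c + of_int n \<noteq> a + of_int (m + n)" for m using nm[OF n] .
      moreover have "circle_interval D c d" unfolding int' using n by blast
      ultimately show "circle_interval D c d \<and> \<not> (\<exists>n::int. c = a + of_int n \<and> d = b + of_int n)" by auto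
    qed
    show ?thesis unfolding circle_interval_insert[OF ci] 1 by auto
  qed
  thus ?thesis unfolding has_intervals_def by blast
qed

lemma has_intervals_base:
  "has_intervals (insert (primary_arc (2/3) (4/3)) {arcA}) [(1/3, 2/3), (2/3, 5/6), (5/6, 7/6), (7/6, 4/3)]"
  using has_intervals_insert[of "{arcA}" "[(1/3, 2/3)]" "2/3" "4/3" "[]" "1/3"] has_intervals_arcA by simp

text \<open>Subdividing an interval of the diagram replaces the corresponding leaf by a node.\<close>

theorem diagram_leaves: "arc_diagram D \<Longrightarrow> \<exists>\<tau> \<sigma>. has_intervals D (leaves2 \<tau> \<sigma>)"
proof (induction rule: arc_diagram.induct)
  case base
  have "insert (primary_arc (2/3) (4/3)) {arcA} = {{point (1/3), point (2/3)}, {point (1/6), point (5/6)}}"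
    unfolding primary_arc_B by (simp add: insert_commute)
  moreover have "leaves2 Leaf (Node Leaf Leaf Leaf) = [(1/3, 2/3), (2/3, 5/6), (5/6, 7/6), (7/6, 4/3)]" by simp
  ultimately show ?case using has_intervals_base by metis
next
  case (step D a b)
  then obtain \<tau> \<sigma> where int: "has_intervals D (leaves2 \<tau> \<sigma>)" by blast
  then obtain n :: int where n: "(a + of_int n, b + of_int n) \<in> set (leaves2 \<tau> \<sigma>)"
    using step unfolding has_intervals_def by blast
  define a' b' where "a' = a + of_int n" "b' = b + of_int n"
  have pr: "primary_arc a b = primary_arc a' b'" unfolding a'_b'_def by simp
  obtain \<tau>' \<sigma>' us vs where us: "leaves2 \<tau> \<sigma> = us @ (a', b') # vs"
    "leaves2 \<tau>' \<sigma>' = us @ [(a', a' + (b' - a') / 4), (a' + (b' - a') / 4, b' - (b' - a') / 4), (b' - (b' - a') / 4, b')] @ vs"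
    using leaves2_expand[OF n] unfolding a'_b'_def by blast
  have "chain (1/3) (us @ (a', b') # vs) (1/3 + 1)" using chain_leaves2[of \<tau> \<sigma>] us(1) by simp
  from has_intervals_insert[OF int[unfolded us(1)] this] show ?case unfolding pr us(2)[symmetric] by blast
qed

lemma leaves_pieces: "piece n t a b \<Longrightarrow> (c, d) \<in> set (leaves \<tau> a b) \<Longrightarrow> \<exists>m t'. piece m t' c d"
proof (induction \<tau> arbitrary: n t a b)
  case Leaf thus ?case by auto
next
  case (Node l m r)
  thus ?case using Node.IH(1)[OF left[OF Node.prems(1)]] Node.IH(2)[OF middle[OF Node.prems(1)]]
    Node.IH(3)[OF right[OF Node.prems(1)]] by auto
qed

lemma interval_is_piece:
  assumes "arc_diagram D" "circle_interval D a b"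
  obtains n t and k :: int where "piece n t (a + of_int k) (b + of_int k)"
proof -
  obtain \<tau> \<sigma> k where "(a + of_int k, b + of_int k) \<in> set (leaves2 \<tau> \<sigma>)"
    using diagram_leaves[OF assms(1)] assms(2) unfolding has_intervals_def by blast
  thus ?thesis using leaves_pieces[OF pieceA] leaves_pieces[OF pieceB] that by (metis Un_iff set_append)
qed

section \<open>The lamination\<close>

lemma circle_interval_child:
  assumes "circle_interval D a b" "(c, d) \<in> children a b"
  shows "circle_interval (insert (primary_arc a b) D) c d"
  unfolding circle_interval_insert[OF assms(1)] using assms(2) by (intro disjI2 exI[of _ 0]) simp

lemma circle_interval_arcA_B: "circle_interval {arcA} (2/3) (4/3)" "circle_interval {arcA} (1/3) (2/3)"
  unfolding circle_interval_arcA by (rule exI[of _ 0], simp)+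

lemma child_is_interval:
  assumes ab: "(a, b) = (2/3, 4/3) \<or> (\<exists>D. arc_diagram D \<and> circle_interval D a b)" and cd: "(c, d) \<in> children a b"
  shows "\<exists>D. arc_diagram D \<and> circle_interval D c d"
  proof -
    from ab consider "a = 2/3" "b = 4/3" | D where "arc_diagram D" "circle_interval D a b" by blast
    thus ?thesis
    proof cases
      case 1
      thus ?thesis using circle_interval_child[OF circle_interval_arcA_B(1), of c d] cd base_diagram by blast
    next
      case 2
      thus ?thesis using circle_interval_child[OF 2(2) cd] arc_diagram.step by blast
    qed
  qed

text \<open>The exception is \<open>[2/3, 4/3]\<close>, which is already subdivided in every diagram.\<close>

lemma piece_is_interval:
  "piece n t a b \<Longrightarrow> (a, b) = (2/3, 4/3) \<or> (\<exists>D. arc_diagram D \<and> circle_interval D a b)"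
proof (induction rule: piece.induct)
  case pieceA
  have "circle_interval (insert (primary_arc (2/3) (4/3)) {arcA}) (1/3) (2/3)"
    unfolding circle_interval_insert[OF circle_interval_arcA_B(1)] using circle_interval_arcA_B(2) by auto
  thus ?case using base_diagram by blast
next
  case (left n t a b) thus ?case using child_is_interval[of a b] by blast
next
  case (middle n t a b) thus ?case using child_is_interval[of a b] by blast
next
  case (right n t a b) thus ?case using child_is_interval[of a b] by blast
qed simp

lemma diagram_arc_cases:
  "arc_diagram D \<Longrightarrow> e \<in> D \<Longrightarrow> e = arcA \<or> (\<exists>n t a b. piece n t a b \<and> e = primary_arc a b)"
proof (induction arbitrary: e rule: arc_diagram.induct)
  case base
  thus ?case using primary_arc_B pieceB by blast
next
  case (step D a b)
  show ?case
  proof (cases "e \<in> D")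
    case False
    obtain n t k where "piece n t (a + of_int k) (b + of_int k)" using interval_is_piece step by blast
    moreover have "e = primary_arc (a + of_int k) (b + of_int k)" using False step by simp
    ultimately show ?thesis by blast
  qed (use step in blast)
qed

lemma arcA_in_diagram: "arc_diagram D \<Longrightarrow> arcA \<in> D"
  by (induction rule: arc_diagram.induct) auto

lemma primary_B_in_diagram: "arc_diagram D \<Longrightarrow> primary_arc (2/3) (4/3) \<in> D"
  unfolding primary_arc_B by (induction rule: arc_diagram.induct) auto

lemma lamination_iff: "e \<in> lamination \<longleftrightarrow> e = arcA \<or> (\<exists>n t a b. piece n t a b \<and> e = primary_arc a b)"
proof
  assume "e \<in> lamination"
  thus "e = arcA \<or> (\<exists>n t a b. piece n t a b \<and> e = primary_arc a b)"
    unfolding lamination_def using diagram_arc_cases by blast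
next
  assume "e = arcA \<or> (\<exists>n t a b. piece n t a b \<and> e = primary_arc a b)"
  thus "e \<in> lamination"
  proof (elim disjE exE conjE)
    fix n t a b assume p: "piece n t a b" and e: "e = primary_arc a b"
    from piece_is_interval[OF p] show ?thesis
      unfolding lamination_def using e base_diagram arc_diagram.step by blast
  qed (use base_diagram in \<open>auto simp: lamination_def\<close>)
qed

lemma piece_root: "piece n t a b \<Longrightarrow> b \<le> 2/3 \<or> 2/3 \<le> a"
proof (induction rule: piece.induct)
  case (left n t a b) thus ?case using piece_bounds[OF left(1)] by (auto simp: field_simps)
next
  case (middle n t a b) thus ?case using piece_bounds[OF middle(1)] by (auto simp: field_simps)
next
  case (right n t a b) thus ?case using piece_bounds[OF right(1)] by (auto simp: field_simps)
qed simp_all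

lemma point_eq_window: "point x = point y \<Longrightarrow> 1/3 < x \<Longrightarrow> x \<le> 4/3 \<Longrightarrow> 1/3 < y \<Longrightarrow> y \<le> 4/3 \<Longrightarrow> x = y"
  by (rule point_inj) auto

lemma in_child_iff: "in_child c d a b \<longleftrightarrow> (a \<le> c \<and> d \<le> a + (b - a) / 4) \<or>
    (a + (b - a) / 4 \<le> c \<and> d \<le> b - (b - a) / 4) \<or> (b - (b - a) / 4 \<le> c \<and> d \<le> b)"
  unfolding in_child_def by simp

lemma piece_primary_arc:
  assumes "piece n t a b"
  obtains p q where "primary_arc a b = {point p, point q}" "p = a + (b - a) / 4" "q = b - (b - a) / 4"
    "a < p" "p < q" "q < b" "1/3 < p" "q < 4/3" "p \<noteq> 2/3" "q \<noteq> 2/3"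
proof -
  have b: "1/3 \<le> a" "a < b" "b \<le> 4/3" "b \<le> 2/3 \<or> 2/3 \<le> a" using piece_bounds[OF assms] piece_root[OF assms] by auto
  have "a + (b - a) / 4 \<noteq> 2/3"
  proof
    assume e: "a + (b - a) / 4 = 2/3"
    have "\<not> b \<le> 2/3" "\<not> 2/3 \<le> a" using e b(2) by (auto simp: field_simps)
    thus False using b(4) by blast
  qed
  moreover have "b - (b - a) / 4 \<noteq> 2/3"
  proof
    assume e: "b - (b - a) / 4 = 2/3"
    have "\<not> b \<le> 2/3" "\<not> 2/3 \<le> a" using e b(2) by (auto simp: field_simps)
    thus False using b(4) by blast
  qed
  ultimately show ?thesis using b(1-3)
    by (intro that[of "a + (b - a) / 4" "b - (b - a) / 4"]) (simp_all add: primary_arc_def field_simps)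
qed

text \<open>The endpoints of the primary arc of a piece lie in its interior and not in the interior of a child,
whereas another piece is disjoint from it, contained in a child, or contains it in a child.\<close>

lemma lamination_disjoint:
  assumes "e \<in> lamination" "e' \<in> lamination" "e \<inter> e' \<noteq> {}" shows "e = e'"
proof -
  have A: "arcA \<inter> primary_arc a b = {}" if ab: "piece n t a b" for n t a b
  proof -
    obtain p q where pq: "primary_arc a b = {point p, point q}" "1/3 < p" "p < q" "q < 4/3" "p \<noteq> 2/3" "q \<noteq> 2/3"
      using piece_primary_arc[OF ab] by metis
    have "point (1/3) = point (4/3)" using point_add_one[of "1/3"] by simp
    moreover have "point (4/3) \<noteq> point y" "point (2/3) \<noteq> point y" if "1/3 < y" "y < 4/3" "y \<noteq> 2/3" for y
      using point_eq_window[of "4/3" y] point_eq_window[of "2/3" y] that by auto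
    ultimately show ?thesis unfolding pq(1) using pq(2-) by simp
  qed
  have P: "primary_arc a b = primary_arc c d" if ab: "piece n t a b" and cd: "piece m s c d"
    and ne: "primary_arc a b \<inter> primary_arc c d \<noteq> {}" for n t a b m s c d
  proof -
    obtain p q where pq: "primary_arc a b = {point p, point q}" "p = a + (b - a) / 4" "q = b - (b - a) / 4"
      "a < p" "p < q" "q < b" "1/3 < p" "q < 4/3" using piece_primary_arc[OF ab] by metis
    obtain r u where ru: "primary_arc c d = {point r, point u}" "r = c + (d - c) / 4" "u = d - (d - c) / 4"
      "c < r" "r < u" "u < d" "1/3 < r" "u < 4/3" using piece_primary_arc[OF cd] by metis
    obtain x y where xy: "x = p \<or> x = q" "y = r \<or> y = u" "point x = point y"
      using ne unfolding pq(1) ru(1) by blast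
    have "1/3 < x" "x \<le> 4/3" using xy(1) pq(5,7,8) by auto
    moreover have "1/3 < y" "y \<le> 4/3" using xy(2) ru(5,7,8) by auto
    ultimately have "x = y" using point_eq_window xy(3) by blast
    hence "\<not> b \<le> c" "\<not> d \<le> a" "\<not> in_child c d a b" "\<not> in_child a b c d"
      unfolding in_child_iff pq(2,3)[symmetric] ru(2,3)[symmetric] using xy pq(4-6) ru(4-6) by linarith+
    thus ?thesis using piece_nested[OF ab cd] by simp
  qed
  show ?thesis using assms A P unfolding lamination_iff by (metis Int_commute)
qed

text \<open>A point of a diagram can enter the interior of a piece only by the subdivision of a piece that
overlaps it.  If this is a larger one, the new points are not inside the smaller piece; if it
is a smaller one, one of its endpoints has been inside the piece before.\<close>

lemma diagram_refines_piece:
  "arc_diagram D \<Longrightarrow> piece n t a b \<Longrightarrow> primary_arc a b \<in> D \<or> vertex_angles D \<inter> {a<..<b} = {}"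
proof (induction rule: arc_diagram.induct)
  case base
  show ?case
  proof (cases "a = 2/3 \<and> b = 4/3")
    case True
    hence "primary_arc a b = primary_arc (2/3) (4/3)" by (elim conjE) (simp only:)
    thus ?thesis using primary_B_in_diagram[OF arc_diagram.base] by presburger
  next
    case False
    have no: "point x \<notin> {point (1/3), point (2/3), point (1/6), point (5/6)}" if x: "a < x" "x < b" for x
    proof -
      have b: "1/3 < x" "x < 4/3" "1/3 \<le> a" "b \<le> 4/3" using x piece_bounds[OF base] by auto
      have e: "point (1/3) = point (4/3)" "point (1/6) = point (7/6)" using point_add_one[of "1/3"] point_add_one[of "1/6"] by simp_all
      have "x \<noteq> 2/3" using x piece_root[OF base] by auto
      moreover have "x \<noteq> 7/6 \<and> x \<noteq> 5/6"
        using piece_nested[OF base pieceB] False x b unfolding in_child_iff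
        by (elim disjE conjE) (auto simp: field_simps)
      ultimately show ?thesis unfolding e using b point_eq_window[of x] by force
    qed
    thus ?thesis unfolding vertex_angles_def by auto
  qed
next
  case (step D c' d')
  obtain m s k where "piece m s (c' + of_int k) (d' + of_int k)" using interval_is_piece step by blast
  then obtain c d where cd: "piece m s c d" "primary_arc c' d' = primary_arc c d" "circle_interval D c d"
    using step(2) by fastforce
  show ?case
  proof (cases "primary_arc a b \<in> insert (primary_arc c d) D")
    case False
    hence V: "vertex_angles D \<inter> {a<..<b} = {}" using step cd by auto
    have ne: "\<not> (a = c \<and> b = d)" using False by auto
    have lt: "a < b" "c < d" "1/3 \<le> a" "b \<le> 4/3" using piece_bounds cd step by blast+
    have "c \<in> vertex_angles D" "d \<in> vertex_angles D" using cd(3) by (auto simp: circle_interval_def vertex_angles_def)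
    hence cdn: "\<not> (a < c \<and> c < b)" "\<not> (a < d \<and> d < b)" using V by auto
    obtain r u where ru: "primary_arc c d = {point r, point u}" "r = c + (d - c) / 4" "u = d - (d - c) / 4"
      "c < r" "r < u" "u < d" "1/3 < r" "u < 4/3" using piece_primary_arc[OF cd(1)] by metis
    have "x \<notin> vertex_angles (insert (primary_arc c d) D)" if x: "a < x" "x < b" for x
    proof
      assume "x \<in> vertex_angles (insert (primary_arc c d) D)"
      hence "point x \<in> primary_arc c d" using V x unfolding vertex_angles_def by auto
      then obtain y where y: "y = r \<or> y = u" "point x = point y" unfolding ru(1) by blast
      have "1/3 < y" "y \<le> 4/3" using y(1) ru(5,7,8) by auto
      hence "x = y" using point_eq_window[OF y(2)] x lt by simp
      hence "\<not> b \<le> c" "\<not> d \<le> a" "\<not> in_child c d a b" "\<not> in_child a b c d"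
        unfolding in_child_iff ru(2,3)[symmetric] using x y(1) lt cdn ru(4-6) by (linarith, linarith, argo, linarith)
      thus False using piece_nested[OF step(4) cd(1)] ne by blast
    qed
    thus ?thesis unfolding cd by auto
  qed (use cd in auto)
qed

section \<open>Regions cut out by geodesics and the Klein model\<close>

text \<open>The two sides of the defining equation of \<open>geodesic {point a, point b}\<close> subtracted from each other.
For \<open>a < b < a + 1\<close> it is positive on the side of the geodesic that contains \<open>point x\<close> for
\<open>a < x < b\<close>.\<close>

definition arc_side :: "real \<Rightarrow> real \<Rightarrow> complex \<Rightarrow> real" where
  "arc_side a b z = 2 * Re (z * cis (- (pi * (a + b)))) - cos (pi * (a - b)) * (1 + (norm z)\<^sup>2)"

text \<open>The affine function that vanishes on the chord from \<open>point a\<close> to \<open>point b\<close>.\<close>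

definition chord_side :: "real \<Rightarrow> real \<Rightarrow> complex \<Rightarrow> real" where
  "chord_side a b w = Re (w * cis (- (pi * (a + b)))) - cos (pi * (a - b))"

text \<open>The change from the Poincare model to the Klein model, in which geodesics are straight, and its
inverse.\<close>

definition klein :: "complex \<Rightarrow> complex" where
  "klein z = of_real (2 / (1 + (norm z)\<^sup>2)) * z"

definition unklein :: "complex \<Rightarrow> complex" where
  "unklein w = of_real (1 / (1 + sqrt (1 - (norm w)\<^sup>2))) * w"

lemma side_factor_pos: "1 + (norm (z::complex))\<^sup>2 > 0"
  by (rule add_pos_nonneg) simp_all

lemma arc_side_klein: "arc_side a b z = (1 + (norm z)\<^sup>2) * chord_side a b (klein z)"
proof -
  have p: "1 + (norm z)\<^sup>2 > 0" by (rule side_factor_pos)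
  have "Re (klein z * cis (- (pi * (a + b)))) = 2 / (1 + (norm z)\<^sup>2) * Re (z * cis (- (pi * (a + b))))"
    unfolding klein_def by (simp only: mult.assoc Re_complex_of_real Im_complex_of_real times_complex.simps)
  thus ?thesis unfolding arc_side_def chord_side_def using p by (simp add: field_simps)
qed

lemma norm_klein: "norm (klein z) = 2 * norm z / (1 + (norm z)\<^sup>2)"
proof -
  have "1 + (norm z)\<^sup>2 > 0" by (rule side_factor_pos)
  thus ?thesis unfolding klein_def norm_mult norm_of_real by simp
qed

lemma norm_klein_le: "norm (klein z) \<le> 1"
proof -
  have "0 \<le> (1 - norm z)\<^sup>2" "1 + (norm z)\<^sup>2 > 0" using side_factor_pos by simp_all
  thus ?thesis unfolding norm_klein by (simp add: field_simps power2_eq_square)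
qed

lemma norm_klein_less: "norm z < 1 \<Longrightarrow> norm (klein z) < 1"
proof -
  assume "norm z < 1"
  hence "0 < (1 - norm z)\<^sup>2" "1 + (norm z)\<^sup>2 > 0" using side_factor_pos by simp_all
  thus ?thesis unfolding norm_klein by (simp add: field_simps power2_eq_square)
qed

lemma unklein_klein:
  assumes "norm z \<le> 1" shows "unklein (klein z) = z"
proof -
  define r where "r = (norm z)\<^sup>2"
  have r: "0 \<le> r" "r \<le> 1" using assms by (auto simp: r_def power_le_one)
  have "1 - (norm (klein z))\<^sup>2 = ((1 - r) / (1 + r))\<^sup>2"
  proof -
    have "(norm (klein z))\<^sup>2 = 4 * r / (1 + r)\<^sup>2"
      unfolding norm_klein by (simp add: power_divide power_mult_distrib r_def[symmetric])
    moreover have "1 - 4 * r / (1 + r)\<^sup>2 = ((1 + r)\<^sup>2 - 4 * r) / (1 + r)\<^sup>2"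
      using r by (simp add: diff_divide_distrib)
    moreover have "(1 + r)\<^sup>2 - 4 * r = (1 - r)\<^sup>2" by (simp add: power2_eq_square algebra_simps)
    ultimately show ?thesis by (simp add: power_divide)
  qed
  hence "sqrt (1 - (norm (klein z))\<^sup>2) = (1 - r) / (1 + r)" using r by (simp add: real_sqrt_abs)
  moreover have "1 / (1 + (1 - r) / (1 + r)) = (1 + r) / 2" using r by (simp add: field_simps)
  ultimately have "1 / (1 + sqrt (1 - (norm (klein z))\<^sup>2)) = (1 + r) / 2" by simp
  hence "unklein (klein z) = of_real ((1 + r) / 2) * (of_real (2 / (1 + r)) * z)"
    unfolding unklein_def by (simp only: klein_def r_def)
  also have "\<dots> = of_real ((1 + r) / 2 * (2 / (1 + r))) * z" by (simp only: of_real_mult mult.assoc)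
  also have "(1 + r) / 2 * (2 / (1 + r)) = 1" using r by simp
  finally show ?thesis by simp
qed

lemma norm_unklein_sq:
  assumes "norm w \<le> 1"
  defines "s \<equiv> sqrt (1 - (norm w)\<^sup>2)"
  shows "(norm (unklein w))\<^sup>2 = (1 - s) / (1 + s)" "s \<ge> 0"
proof -
  have "(norm w)\<^sup>2 \<le> 1" using assms(1) by (simp add: power_le_one)
  thus s: "s \<ge> 0" by (simp add: s_def)
  have s2: "(norm w)\<^sup>2 = (1 - s) * (1 + s)" using \<open>(norm w)\<^sup>2 \<le> 1\<close> by (simp add: s_def algebra_simps power2_eq_square[symmetric])
  have "norm (unklein w) = norm w / (1 + s)" unfolding unklein_def s_def[symmetric] norm_mult norm_of_real using s by simp
  hence "(norm (unklein w))\<^sup>2 = (1 - s) * (1 + s) / (1 + s)\<^sup>2" by (simp add: power_divide s2)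
  thus "(norm (unklein w))\<^sup>2 = (1 - s) / (1 + s)" using s by (simp add: power2_eq_square)
qed

lemma klein_unklein:
  assumes "norm w \<le> 1" shows "klein (unklein w) = w"
proof -
  define s where "s = sqrt (1 - (norm w)\<^sup>2)"
  have s: "s \<ge> 0" "(norm (unklein w))\<^sup>2 = (1 - s) / (1 + s)" using norm_unklein_sq[OF assms] by (simp_all add: s_def)
  have "2 / (1 + (norm (unklein w))\<^sup>2) = 1 + s" unfolding s(2) using s(1) by (simp add: field_simps)
  hence "klein (unklein w) = of_real (1 + s) * (of_real (1 / (1 + s)) * w)"
    unfolding klein_def by (simp only: unklein_def s_def)
  also have "\<dots> = of_real ((1 + s) * (1 / (1 + s))) * w" by (simp only: of_real_mult mult.assoc)
  also have "(1 + s) * (1 / (1 + s)) = 1" using s by simp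
  finally show ?thesis by simp
qed

lemma norm_unklein_le: "norm w \<le> 1 \<Longrightarrow> norm (unklein w) \<le> 1"
proof -
  assume w: "norm w \<le> 1"
  have "(norm (unklein w))\<^sup>2 \<le> 1"
    unfolding norm_unklein_sq(1)[OF w] using norm_unklein_sq(2)[OF w] by (subst divide_le_eq_1_pos) (auto intro: add_pos_nonneg)
  thus ?thesis by (simp add: abs_square_le_1)
qed

lemma norm_unklein_less: "norm w < 1 \<Longrightarrow> norm (unklein w) < 1"
proof -
  assume w: "norm w < 1"
  have "(norm w)\<^sup>2 < 1" using w by (simp add: power_less_one_iff abs_square_less_1)
  hence "sqrt (1 - (norm w)\<^sup>2) > 0" by simp
  hence "(norm (unklein w))\<^sup>2 < 1"
    using norm_unklein_sq(1)[of w] w by (subst norm_unklein_sq(1), simp) (subst divide_less_eq_1_pos, auto intro: add_pos_nonneg)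
  thus ?thesis by (simp add: abs_square_less_1)
qed

lemma continuous_on_unklein: "continuous_on (cball 0 1) unklein"
proof -
  have "1 + sqrt (1 - (norm w)\<^sup>2) \<noteq> 0" if "w \<in> cball 0 1" for w :: complex
    using norm_unklein_sq(2)[of w] that by (intro less_imp_neq[THEN not_sym] add_pos_nonneg) auto
  thus ?thesis unfolding unklein_def by (intro continuous_intros) auto
qed

lemma klein_circle: "p \<in> circle \<Longrightarrow> klein p = p"
  by (simp add: klein_def)

lemma chord_side_convex:
  "chord_side a b (of_real (1 - t) * u + of_real t * v) = (1 - t) * chord_side a b u + t * chord_side a b v"
  unfolding chord_side_def by (simp add: algebra_simps)

lemma arc_side_point: "arc_side a b (point x) = 4 * sin (pi * (x - a)) * sin (pi * (b - x))"
proof -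
  have "point x * cis (- (pi * (a + b))) = cis (pi * (x - a) - pi * (b - x))"
    unfolding point_def cis_mult by (simp add: algebra_simps)
  moreover have "pi * (a - b) = - (pi * (x - a) + pi * (b - x))" by (simp add: algebra_simps)
  ultimately show ?thesis unfolding arc_side_def by (simp add: cos_diff cos_add)
qed

lemma arc_side_alt: "arc_side a b z =
  2 * (Re z * cos (pi * a + pi * b) + Im z * sin (pi * a + pi * b)) - cos (pi * a - pi * b) * (1 + (norm z)\<^sup>2)"
  unfolding arc_side_def by (simp only: cis.simps times_complex.simps sin_minus cos_minus distrib_left right_diff_distrib)

lemma arc_side_swap: "arc_side b a z = arc_side a b z"
  unfolding arc_side_alt by (simp add: cos_diff cos_add sin_add mult.commute add.commute)

lemma arc_side_shift:
  fixes n :: int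
  shows "\<exists>s\<in>{1, -1}. \<forall>z. arc_side (a + of_int n) b z = s * arc_side a b z"
proof -
  have p: "pi * (a + of_int n) - pi * b = (pi * a - pi * b) + pi * of_int n"
      "pi * (a + of_int n) + pi * b = (pi * a + pi * b) + pi * of_int n"
      by (simp_all add: algebra_simps)
  have s: "sin (pi * of_int n) = 0" by (simp add: sin_zero_iff_int2 mult.commute)
  have "cos (pi * of_int n) = 1 \<or> cos (pi * of_int n) = -1"
    using s sin_zero_abs_cos_one by (metis abs_eq_iff abs_1)
  moreover have "arc_side (a + of_int n) b z = cos (pi * of_int n) * arc_side a b z" for z
    unfolding arc_side_alt p cos_add[of _ "pi * of_int n"] sin_add[of _ "pi * of_int n"] s by (simp add: algebra_simps)
  ultimately show ?thesis by auto
qed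

text \<open>The sign of \<open>arc_side\<close> depends on the integers in the lifts of the endpoints, so only the partition
into sides is an invariant of the arc.\<close>

lemma arc_side_same_arc:
  assumes "{point a, point b} = {point c, point d}"
  shows "\<exists>s\<in>{1, -1}. \<forall>z. arc_side c d z = s * arc_side a b z"
proof -
  have *: "\<exists>s\<in>{1, -1}. \<forall>z. arc_side c d z = s * arc_side a b z" if cd: "point c = point a" "point d = point b" for a b
  proof -
    obtain m n :: int where "c = a + m" "d = b + n" using cd point_eq_iff by blast
    moreover obtain s where "s \<in> {1, -1}" "\<And>z. arc_side (a + m) (b + n) z = s * arc_side a (b + n) z"
      using arc_side_shift[of a m "b + n"] by blast
    moreover obtain s' where "s' \<in> {1, -1}" "\<And>z. arc_side (b + n) a z = s' * arc_side b a z"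
      using arc_side_shift[of b n a] by blast
    ultimately show ?thesis
      by (intro bexI[of _ "s * s'"]) (auto simp: arc_side_swap[of a "b + n"] arc_side_swap[of a b])
  qed
  have "(point c = point a \<and> point d = point b) \<or> (point c = point b \<and> point d = point a)"
    using assms by (auto simp: doubleton_eq_iff)
  thus ?thesis using *[of a b] *[of b a] arc_side_swap by metis
qed

definition arc_ends :: "complex set \<Rightarrow> real \<times> real" where
  "arc_ends e = (SOME p. e = {point (fst p), point (snd p)})"

text \<open>The endpoints are chosen arbitrarily, which leaves the sign undetermined.  For this reason
sides are compared by the sign of \<open>side e x * side e y\<close>.\<close>

definition side :: "complex set \<Rightarrow> complex \<Rightarrow> real" where
  "side e = arc_side (fst (arc_ends e)) (snd (arc_ends e))"

definition chord :: "complex set \<Rightarrow> complex \<Rightarrow> real" where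
  "chord e = chord_side (fst (arc_ends e)) (snd (arc_ends e))"

definition is_arc :: "complex set \<Rightarrow> bool" where
  "is_arc e \<longleftrightarrow> (\<exists>p\<in>circle. \<exists>q\<in>circle. p \<noteq> q \<and> e = {p, q})"

lemma is_arc_ends:
  assumes "is_arc e" obtains a b where "a < b" "b < a + 1" "e = {point a, point b}"
proof -
  obtain p q where pq: "p \<in> circle" "q \<in> circle" "p \<noteq> q" "e = {p, q}" using assms unfolding is_arc_def by blast
  obtain a where a: "p = point a" using circle_point[OF pq(1), of 0] by metis
  obtain b where b: "a \<le> b" "b < a + 1" "q = point b" using circle_point[OF pq(2)] by metis
  have "a \<noteq> b" using a b pq by auto
  thus ?thesis using that[of a b] a b pq by auto
qed

lemma is_arcI: "a < b \<Longrightarrow> b < a + 1 \<Longrightarrow> is_arc {point a, point b}"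
  unfolding is_arc_def using point_inj[of a b] point_in_circle by fastforce

lemma arc_ends: "is_arc e \<Longrightarrow> e = {point (fst (arc_ends e)), point (snd (arc_ends e))}"
  unfolding arc_ends_def by (rule someI_ex) (metis is_arc_ends fst_conv snd_conv)

lemma side_eq:
  assumes "is_arc e" "e = {point a, point b}"
  obtains s :: real where "s = 1 \<or> s = -1" "\<And>z. side e z = s * arc_side a b z"
proof -
  have "{point a, point b} = {point (fst (arc_ends e)), point (snd (arc_ends e))}"
    using arc_ends[OF assms(1)] assms(2) by simp
  from arc_side_same_arc[OF this] obtain s where "s \<in> {1, -1}"
    "\<forall>z. arc_side (fst (arc_ends e)) (snd (arc_ends e)) z = s * arc_side a b z" by blast
  thus ?thesis using that[of s] unfolding side_def by blast
qed

lemma geodesic_side: "is_arc e \<Longrightarrow> geodesic e = {z \<in> cball 0 1. side e z = 0}"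
  using geodesic_eq[of "fst (arc_ends e)" "snd (arc_ends e)"] arc_ends[of e]
  unfolding side_def arc_side_def by auto

lemma side_chord: "side e z = (1 + (norm z)\<^sup>2) * chord e (klein z)"
  unfolding side_def chord_def by (rule arc_side_klein)

lemma sgn_side: "sgn (side e z) = sgn (chord e (klein z))"
  unfolding side_chord sgn_mult using side_factor_pos by simp

lemma side_mult_sign:
  "side e x * side e' y > 0 \<longleftrightarrow> chord e (klein x) * chord e' (klein y) > 0"
  "side e x * side e' y \<ge> 0 \<longleftrightarrow> chord e (klein x) * chord e' (klein y) \<ge> 0"
proof -
  have "sgn (side e x * side e' y) = sgn (chord e (klein x) * chord e' (klein y))"
    by (simp add: sgn_mult sgn_side)
  thus "side e x * side e' y > 0 \<longleftrightarrow> chord e (klein x) * chord e' (klein y) > 0"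
    "side e x * side e' y \<ge> 0 \<longleftrightarrow> chord e (klein x) * chord e' (klein y) \<ge> 0"
    by (smt (verit) sgn_greater sgn_less)+
qed

lemma continuous_on_side: "continuous_on S (side e)"
  unfolding side_def arc_side_def by (intro continuous_intros)

lemma chord_convex: "chord e (of_real (1 - t) * u + of_real t * v) = (1 - t) * chord e u + t * chord e v"
  unfolding chord_def by (rule chord_side_convex)

lemma arc_side_point_pos:
  assumes "a < x" "x < b" "b < a + 1" shows "arc_side a b (point x) > 0"
proof -
  have "sin (pi * (x - a)) > 0" "sin (pi * (b - x)) > 0" using assms by (auto intro!: sin_gt_zero)
  thus ?thesis unfolding arc_side_point by simp
qed

lemma arc_side_point_neg:
  assumes "a < b" "b < x" "x < a + 1" shows "arc_side a b (point x) < 0"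
proof -
  have "sin (pi * (x - a)) > 0" "sin (pi * (x - b)) > 0" using assms by (auto intro!: sin_gt_zero)
  moreover have "pi * (b - x) = - (pi * (x - b))" by (simp add: algebra_simps)
  ultimately show ?thesis unfolding arc_side_point by (simp add: mult_pos_pos)
qed

lemma arc_side_ends: "arc_side a b (point a) = 0" "arc_side a b (point b) = 0"
  unfolding arc_side_point by simp_all

lemma side_circle_zero:
  assumes "is_arc e" "p \<in> circle" shows "side e p = 0 \<longleftrightarrow> p \<in> e"
proof -
  obtain a b where ab: "a < b" "b < a + 1" "e = {point a, point b}" using is_arc_ends[OF assms(1)] .
  obtain s where s: "s = 1 \<or> s = -1" "\<And>z. side e z = s * arc_side a b z" using side_eq[OF assms(1) ab(3)] by blast
  obtain x where x: "a \<le> x" "x < a + 1" "p = point x" using circle_point[OF assms(2)] .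
  consider "x = a" | "x = b" | "a < x" "x < b" | "b < x" using x by linarith
  hence "side e p = 0 \<longleftrightarrow> x = a \<or> x = b"
  proof cases
    case 3 thus ?thesis using arc_side_point_pos[of a x b] ab s x by auto
  next
    case 4 thus ?thesis using arc_side_point_neg[of a b x] ab s x by auto
  qed (use s x arc_side_ends in auto)
  also have "\<dots> \<longleftrightarrow> p \<in> e"
  proof -
    have "\<bar>x - a\<bar> < 1" "\<bar>x - b\<bar> < 1" using x ab by auto
    thus ?thesis using x(3) ab(3) point_inj[of x a] point_inj[of x b] by auto
  qed
  finally show ?thesis .
qed

lemma arc_subset_circle: "is_arc e \<Longrightarrow> e \<subseteq> circle"
  by (auto simp: is_arc_def)

lemma arc_subset_geodesic: "is_arc e \<Longrightarrow> e \<subseteq> geodesic e"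
  unfolding geodesic_side using side_circle_zero[of e] arc_subset_circle[of e]
  by (metis (mono_tags, lifting) mem_Collect_eq sphere_cball subset_iff)

lemma geodesic_circle: "is_arc e \<Longrightarrow> geodesic e \<inter> circle = e"
  using side_circle_zero[of e] arc_subset_circle[of e] arc_subset_geodesic[of e] by (auto simp: geodesic_side)

text \<open>After rotating by \<open>- \<pi> (a + b)\<close> the chord is vertical, and the parameter is read off the imaginary
part.\<close>

lemma chord_side_zero_segment:
  assumes "chord_side a b w = 0" "norm w \<le> 1"
  obtains t where "0 \<le> t" "t \<le> 1" "w = of_real (1 - t) * point a + of_real t * point b"
proof -
  define u where "u = w * cis (- (pi * (a + b)))"
  have wu: "w = cis (pi * (a + b)) * u" unfolding u_def by (simp add: mult.left_commute[of _ w] cis_mult)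
  define c s where "c = cos (pi * (a - b))" "s = sin (pi * (a - b))"
  have Re: "Re u = c" using assms(1) by (simp add: chord_side_def u_def c_s_def)
  have cs: "c\<^sup>2 + s\<^sup>2 = 1" by (simp add: c_s_def)
  have "norm u = norm w" unfolding u_def by (simp add: norm_mult)
  hence "(Re u)\<^sup>2 + (Im u)\<^sup>2 \<le> 1" using assms(2) by (metis cmod_power2 norm_ge_zero power_le_one)
  hence "(Im u)\<^sup>2 \<le> s\<^sup>2" using Re cs by simp
  hence Im: "\<bar>Im u\<bar> \<le> \<bar>s\<bar>" by (simp add: abs_le_square_iff)
  define t where "t = (if s = 0 then 0 else (1 - Im u / s) / 2)"
  have "\<bar>Im u / s\<bar> \<le> 1" using Im by (cases "s = 0") (simp_all add: abs_divide divide_le_eq_1)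
  hence "Im u / s \<le> 1" "- 1 \<le> Im u / s" by linarith+
  hence t01: "0 \<le> t" "t \<le> 1" unfolding t_def by simp_all
  have ImE: "Im u = (1 - t) * s + t * (- s)" using Im by (auto simp: t_def field_simps)
  have "cis (pi * (a - b)) = Complex c s" "cis (- (pi * (a - b))) = Complex c (- s)"
    by (simp_all only: c_s_def cis.ctr sin_minus cos_minus)
  hence "u = of_real (1 - t) * cis (pi * (a - b)) + of_real t * cis (- (pi * (a - b)))"
    using Re ImE by (simp add: complex_eq_iff algebra_simps)
  moreover have "point a = cis (pi * (a + b)) * cis (pi * (a - b))" "point b = cis (pi * (a + b)) * cis (- (pi * (a - b)))"
    unfolding point_def cis_mult by (simp_all add: algebra_simps)
  ultimately have "w = of_real (1 - t) * point a + of_real t * point b" unfolding wu by (simp only: distrib_left mult.left_commute)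
  thus ?thesis using t01 that by blast
qed

text \<open>An affine function that is nonnegative at both ends of a chord is nonnegative on it.\<close>

lemma geodesic_side_nonneg:
  assumes e: "is_arc e" and p: "\<And>p. p \<in> e \<Longrightarrow> s * side g p \<ge> 0" and w: "chord e w = 0" "norm w \<le> 1"
  shows "s * chord g w \<ge> 0"
proof -
  let ?a = "fst (arc_ends e)" and ?b = "snd (arc_ends e)"
  have eq: "e = {point ?a, point ?b}" using arc_ends[OF e] .
  obtain t where t: "0 \<le> t" "t \<le> 1" "w = of_real (1 - t) * point ?a + of_real t * point ?b"
    using chord_side_zero_segment w unfolding chord_def by metis
  have *: "s * chord g (point x) \<ge> 0" if "point x \<in> e" for x
    using p[OF that] unfolding side_chord klein_circle[OF point_in_circle] by (simp add: zero_le_mult_iff)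
  have "s * chord g (point ?a) \<ge> 0" "s * chord g (point ?b) \<ge> 0" using eq by (auto intro!: *)
  hence "(1 - t) * (s * chord g (point ?a)) + t * (s * chord g (point ?b)) \<ge> 0"
    using t by (intro add_nonneg_nonneg[OF mult_nonneg_nonneg mult_nonneg_nonneg]) simp_all
  thus ?thesis unfolding t(3) chord_convex by (simp add: algebra_simps)
qed

definition open_cells :: "complex set set \<Rightarrow> complex set" where
  "open_cells L = ball 0 1 - (\<Union>e\<in>L. geodesic e)"

text \<open>In the Klein model this is an intersection of open half-planes with the disk, hence convex.\<close>

definition region :: "complex set set \<Rightarrow> complex \<Rightarrow> complex set" where
  "region L x = {y \<in> ball 0 1. \<forall>e\<in>L. side e x * side e y > 0}"

lemma open_cells_side:
  assumes "\<And>e. e \<in> L \<Longrightarrow> is_arc e"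
  shows "x \<in> open_cells L \<longleftrightarrow> norm x < 1 \<and> (\<forall>e\<in>L. side e x \<noteq> 0)"
  unfolding open_cells_def using geodesic_side assms by auto

lemma region_self: "(\<And>e. e \<in> L \<Longrightarrow> is_arc e) \<Longrightarrow> x \<in> open_cells L \<Longrightarrow> x \<in> region L x"
  by (auto simp: region_def open_cells_side zero_less_mult_iff)

lemma same_sign_trans: "a * b > 0 \<Longrightarrow> b * c > 0 \<Longrightarrow> a * c > (0::real)"
  by (auto simp: zero_less_mult_iff)

lemma same_sign_convex:
  fixes u v :: real assumes "u * v > 0" "0 \<le> t" "t \<le> 1" shows "u * ((1 - t) * u + t * v) > 0"
proof -
  have "u * u > 0" using assms(1) by (auto simp: zero_less_mult_iff)
  hence "(1 - t) * (u * u) + t * (u * v) > 0"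
    using assms by (cases "t = 0") (auto intro!: add_nonneg_pos[OF mult_nonneg_nonneg mult_pos_pos])
  thus ?thesis by (simp add: algebra_simps)
qed

lemma region_subset: "(\<And>e. e \<in> L \<Longrightarrow> is_arc e) \<Longrightarrow> region L x \<subseteq> open_cells L"
  using open_cells_side[of L] by (fastforce simp: region_def)

lemma region_eq: "y \<in> region L x \<Longrightarrow> region L y = region L x"
  unfolding region_def by (auto intro: same_sign_trans simp: mult.commute)

definition klein_path :: "complex \<Rightarrow> complex \<Rightarrow> real \<Rightarrow> complex" where
  "klein_path x y t = unklein (of_real (1 - t) * klein x + of_real t * klein y)"

lemma klein_convex_norm:
  assumes "0 \<le> t" "t \<le> 1" shows "norm (of_real (1 - t) * klein x + of_real t * klein y) \<le> 1"
proof -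
  have "norm (of_real (1 - t) * klein x + of_real t * klein y) \<le> (1 - t) * norm (klein x) + t * norm (klein y)"
    using assms by (intro norm_triangle_le) (simp add: norm_mult del: of_real_diff)
  also have "\<dots> \<le> (1 - t) * 1 + t * 1" using assms norm_klein_le by (intro add_mono mult_left_mono) auto
  finally show ?thesis by simp
qed

lemma klein_path_side:
  assumes "0 \<le> t" "t \<le> 1"
  shows "sgn (side e (klein_path x y t)) = sgn ((1 - t) * chord e (klein x) + t * chord e (klein y))"
  unfolding sgn_side klein_path_def klein_unklein[OF klein_convex_norm[OF assms]] chord_convex ..

lemma klein_path_ball:
  assumes "0 < t" "t \<le> 1" "norm y < 1" shows "norm (klein_path x y t) < 1"
proof -
  have "norm (of_real (1 - t) * klein x + of_real t * klein y) \<le> (1 - t) * norm (klein x) + t * norm (klein y)"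
    using assms by (intro norm_triangle_le) (simp add: norm_mult del: of_real_diff)
  also have "\<dots> < (1 - t) * 1 + t * 1"
    using assms norm_klein_le norm_klein_less by (intro add_le_less_mono mult_left_mono mult_strict_left_mono) auto
  finally show ?thesis unfolding klein_path_def by (intro norm_unklein_less) simp
qed

lemma klein_path_ends: "norm x \<le> 1 \<Longrightarrow> klein_path x y 0 = x" "norm y \<le> 1 \<Longrightarrow> klein_path x y 1 = y"
  unfolding klein_path_def by (simp_all add: unklein_klein)

lemma continuous_on_klein_path: "continuous_on {0..1} (klein_path x y)"
  unfolding klein_path_def
  by (intro continuous_on_compose2[OF continuous_on_unklein] continuous_intros)
     (auto simp del: of_real_diff simp: klein_convex_norm)

text \<open>A connected set that avoids a geodesic stays on one side of it.  Conversely, the hyperbolic segment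
between two points on the same side of all geodesics meets none of them.\<close>

lemma connected_component_region:
  assumes arcs: "\<And>e. e \<in> L \<Longrightarrow> is_arc e" and x: "x \<in> open_cells L"
  shows "connected_component_set (open_cells L) x = region L x"
proof (intro equalityI subsetI)
  fix y assume "y \<in> connected_component_set (open_cells L) x"
  then obtain T where T: "connected T" "T \<subseteq> open_cells L" "x \<in> T" "y \<in> T"
    unfolding connected_component_def by blast
  have "side e x * side e y > 0" if e: "e \<in> L" for e
  proof (rule ccontr)
    assume n: "\<not> side e x * side e y > 0"
    have "connected (side e ` T)" by (intro connected_continuous_image continuous_on_side T)
    moreover have "side e x \<in> side e ` T" "side e y \<in> side e ` T" using T by auto
    ultimately have "0 \<in> side e ` T" using n connectedD_interval[of "side e ` T" "side e x" "side e y" 0]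
      connectedD_interval[of "side e ` T" "side e y" "side e x" 0] by (auto simp: zero_less_mult_iff not_less)
    thus False using T(2) open_cells_side[OF arcs] e by auto
  qed
  thus "y \<in> region L x" using T open_cells_side[OF arcs] by (auto simp: region_def)
next
  fix y assume y: "y \<in> region L x"
  let ?T = "klein_path x y ` {0..1}"
  have n: "norm x < 1" "norm y < 1" using x y by (auto simp: open_cells_def region_def)
  have "?T \<subseteq> open_cells L"
  proof
    fix z assume "z \<in> ?T"
    then obtain t where t: "0 \<le> t" "t \<le> 1" "z = klein_path x y t" by auto
    have "norm z < 1" using klein_path_ball[of t y x] klein_path_ends(1)[of x y] t n by (cases "t = 0") auto
    moreover have "side e z \<noteq> 0" if "e \<in> L" for e
    proof -
      have "side e x * side e y > 0" using y that by (auto simp: region_def)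
      hence "chord e (klein x) * chord e (klein y) > 0" by (simp add: side_mult_sign)
      hence "(1 - t) * chord e (klein x) + t * chord e (klein y) \<noteq> 0"
        using same_sign_convex[of "chord e (klein x)" "chord e (klein y)" t] t by auto
      hence "sgn (side e z) \<noteq> 0" unfolding t(3) klein_path_side[OF t(1,2)] by (simp add: sgn_zero_iff)
      thus ?thesis by (simp add: sgn_zero_iff)
    qed
    ultimately show "z \<in> open_cells L" using open_cells_side[OF arcs] by auto
  qed
  moreover have "connected ?T" by (intro connected_continuous_image continuous_on_klein_path) simp
  moreover have "x \<in> ?T" "y \<in> ?T" using klein_path_ends n by (force intro: image_eqI[of _ _ 0] image_eqI[of _ _ 1])+
  ultimately show "y \<in> connected_component_set (open_cells L) x"
    unfolding connected_component_def by blast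
qed

lemma complementary_regions_eq:
  assumes "\<And>e. e \<in> L \<Longrightarrow> is_arc e" shows "complementary_regions L = region L ` open_cells L"
  unfolding complementary_regions_def open_cells_def[symmetric] components_def
  using connected_component_region[OF assms] by auto

text \<open>A point that satisfies the weak inequalities is the limit of interior points along the hyperbolic
segment to \<open>x\<close>, on which the inequalities become strict.\<close>

lemma closure_region:
  assumes arcs: "\<And>e. e \<in> L \<Longrightarrow> is_arc e" and x: "x \<in> open_cells L"
  shows "closure (region L x) = {z \<in> cball 0 1. \<forall>e\<in>L. side e x * side e z \<ge> 0}"
proof
  have "closed {z. side e x * side e z \<ge> 0}" for e
    by (intro closed_Collect_le continuous_intros continuous_on_side)
  hence "closed (cball 0 1 \<inter> (\<Inter>e\<in>L. {z. side e x * side e z \<ge> 0}))" by blast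
  moreover have "region L x \<subseteq> cball 0 1 \<inter> (\<Inter>e\<in>L. {z. side e x * side e z \<ge> 0})"
    by (auto simp: region_def less_imp_le)
  ultimately show "closure (region L x) \<subseteq> {z \<in> cball 0 1. \<forall>e\<in>L. side e x * side e z \<ge> 0}"
    using closure_minimal by blast
next
  show "{z \<in> cball 0 1. \<forall>e\<in>L. side e x * side e z \<ge> 0} \<subseteq> closure (region L x)"
  proof
    fix z assume "z \<in> {z \<in> cball 0 1. \<forall>e\<in>L. side e x * side e z \<ge> 0}"
    hence z: "norm z \<le> 1" "\<And>e. e \<in> L \<Longrightarrow> side e x * side e z \<ge> 0" by auto
    have nx: "norm x < 1" using x by (simp add: open_cells_def)
    let ?t = "\<lambda>n::nat. 1 / real (Suc n)"
    have t: "0 < ?t n" "?t n \<le> 1" for n by auto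
    have "klein_path z x (?t n) \<in> region L x" for n
    proof -
      have "side e x * side e (klein_path z x (?t n)) > 0" if e: "e \<in> L" for e
      proof -
        let ?c = "chord e (klein x)" and ?d = "chord e (klein z)"
        have "?c \<noteq> 0" using x open_cells_side[OF arcs] e side_chord[of e x] by auto
        hence "?c * ?c > 0" by (auto simp: zero_less_mult_iff)
        moreover have "?c * ?d \<ge> 0" using z(2)[OF e] by (simp add: side_mult_sign)
        ultimately have "(1 - ?t n) * (?c * ?d) + ?t n * (?c * ?c) > 0"
          using t[of n] by (intro add_nonneg_pos[OF mult_nonneg_nonneg mult_pos_pos]) auto
        hence "?c * ((1 - ?t n) * ?d + ?t n * ?c) > 0" by (simp add: algebra_simps)
        hence "sgn ?c * sgn ((1 - ?t n) * ?d + ?t n * ?c) > 0" by (simp add: sgn_mult[symmetric])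
        hence "sgn (side e x) * sgn (side e (klein_path z x (?t n))) > 0"
          unfolding klein_path_side[OF less_imp_le[OF t(1)] t(2)] sgn_side[of e x] .
        thus ?thesis by (simp add: sgn_mult[symmetric])
      qed
      thus ?thesis using klein_path_ball[OF t nx] by (simp add: region_def)
    qed
    moreover have "(\<lambda>n. klein_path z x (?t n)) \<longlonglongrightarrow> klein_path z x 0"
    proof (rule continuous_on_tendsto_compose[OF continuous_on_klein_path])
      show "?t \<longlonglongrightarrow> 0" using LIMSEQ_inverse_real_of_nat by (simp add: inverse_eq_divide)
    qed (use t in \<open>auto simp: less_imp_le\<close>)
    ultimately show "z \<in> closure (region L x)" unfolding klein_path_ends(1)[OF z(1)] closure_sequential
      by (intro exI[of _ "\<lambda>n. klein_path z x (?t n)"]) blast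
  qed
qed

lemma geodesic_closure_region:
  assumes arcs: "\<And>e. e \<in> L \<Longrightarrow> is_arc e" and x: "x \<in> open_cells L" and e: "is_arc e"
  shows "geodesic e \<subseteq> closure (region L x) \<longleftrightarrow> e \<subseteq> closure (region L x)"
proof
  assume "geodesic e \<subseteq> closure (region L x)" thus "e \<subseteq> closure (region L x)" using arc_subset_geodesic[OF e] by blast
next
  assume a: "e \<subseteq> closure (region L x)"
  show "geodesic e \<subseteq> closure (region L x)"
  proof
    fix z assume "z \<in> geodesic e"
    hence z: "norm z \<le> 1" "side e z = 0" by (auto simp: geodesic_side[OF e])
    hence c: "chord e (klein z) = 0" using side_chord[of e z] side_factor_pos[of z] by simp
    have "side g x * side g z \<ge> 0" if g: "g \<in> L" for g
    proof -
      have "side g x * side g p \<ge> 0" if "p \<in> e" for p using a that g closure_region[OF arcs x] by auto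
      hence "side g x * chord g (klein z) \<ge> 0" by (intro geodesic_side_nonneg[OF e _ c norm_klein_le]) auto
      hence "(1 + (norm z)\<^sup>2) * (side g x * chord g (klein z)) \<ge> 0"
        by (rule mult_nonneg_nonneg[OF less_imp_le[OF side_factor_pos]])
      thus ?thesis unfolding side_chord[of g z] by (simp only: mult.left_commute)
    qed
    thus "z \<in> closure (region L x)" using z closure_region[OF arcs x] by auto
  qed
qed

text \<open>If an arc \<open>e'\<close> ends on one closed side of \<open>e\<close>, it does not cross the other open side: a segment
between two points of that side which crossed \<open>e'\<close> would meet the chord of \<open>e'\<close>, on which
\<open>side e\<close> has the opposite weak sign.\<close>

lemma cap_one_side:
  assumes e': "is_arc e'" and ends: "\<And>p. p \<in> e' \<Longrightarrow> s * side e p \<ge> 0"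
    and x: "s * side e x < 0" and y: "s * side e y < 0"
  shows "side e' x * side e' y > 0"
proof (rule ccontr)
  assume "\<not> side e' x * side e' y > 0"
  define u v where "u = chord e' (klein x)" "v = chord e' (klein y)"
  have uv: "\<not> u * v > 0" using \<open>\<not> side e' x * side e' y > 0\<close> by (simp add: side_mult_sign u_v_def)
  \<comment> \<open>The parameter at which the segment from \<open>klein x\<close> to \<open>klein y\<close> crosses the chord.\<close>
  define t where "t = (if u = v then 0 else u / (u - v))"
  have t: "0 \<le> t" "t \<le> 1" "(1 - t) * u + t * v = 0"
    using uv by (auto simp: t_def divide_simps zero_less_mult_iff not_less algebra_simps split: if_splits)
  define w where "w = of_real (1 - t) * klein x + of_real t * klein y"
  have w: "norm w \<le> 1" "chord e' w = 0"
    using klein_convex_norm[OF t(1,2)] t(3) unfolding w_def chord_convex u_v_def by auto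
  have nn: "s * chord e w \<ge> 0" by (rule geodesic_side_nonneg[OF e' ends w(2,1)])
  have neg: "s * chord e (klein z) < 0" if "s * side e z < 0" for z
  proof -
    have "(1 + (norm z)\<^sup>2) * (s * chord e (klein z)) < 0" using that unfolding side_chord by (simp only: mult.left_commute)
    thus ?thesis using side_factor_pos[of z] mult_less_0_iff by (metis not_less_iff_gr_or_eq)
  qed
  have "s * chord e (klein x) < 0" "s * chord e (klein y) < 0" using neg x y by auto
  hence "(1 - t) * (s * chord e (klein x)) + t * (s * chord e (klein y)) < 0"
    using t(1,2) by (intro convex_bound_lt) auto
  thus False using nn unfolding w_def chord_convex by (simp add: algebra_simps)
qed

text \<open>The parallelogram law.\<close>

lemma midpoint_in_disk:
  assumes "p \<in> circle" "q \<in> circle" "p \<noteq> q" shows "norm ((p + q) / 2) < 1"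
proof -
  have "(norm (p + q))\<^sup>2 + (norm (p - q))\<^sup>2 = 2 * (norm p)\<^sup>2 + 2 * (norm q)\<^sup>2"
    unfolding cmod_power2 by (simp add: power2_eq_square algebra_simps)
  moreover have "(norm (p - q))\<^sup>2 > 0" using assms by simp
  moreover have "(norm p)\<^sup>2 = 1" "(norm q)\<^sup>2 = 1" using assms by auto
  ultimately have "(norm (p + q))\<^sup>2 < 4" by linarith
  hence "(norm (p + q))\<^sup>2 < 2\<^sup>2" by simp
  hence "norm (p + q) < 2" using power_less_imp_less_base by fastforce
  thus ?thesis by (simp add: norm_divide)
qed

text \<open>A bijection of the circle that respects the arcs and their sides carries regions to regions, although
it is not extended to the disk: the image region contains the centroid, in the Klein model, of the
images of three boundary points.  No arc contains all three of them, so the centroid is strictly on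
the correct side of each arc.\<close>

lemma region_transport:
  assumes arcs: "\<And>e. e \<in> L \<Longrightarrow> is_arc e" and f: "f \<in> circle \<rightarrow> circle" "inj_on f circle"
    and sides: "\<And>e p q. e \<in> L \<Longrightarrow> p \<in> circle \<Longrightarrow> q \<in> circle \<Longrightarrow>
      side e p * side e q > 0 \<Longrightarrow> side (f ` e) (f p) * side (f ` e) (f q) > 0"
    and sides': "\<And>e p q. e \<in> L \<Longrightarrow> p \<in> circle \<Longrightarrow> q \<in> circle \<Longrightarrow>
      side (f ` e) (f p) * side (f ` e) (f q) > 0 \<Longrightarrow> side e p * side e q > 0"
    and x: "x \<in> open_cells L"
    and P: "P \<subseteq> circle \<inter> closure (region L x)" "card P = 3"
  obtains y where "y \<in> open_cells ((`) f ` L)"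
    "\<And>e p. e \<in> L \<Longrightarrow> p \<in> circle \<Longrightarrow> side e x * side e p > 0 \<longleftrightarrow> side (f ` e) y * side (f ` e) (f p) > 0"
proof -
  have arcs': "is_arc (f ` e)" if "e \<in> L" for e
  proof -
    from that obtain p q where pq: "p \<in> circle" "q \<in> circle" "p \<noteq> q" "e = {p, q}" using arcs is_arc_def by metis
    hence "f p \<in> circle" "f q \<in> circle" "f p \<noteq> f q" using f by (auto simp: inj_on_def)
    thus ?thesis unfolding is_arc_def using pq by blast
  qed
  obtain p q r where pqr: "P = {p, q, r}" "p \<noteq> q" "q \<noteq> r" "p \<noteq> r" using P(2) unfolding card_3_iff by blast
  have c: "p \<in> circle" "q \<in> circle" "r \<in> circle" using P(1) pqr(1) by auto
  have fc: "f p \<in> circle" "f q \<in> circle" "f r \<in> circle" "f p \<noteq> f q" using c f pqr by (auto simp: inj_on_def)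
  define w where "w = (f p + f q + f r) / 3"
  have "norm (f p + f q) < 2" using midpoint_in_disk[OF fc(1,2,4)] by (simp add: norm_divide)
  hence "norm (f p + f q + f r) < 3" using norm_triangle_ineq[of "f p + f q" "f r"] fc by simp
  hence w: "norm w < 1" by (simp add: w_def norm_divide)
  define y where "y = unklein w"
  have ky: "klein y = w" unfolding y_def using klein_unklein w by simp
  have ny: "norm y < 1" unfolding y_def using norm_unklein_less w by simp
  have key: "\<exists>u\<in>P. side e x * side e u > 0 \<and> side (f ` e) y * side (f ` e) (f u) > 0" if e: "e \<in> L" for e
  proof -
    obtain a b where "e = {a, b}" using arcs[OF e] is_arc_def by auto
    then obtain u where u: "u \<in> P" "u \<notin> e" using pqr by (metis insertI1 insertI2 insertE singletonD)
    have uc: "u \<in> circle" using u P by auto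
    have nn: "side e x * side e v \<ge> 0" if "v \<in> P" for v using that P closure_region[OF arcs x] e by auto
    have xe: "side e x \<noteq> 0" using open_cells_side[OF arcs] x e by blast
    have ue: "side e x * side e u > 0" using nn[OF u(1)] side_circle_zero[OF arcs[OF e] uc] u(2) xe by (simp add: less_le)
    let ?k = "chord (f ` e) (f u)"
    have fu: "f u \<in> circle" using uc f by auto
    have nn': "?k * chord (f ` e) (f v) \<ge> 0" if v: "v \<in> P" for v
    proof -
      have vc: "v \<in> circle" using v P by auto
      hence fv: "f v \<in> circle" using f by auto
      show ?thesis
      proof (cases "side e v = 0")
        case True
        hence "v \<in> e" using side_circle_zero[OF arcs[OF e] vc] by simp
        hence "side (f ` e) (f v) = 0" using side_circle_zero[OF arcs'[OF e] fv] by simp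
        thus ?thesis using side_chord[of "f ` e" "f v"] side_factor_pos[of "f v"] by (simp add: klein_circle[OF fv])
      next
        case False
        hence "side e x * side e v > 0" using nn[OF v] xe by (simp add: less_le)
        hence "side e u * side e v > 0" using ue same_sign_trans by (metis mult.commute)
        from sides[OF e uc vc this] show ?thesis by (simp add: side_mult_sign klein_circle[OF fu] klein_circle[OF fv] less_imp_le)
      qed
    qed
    have "?k \<noteq> 0"
    proof
      assume "?k = 0"
      hence "side (f ` e) (f u) = 0" using side_chord[of "f ` e" "f u"] by (simp add: klein_circle[OF fu])
      hence "f u \<in> f ` e" using side_circle_zero[OF arcs'[OF e] fu] by simp
      thus False using u(2) uc f(2) arc_subset_circle[OF arcs[OF e]] unfolding inj_on_def by blast
    qed
    hence kk: "?k * ?k > 0" by (auto simp: zero_less_mult_iff)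
    have "chord (f ` e) w = (chord (f ` e) (f p) + chord (f ` e) (f q) + chord (f ` e) (f r)) / 3"
      unfolding chord_def chord_side_def w_def by (simp add: field_simps)
    hence "?k * chord (f ` e) w = (?k * chord (f ` e) (f p) + ?k * chord (f ` e) (f q) + ?k * chord (f ` e) (f r)) / 3"
      by (simp only: times_divide_eq_right distrib_left)
    moreover have "?k * chord (f ` e) (f p) \<ge> 0" "?k * chord (f ` e) (f q) \<ge> 0" "?k * chord (f ` e) (f r) \<ge> 0"
      using nn' pqr by auto
    moreover have "?k * chord (f ` e) (f p) > 0 \<or> ?k * chord (f ` e) (f q) > 0 \<or> ?k * chord (f ` e) (f r) > 0"
      using kk u(1) pqr by auto
    ultimately have "?k * chord (f ` e) w > 0" by auto
    hence "side (f ` e) y * side (f ` e) (f u) > 0" by (simp add: side_mult_sign ky klein_circle[OF fu] mult.commute)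
    thus ?thesis using u ue by blast
  qed
  show ?thesis
  proof (rule that[of y])
    have "side g y \<noteq> 0" if "g \<in> (`) f ` L" for g using that key by fastforce
    thus "y \<in> open_cells ((`) f ` L)" using open_cells_side[of "(`) f ` L" y] arcs' ny by auto
  next
    fix e v assume e: "e \<in> L" and v: "v \<in> circle"
    obtain u where u: "u \<in> P" "side e x * side e u > 0" "side (f ` e) y * side (f ` e) (f u) > 0" using key[OF e] by blast
    have uc: "u \<in> circle" using u P by auto
    have "side e x * side e v > 0 \<longleftrightarrow> side e u * side e v > 0" using u(2) same_sign_trans by (metis mult.commute)
    also have "\<dots> \<longleftrightarrow> side (f ` e) (f u) * side (f ` e) (f v) > 0" using sides[OF e uc v] sides'[OF e uc v] by blast
    also have "\<dots> \<longleftrightarrow> side (f ` e) y * side (f ` e) (f v) > 0" using u(3) same_sign_trans by (metis mult.commute)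
    finally show "side e x * side e v > 0 \<longleftrightarrow> side (f ` e) y * side (f ` e) (f v) > 0" .
  qed
qed

section \<open>Gaps and faces have at least two bordering arcs\<close>

text \<open>An arc of the lamination is encoded by the interval on its side away from the centre.\<close>

definition beneath :: "real \<Rightarrow> real \<Rightarrow> bool" where
  "beneath a b \<longleftrightarrow> (\<exists>n. piece n True a b) \<and> (a, b) \<noteq> (2/3, 4/3)"

lemma beneath_bounds:
  assumes "beneath a b" shows "1/3 \<le> a" "a < b" "b \<le> 4/3" "b \<le> a + 1/3"
proof -
  obtain n where n: "piece n True a b" "(a, b) \<noteq> (2/3, 4/3)" using assms unfolding beneath_def by blast
  show "1/3 \<le> a" "a < b" "b \<le> 4/3" using piece_bounds[OF n(1)] by auto
  show "b \<le> a + 1/3"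
  proof (cases n)
    case 0
    thus ?thesis using n by (auto elim: piece.cases)
  next
    case (Suc m)
    have "(1::real) \<le> 2 ^ m" by simp
    hence "(2/3) / 2 ^ Suc m \<le> (1::real) / 3" by (simp add: field_simps)
    thus ?thesis using piece_length[OF n(1)] unfolding Suc by linarith
  qed
qed

lemma arcA_lamination: "arcA \<in> lamination"
  using lamination_iff by blast

lemma primary_arc_lamination: "piece n t a b \<Longrightarrow> primary_arc a b \<in> lamination"
  using lamination_iff by blast

lemma lamination_beneath: "e \<in> lamination \<longleftrightarrow> (\<exists>a b. beneath a b \<and> e = {point a, point b})"
proof
  assume "e \<in> lamination"
  thus "\<exists>a b. beneath a b \<and> e = {point a, point b}"
    unfolding lamination_iff
  proof (elim disjE exE conjE)
    assume "e = arcA" thus ?thesis using pieceA by (intro exI[of _ "1/3"] exI[of _ "2/3"]) (auto simp: beneath_def)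
  next
    fix n t a b assume ab: "piece n t a b" "e = primary_arc a b"
    obtain p q where "primary_arc a b = {point p, point q}" "p = a + (b - a) / 4" "q = b - (b - a) / 4" "q < 4/3"
      using piece_primary_arc[OF ab(1)] by metis
    moreover have "piece (Suc n) True p q" using piece.middle[OF ab(1)] calculation by simp
    ultimately show ?thesis using ab unfolding beneath_def by (intro exI[of _ p] exI[of _ q]) auto
  qed
next
  assume "\<exists>a b. beneath a b \<and> e = {point a, point b}"
  then obtain n a b where ab: "piece n True a b" "(a, b) \<noteq> (2/3, 4/3)" "e = {point a, point b}" unfolding beneath_def by blast
  from ab(1) show "e \<in> lamination"
  proof (cases rule: piece.cases)
    case (middle n t a' b')
    hence "e = primary_arc a' b'" using ab(3) by (simp add: primary_arc_def)
    thus ?thesis using middle unfolding lamination_iff by blast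
  next
    case pieceA
    thus ?thesis using ab(3) arcA_lamination by (simp only:)
  next
    case pieceB
    thus ?thesis using ab(2) by (simp only:)
  qed simp_all
qed

lemma lamination_is_arc: "e \<in> lamination \<Longrightarrow> is_arc e"
  unfolding lamination_beneath using beneath_bounds is_arcI by fastforce

lemma arc_side_inside: "c \<le> t \<Longrightarrow> t \<le> d \<Longrightarrow> d \<le> c + 1 \<Longrightarrow> arc_side c d (point t) \<ge> 0"
  unfolding arc_side_point by (intro mult_nonneg_nonneg sin_ge_zero) auto

lemma arc_side_outside:
  assumes "(d \<le> t \<and> t \<le> c + 1) \<or> (d - 1 \<le> t \<and> t \<le> c)" "c < d" "d \<le> c + 1"
  shows "arc_side c d (point t) \<le> 0"
proof -
  have neg: "sin (pi * (u - v)) = - sin (pi * (v - u))" for u v :: real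
    by (metis minus_diff_eq mult_minus_right sin_minus)
  from assms(1) show ?thesis
  proof
    assume "d \<le> t \<and> t \<le> c + 1"
    hence "sin (pi * (t - c)) \<ge> 0" "sin (pi * (t - d)) \<ge> 0" using assms by (auto intro!: sin_ge_zero)
    thus ?thesis unfolding arc_side_point neg[of d t] by (simp add: mult_nonneg_nonneg)
  next
    assume "d - 1 \<le> t \<and> t \<le> c"
    hence "sin (pi * (c - t)) \<ge> 0" "sin (pi * (d - t)) \<ge> 0" using assms by (auto intro!: sin_ge_zero)
    thus ?thesis unfolding arc_side_point neg[of t c] by (simp add: mult_nonneg_nonneg)
  qed
qed

lemma side_arc_side:
  assumes "is_arc e" "e = {point a, point b}"
  shows "side e x * side e y > 0 \<longleftrightarrow> arc_side a b x * arc_side a b y > 0"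
    "side e x * side e y \<ge> 0 \<longleftrightarrow> arc_side a b x * arc_side a b y \<ge> 0" "side e x = 0 \<longleftrightarrow> arc_side a b x = 0"
proof -
  obtain s :: real where "s = 1 \<or> s = -1" "\<And>z. side e z = s * arc_side a b z" using side_eq[OF assms] by blast
  thus "side e x * side e y > 0 \<longleftrightarrow> arc_side a b x * arc_side a b y > 0"
    "side e x * side e y \<ge> 0 \<longleftrightarrow> arc_side a b x * arc_side a b y \<ge> 0" "side e x = 0 \<longleftrightarrow> arc_side a b x = 0" by auto
qed

lemma cap_arc_side:
  assumes "a < b" "b < a + 1" "c < d" "d < c + 1"
    "arc_side a b (point c) \<le> 0" "arc_side a b (point d) \<le> 0" "arc_side a b x > 0" "arc_side a b y > 0"
  shows "arc_side c d x * arc_side c d y > 0"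
proof -
  let ?e = "{point a, point b}" and ?e' = "{point c, point d}"
  have arcs: "is_arc ?e" "is_arc ?e'" using is_arcI assms by auto
  obtain s :: real where s: "s = 1 \<or> s = -1" "\<And>z. side ?e z = s * arc_side a b z" using side_eq[OF arcs(1) refl] by blast
  have "side ?e' x * side ?e' y > 0"
    by (rule cap_one_side[of _ "- s" ?e]) (use assms s arcs in auto)
  thus ?thesis using side_arc_side[OF arcs(2) refl] by simp
qed

lemma beneath_centre: assumes "beneath a b" shows "arc_side a b 0 < 0"
proof -
  have "cos (pi * (b - a)) > 0"
  proof (rule cos_gt_zero_pi)
    have "pi * (b - a) \<le> pi * (1/3)" using beneath_bounds[OF assms] by (intro mult_left_mono) auto
    moreover have "0 < pi * (b - a)" using beneath_bounds[OF assms] by simp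
    ultimately show "pi * (b - a) < pi / 2" "- (pi / 2) < pi * (b - a)" using pi_gt_zero by linarith+
  qed
  moreover have "pi * (a - b) = - (pi * (b - a))" by (simp add: algebra_simps)
  ultimately show ?thesis unfolding arc_side_def by (simp only: cos_minus) simp
qed

text \<open>The arcs accumulate only at the circle: the geodesic above an interval of length \<open>l\<close> cuts off
only points whose norm exceeds a bound that tends to 1 as \<open>l\<close> tends to 0, and there are only finitely
many pieces of each depth.\<close>

lemma finite_above:
  assumes x: "norm x < 1" shows "finite {(a, b). beneath a b \<and> arc_side a b x > 0}"
proof -
  have "0 < (1 - norm x)\<^sup>2" using x by simp
  hence "2 * norm x < 1 + (norm x)\<^sup>2" by (simp add: power2_eq_square algebra_simps)
  moreover have "((\<lambda>n::nat. cos (pi * ((2/3) / 2 ^ n)) * (1 + (norm x)\<^sup>2)) \<longlongrightarrow> cos (pi * 0) * (1 + (norm x)\<^sup>2)) sequentially"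
    by (intro tendsto_mult tendsto_cos tendsto_const LIMSEQ_divide_realpow_zero) auto
  ultimately have "eventually (\<lambda>n::nat. cos (pi * ((2/3) / 2 ^ n)) * (1 + (norm x)\<^sup>2) > 2 * norm x) sequentially"
    by (intro order_tendstoD(1)[of _ "cos (pi * 0) * (1 + (norm x)\<^sup>2)"]) auto
  then obtain N :: nat where N: "\<And>n. n \<ge> N \<Longrightarrow> cos (pi * ((2/3) / 2 ^ n)) * (1 + (norm x)\<^sup>2) > 2 * norm x"
    unfolding eventually_sequentially by blast
  have "{(a, b). beneath a b \<and> arc_side a b x > 0} \<subseteq> (\<Union>n<N. {(a, b). \<exists>t. piece n t a b})"
  proof clarify
    fix a b assume ab: "beneath a b" "arc_side a b x > 0"
    then obtain n where n: "piece n True a b" by (auto simp: beneath_def)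
    have "n < N"
    proof (rule ccontr)
      assume "\<not> n < N"
      hence c: "cos (pi * ((2/3) / 2 ^ n)) * (1 + (norm x)\<^sup>2) > 2 * norm x" using N by simp
      have "cos (pi * ((2/3) / 2 ^ n)) \<le> cos (pi * (b - a))"
      proof (rule cos_monotone_0_pi_le)
        show "0 \<le> pi * (b - a)" using piece_bounds[OF n] by simp
        show "pi * (b - a) \<le> pi * ((2/3) / 2 ^ n)" using piece_length[OF n] by (intro mult_left_mono) auto
        have "(2/3) / 2 ^ n \<le> (1::real)"
        proof -
          have "(1::real) \<le> 2 ^ n" by simp
          hence "(2/3) \<le> (2::real) ^ n" by linarith
          thus ?thesis by (subst divide_le_eq_1_pos) simp_all
        qed
        thus "pi * ((2/3) / 2 ^ n) \<le> pi" using pi_gt_zero mult_left_mono[of "(2/3) / 2 ^ n" 1 pi] by simp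
      qed
      hence "cos (pi * ((2/3) / 2 ^ n)) * (1 + (norm x)\<^sup>2) \<le> cos (pi * (b - a)) * (1 + (norm x)\<^sup>2)"
        using side_factor_pos[of x] by (intro mult_right_mono) auto
      moreover have "cos (pi * (a - b)) = cos (pi * (b - a))" by (metis cos_minus minus_diff_eq mult_minus_right)
      moreover have "2 * Re (x * cis (- (pi * (a + b)))) \<le> 2 * norm x"
        using complex_Re_le_cmod[of "x * cis (- (pi * (a + b)))"] by (simp add: norm_mult)
      ultimately have "arc_side a b x \<le> 0" using c unfolding arc_side_def by simp
      thus False using ab by simp
    qed
    thus "(a, b) \<in> (\<Union>n<N. {(a, b). \<exists>t. piece n t a b})" using n by blast
  qed
  moreover have "finite (\<Union>n<N. {(a, b). \<exists>t. piece n t a b})" using finite_pieces by blast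
  ultimately show ?thesis using finite_subset by blast
qed

text \<open>The form of \<open>closure_region\<close> for the intervals beneath the arcs, for which the positive side is
the one away from the centre.\<close>

lemma closure_region_beneath:
  assumes D: "D \<subseteq> lamination" and x: "x \<in> open_cells D"
  shows "z \<in> closure (region D x) \<longleftrightarrow> norm z \<le> 1 \<and>
    (\<forall>a b. beneath a b \<longrightarrow> {point a, point b} \<in> D \<longrightarrow> arc_side a b x * arc_side a b z \<ge> 0)"
proof -
  have arcs: "is_arc e" if "e \<in> D" for e using that D lamination_is_arc by blast
  have "z \<in> closure (region D x) \<longleftrightarrow> norm z \<le> 1 \<and> (\<forall>e\<in>D. side e x * side e z \<ge> 0)"
    using closure_region[OF arcs x] by auto
  also have "(\<forall>e\<in>D. side e x * side e z \<ge> 0) \<longleftrightarrow>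
    (\<forall>a b. beneath a b \<longrightarrow> {point a, point b} \<in> D \<longrightarrow> arc_side a b x * arc_side a b z \<ge> 0)"
    using side_arc_side(2)[OF arcs] D lamination_beneath by (metis subset_iff)
  finally show ?thesis .
qed

text \<open>The endpoints of the two initial arcs are vertices of every diagram, so they are not inside an
interval beneath an arc.\<close>

lemma central_vertex_outside:
  assumes t: "t \<in> {1/3, 2/3, 5/6, 7/6}" and cd: "beneath c d"
  shows "arc_side c d (point t) \<le> 0"
proof -
  obtain n where n: "piece n True c d" "\<not> (c = 2/3 \<and> d = 4/3)" using cd unfolding beneath_def by auto
  have b: "1/3 \<le> c" "c < d" "d \<le> 4/3" "d \<le> c + 1/3" using beneath_bounds[OF cd] by auto
  have "\<not> (c < t \<and> t < d)"
  proof
    assume a: "c < t \<and> t < d"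
    have nB: "\<not> in_child c d (2/3) (4/3)" using a t b unfolding in_child_iff by auto
    have nB': "\<not> in_child (2/3) (4/3) c d" using b unfolding in_child_iff by (auto simp: field_simps)
    have "d \<le> 2/3" using piece_nested[OF n(1) pieceB] nB nB' n(2) b by auto
    thus False using a t b by auto
  qed
  thus ?thesis using b t by (intro arc_side_outside) auto
qed

text \<open>If some arc has the region on its side away from the centre, take the innermost one: it borders the
region, and so does the primary arc of the interval beneath it.  This requires the comparison with
all arcs of \<open>D\<close>, by the relative position of their intervals.  If there is no such arc, the region
lies around the centre and the two initial arcs border it.\<close>

lemma region_two_arcs:
  assumes D: "D \<subseteq> lamination" and x: "x \<in> open_cells D"
  obtains e e' where "e \<in> lamination" "e' \<in> lamination" "e \<noteq> e'"
    "e \<subseteq> closure (region D x)" "e' \<subseteq> closure (region D x)"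
proof -
  have nx: "norm x < 1" using x by (auto simp: open_cells_def)
  have arcs: "is_arc e" if "e \<in> D" for e using that D lamination_is_arc by blast
  have nz: "arc_side c d x \<noteq> 0" if "beneath c d" "{point c, point d} \<in> D" for c d
    using open_cells_side[OF arcs] x that side_arc_side(3)[OF arcs[OF that(2)] refl] by blast
  define S where "S = {(a, b). beneath a b \<and> {point a, point b} \<in> D \<and> arc_side a b x > 0}"
  have fin: "finite S" by (rule finite_subset[OF _ finite_above[OF nx]]) (auto simp: S_def)
  have outside: "arc_side c d (point t) \<le> 0" if "beneath c d" "1/3 \<le> t" "t \<le> 4/3" "\<not> (c < t \<and> t < d)" for c d t
    using beneath_bounds[OF that(1)] that by (intro arc_side_outside) auto
  show ?thesis
  proof (cases "S = {}")
    case True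
    have neg: "arc_side c d x < 0" if "beneath c d" "{point c, point d} \<in> D" for c d
      using True that nz[OF that] unfolding S_def by force
    have mem: "point t \<in> closure (region D x)" if t: "t \<in> {1/3, 2/3, 5/6, 7/6}" for t
    proof -
      have "arc_side c d x * arc_side c d (point t) \<ge> 0" if cd: "beneath c d" "{point c, point d} \<in> D" for c d
      proof -
        have "arc_side c d (point t) \<le> 0" using central_vertex_outside[OF t cd(1)] .
        thus ?thesis using neg[OF cd] by (simp add: mult_nonpos_nonpos)
      qed
      thus ?thesis unfolding closure_region_beneath[OF D x] by simp
    qed
    show ?thesis
    proof (rule that[of arcA "primary_arc (2/3) (4/3)"])
      have "primary_arc (2/3) (4/3) = {point (5/6), point (7/6)}" by (simp add: primary_arc_def)
      thus "primary_arc (2/3) (4/3) \<subseteq> closure (region D x)" using mem by simp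
      have "point (1/3) \<noteq> point (5/6)" "point (1/3) \<noteq> point (7/6)" using point_inj[of "1/3" "5/6"] point_inj[of "1/3" "7/6"] by auto
      thus "arcA \<noteq> primary_arc (2/3) (4/3)" by (auto simp: primary_arc_def)
    qed (use mem primary_arc_lamination[OF pieceB] arcA_lamination in auto)
  next
    case False
    define len :: "real \<times> real \<Rightarrow> real" where "len = (\<lambda>(a, b). b - a)"
    define p where "p = arg_min_on len S"
    have p: "p \<in> S" "\<And>r. r \<in> S \<Longrightarrow> len p \<le> len r"
      using arg_min_if_finite(1)[OF fin False, of len] arg_min_least[OF fin False, of _ len] unfolding p_def by blast+
    obtain a b where ab: "p = (a, b)" by (cases p)
    have abS: "beneath a b" "{point a, point b} \<in> D" "arc_side a b x > 0" using p(1) ab by (auto simp: S_def)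
    obtain n where n: "piece n True a b" using abS(1) by (auto simp: beneath_def)
    obtain u v where uv: "primary_arc a b = {point u, point v}" "u = a + (b - a) / 4" "v = b - (b - a) / 4"
      "a < u" "u < v" "v < b" using piece_primary_arc[OF n] by metis
    have B: "1/3 \<le> a" "a < b" "b \<le> 4/3" "b \<le> a + 1/3" using beneath_bounds[OF abS(1)] by auto
    \<comment> \<open>The midpoint of the innermost interval represents \<open>x\<close> on the circle: no arc outside this interval
       separates them.\<close>
    define m where "m = (a + b) / 2"
    have m: "a < m" "m < b" using B by (auto simp: m_def)
    have mp: "arc_side a b (point m) > 0" using m B by (intro arc_side_point_pos) auto
    have mem: "point t \<in> closure (region D x)" if t: "t \<in> {a, b, u, v}" for t
    proof -
      have tb: "a \<le> t" "t \<le> b" using t uv(4-6) by auto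
      have "arc_side c d x * arc_side c d (point t) \<ge> 0" if cd: "beneath c d" "{point c, point d} \<in> D" for c d
      proof -
        obtain k where k: "piece k True c d" using cd by (auto simp: beneath_def)
        have C: "1/3 \<le> c" "c < d" "d \<le> 4/3" "d \<le> c + 1/3" using beneath_bounds[OF cd(1)] by auto
        have same: "arc_side c d x * arc_side c d (point m) > 0" if "\<not> (a < c \<and> c < b)" "\<not> (a < d \<and> d < b)"
          using outside[OF abS(1), of c] outside[OF abS(1), of d] that B C abS(3) mp by (intro cap_arc_side[of a b]) auto
        from piece_nested[OF n k] consider "a = c" "b = d" | "b \<le> c \<or> d \<le> a" | "in_child c d a b" | "in_child a b c d" by blast
        thus ?thesis
        proof cases
          case 1
          have "arc_side a b (point t) \<ge> 0" using tb B by (intro arc_side_inside) auto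
          thus ?thesis using 1 abS(3) by simp
        next
          case 2
          have "arc_side c d (point m) \<le> 0" using 2 m B by (intro outside[OF cd(1)]) auto
          hence "arc_side c d x < 0" using same 2 C B by (auto simp: zero_less_mult_iff)
          moreover have "arc_side c d (point t) \<le> 0" using 2 tb B by (intro outside[OF cd(1)]) auto
          ultimately show ?thesis by (simp add: mult_nonpos_nonpos)
        next
          case 3
          have "d - c < b - a" "\<not> (c < t \<and> t < d)" using 3 t uv(4-6) C B
            unfolding in_child_iff uv(2,3)[symmetric] by auto
          hence "(c, d) \<notin> S" using p(2)[of "(c, d)"] ab by (auto simp: len_def)
          hence "arc_side c d x < 0" using cd nz[OF cd] unfolding S_def by auto
          moreover have "arc_side c d (point t) \<le> 0" using \<open>\<not> (c < t \<and> t < d)\<close> tb B by (intro outside[OF cd(1)]) auto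
          ultimately show ?thesis by (simp add: mult_nonpos_nonpos)
        next
          case 4
          have sub: "c \<le> a" "b \<le> d" using in_child_subset[OF 4] C by auto
          have "arc_side c d (point m) \<ge> 0" using sub m C by (intro arc_side_inside) auto
          hence "arc_side c d x > 0" using same sub B by (auto simp: zero_less_mult_iff)
          moreover have "arc_side c d (point t) \<ge> 0" using sub tb C by (intro arc_side_inside) auto
          ultimately show ?thesis by simp
        qed
      qed
      thus ?thesis unfolding closure_region_beneath[OF D x] by simp
    qed
    show ?thesis
    proof (rule that[of "{point a, point b}" "primary_arc a b"])
      show "{point a, point b} \<in> lamination" using abS D by blast
      show "primary_arc a b \<in> lamination" using n lamination_iff by blast
      have "point a \<noteq> point u" "point a \<noteq> point v" using point_inj[of a u] point_inj[of a v] uv B by auto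
      thus "{point a, point b} \<noteq> primary_arc a b" unfolding uv(1) by auto
    qed (use mem uv(1) in auto)
  qed
qed

lemma region_three_points:
  assumes D: "D \<subseteq> lamination" and x: "x \<in> open_cells D"
  obtains P where "P \<subseteq> circle \<inter> closure (region D x)" "card P = 3"
proof -
  obtain e e' where e: "e \<in> lamination" "e' \<in> lamination" "e \<noteq> e'"
    "e \<subseteq> closure (region D x)" "e' \<subseteq> closure (region D x)" using region_two_arcs[OF assms] .
  have dj: "e \<inter> e' = {}" using lamination_disjoint e by blast
  obtain p q r where pq: "p \<in> circle" "q \<in> circle" "p \<noteq> q" "e = {p, q}" "r \<in> e'" "r \<in> circle"
    using lamination_is_arc[OF e(1)] lamination_is_arc[OF e(2)] unfolding is_arc_def by blast
  hence "p \<noteq> r" "q \<noteq> r" using dj by auto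
  hence "card {p, q, r} = 3" using pq(3) by simp
  thus ?thesis using that[of "{p, q, r}"] pq e by blast
qed

section \<open>Combinatorial description of dyadic rearrangements\<close>

abbreviation circle_inv :: "(complex \<Rightarrow> complex) \<Rightarrow> complex \<Rightarrow> complex" where
  "circle_inv f \<equiv> inv\<^bsub>BijGroup circle\<^esub> f"

lemma Bij_carrier: "carrier (BijGroup circle) = Bij circle"
  by (simp add: BijGroup_def)

lemma BijGroup_mult: "g \<in> Bij S \<Longrightarrow> f \<in> Bij S \<Longrightarrow> g \<otimes>\<^bsub>BijGroup S\<^esub> f = compose S g f"
  by (simp add: BijGroup_def)

lemma BijGroup_one: "\<one>\<^bsub>BijGroup S\<^esub> = (\<lambda>x\<in>S. x)"
  by (simp add: BijGroup_def)

lemma Bij_inj: "f \<in> Bij S \<Longrightarrow> inj_on f S" and Bij_image: "f \<in> Bij S \<Longrightarrow> f ` S = S"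
  by (auto simp: Bij_def bij_betw_def)

lemma Bij_in: "f \<in> Bij S \<Longrightarrow> x \<in> S \<Longrightarrow> f x \<in> S"
  using Bij_image by blast

lemma circle_inv_Bij: "f \<in> Bij circle \<Longrightarrow> circle_inv f \<in> Bij circle"
  using group.inv_closed[OF group_BijGroup[of circle]] by (simp add: Bij_carrier)

lemma circle_inv_inv: "f \<in> Bij circle \<Longrightarrow> circle_inv (circle_inv f) = f"
  using group.inv_inv[OF group_BijGroup[of circle]] by (simp add: Bij_carrier)

lemma circle_inv_left: "f \<in> Bij circle \<Longrightarrow> z \<in> circle \<Longrightarrow> circle_inv f (f z) = z"
  and circle_inv_right: "f \<in> Bij circle \<Longrightarrow> z \<in> circle \<Longrightarrow> f (circle_inv f z) = z"
proof -
  assume f: "f \<in> Bij circle" and z: "z \<in> circle"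
  have i: "circle_inv f = (\<lambda>x\<in>circle. inv_into circle f x)" by (rule inv_BijGroup[OF f])
  show "circle_inv f (f z) = z" unfolding i using Bij_in[OF f z] Bij_inj[OF f] z by (simp del: mem_sphere add: inv_into_f_f)
  show "f (circle_inv f z) = z" unfolding i using Bij_image[OF f] z by (simp del: mem_sphere add: f_inv_into_f)
qed

lemma circle_inv_image:
  assumes "f \<in> Bij circle" "S \<subseteq> circle" shows "circle_inv f ` (f ` S) = S"
  using circle_inv_left[OF assms(1)] assms(2) by (force simp: image_image)

lemma maps_linearly_inverse:
  assumes "f \<in> Bij circle" "maps_linearly f a b c d" shows "maps_linearly (circle_inv f) c d a b"
  using assms(2) circle_inv_left[OF assms(1)] unfolding maps_linearly_def by (metis point_in_circle)

text \<open>The combinatorial part of an isomorphism of diagrams: the 2-complexes, their cells in the disk and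
the isomorphism between them do not occur.\<close>

definition rearranges :: "(complex \<Rightarrow> complex) \<Rightarrow> complex set set \<Rightarrow> complex set set \<Rightarrow> bool" where
  "rearranges f D R \<longleftrightarrow> f \<in> Bij circle \<and> arc_diagram D \<and> arc_diagram R \<and> (`) f ` D = R \<and>
    (\<forall>a b. circle_interval D a b \<longrightarrow> (\<exists>c d. circle_interval R c d \<and> maps_linearly f a b c d))"

lemma diagram_subset_lamination: "arc_diagram D \<Longrightarrow> D \<subseteq> lamination"
  by (auto simp: lamination_def)

lemma diagram_arc_circle: "arc_diagram D \<Longrightarrow> e \<in> D \<Longrightarrow> e \<subseteq> circle"
  using diagram_subset_lamination lamination_is_arc arc_subset_circle by blast

lemma chain_cover: "chain p xs q \<Longrightarrow> p \<le> x \<Longrightarrow> x < q \<Longrightarrow> \<exists>(a, b) \<in> set xs. a \<le> x \<and> x < b"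
  by (induction p xs q rule: chain.induct) (auto, force)

lemma diagram_covers_circle:
  assumes "arc_diagram D" "z \<in> circle"
  obtains a b x where "circle_interval D a b" "a \<le> x" "x < b" "z = point x"
proof -
  obtain \<tau> \<sigma> where L: "has_intervals D (leaves2 \<tau> \<sigma>)" using diagram_leaves[OF assms(1)] by blast
  obtain x where x: "1/3 \<le> x" "x < 1/3 + 1" "z = point x" using circle_point[OF assms(2)] by metis
  have "x < 4/3" using x by simp
  from chain_cover[OF chain_leaves2 x(1) this] obtain a b where ab: "(a, b) \<in> set (leaves2 \<tau> \<sigma>)" "a \<le> x" "x < b" by blast
  have "circle_interval D a b" using has_intervals_member[OF L ab(1)] .
  thus ?thesis using that ab x by blast
qed

lemma diagram_vertex_start:
  assumes "arc_diagram D" "v \<in> \<Union>D"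
  obtains a b where "circle_interval D a b" "v = point a"
proof -
  have "v \<in> circle" using assms diagram_arc_circle by blast
  then obtain a b x where x: "circle_interval D a b" "a \<le> x" "x < b" "v = point x"
    using diagram_covers_circle[OF assms(1)] by blast
  have "x \<in> vertex_angles D" using assms(2) x(4) by (simp add: vertex_angles_def)
  hence "x = a" using x unfolding circle_interval_consecutive consecutive_def by force
  thus ?thesis using that x by blast
qed

lemma circle_interval_same_start:
  assumes "circle_interval D a b" "circle_interval D c d" "point a = point c"
  obtains n :: int where "c = a + of_int n" "d = b + of_int n"
proof -
  obtain n :: int where n: "c = a + of_int n" using assms(3) point_eq_iff by metis
  have "consecutive (vertex_angles D) (a + of_int n) (b + of_int n)" "consecutive (vertex_angles D) c d"
    using assms by (simp_all add: circle_interval_consecutive consecutive_shift)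
  hence "d = b + of_int n" using consecutive_overlap[of _ "a + of_int n" "b + of_int n" c d] n
    by (auto simp: consecutive_def)
  thus ?thesis using that n by blast
qed

lemma circle_interval_same_segment:
  assumes "circle_interval D a b" "circle_interval D c d" "segment a b = segment c d"
  obtains n :: int where "c = a + of_int n" "d = b + of_int n"
proof -
  define m where "m = (a + b) / 2"
  have m: "a < m" "m < b" using circle_interval_less[OF assms(1)] by (auto simp: m_def)
  have "point m \<in> segment a b" using m by (auto simp: segment_def)
  then obtain x where x: "c \<le> x" "x \<le> d" "point m = point x" using assms(3) by (auto simp: segment_def)
  then obtain n :: int where n: "x = m + of_int n" using point_eq_iff by metis
  have 1: "consecutive (vertex_angles D) (a + of_int n) (b + of_int n)" "consecutive (vertex_angles D) c d"
    using assms by (simp_all add: circle_interval_consecutive consecutive_shift)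
  have "a + of_int n = c \<and> b + of_int n = d"
    using consecutive_overlap[OF 1] x m n by auto
  thus ?thesis by (intro that[of n]) auto
qed

lemma rearranges_Union: "rearranges f D R \<Longrightarrow> \<Union>R = f ` \<Union>D"
  unfolding rearranges_def by auto

lemma rearranges_inv:
  assumes "rearranges f D R" shows "rearranges (circle_inv f) R D"
proof -
  have f: "f \<in> Bij circle" "arc_diagram D" "arc_diagram R" "(`) f ` D = R"
    "\<And>a b. circle_interval D a b \<Longrightarrow> \<exists>c d. circle_interval R c d \<and> maps_linearly f a b c d"
    using assms unfolding rearranges_def by auto
  have "(`) (circle_inv f) ` R = (\<lambda>e. circle_inv f ` (f ` e)) ` D" unfolding f(4)[symmetric] image_image ..
  also have "\<dots> = (\<lambda>e. e) ` D" using circle_inv_image[OF f(1)] diagram_arc_circle[OF f(2)] by (intro image_cong) auto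
  finally have "(`) (circle_inv f) ` R = D" by simp
  moreover have "\<exists>a b. circle_interval D a b \<and> maps_linearly (circle_inv f) c d a b" if cd: "circle_interval R c d" for c d
  proof -
    have "point c \<in> \<Union>R" using cd by (auto simp: circle_interval_def)
    then obtain v where v: "v \<in> \<Union>D" "point c = f v" using rearranges_Union[OF assms] by blast
    obtain a b where ab: "circle_interval D a b" "v = point a" using diagram_vertex_start[OF f(2) v(1)] .
    obtain c' d' where cd': "circle_interval R c' d'" "maps_linearly f a b c' d'" using f(5)[OF ab(1)] by blast
    have "point c' = point c" using maps_linearly_ends(1)[OF cd'(2)] ab v by simp
    then obtain n :: int where n: "c = c' + of_int n" "d = d' + of_int n" using circle_interval_same_start[OF cd'(1) cd] by blast
    have "maps_linearly f a b c d" using cd'(2) n by simp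
    thus ?thesis using maps_linearly_inverse[OF f(1)] ab(1) by blast
  qed
  ultimately show ?thesis unfolding rearranges_def using circle_inv_Bij f by blast
qed

lemma maps_linearly_children:
  assumes "maps_linearly f a b c d"
  shows "maps_linearly f a (a + (b - a) / 4) c (c + (d - c) / 4)"
    "maps_linearly f (a + (b - a) / 4) (b - (b - a) / 4) (c + (d - c) / 4) (d - (d - c) / 4)"
    "maps_linearly f (b - (b - a) / 4) b (d - (d - c) / 4) d"
    "f ` primary_arc a b = primary_arc c d"
proof -
  have e: "a + 0 * (b - a) = a" "a + (1/4) * (b - a) = a + (b - a) / 4" "a + (3/4) * (b - a) = b - (b - a) / 4"
    "a + 1 * (b - a) = b" for a b :: real by (simp_all add: field_simps)
  show 1: "maps_linearly f a (a + (b - a) / 4) c (c + (d - c) / 4)"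
    using maps_linearly_sub[OF assms, of 0 "1/4"] unfolding e by simp
  show "maps_linearly f (a + (b - a) / 4) (b - (b - a) / 4) (c + (d - c) / 4) (d - (d - c) / 4)"
    using maps_linearly_sub[OF assms, of "1/4" "3/4"] unfolding e by simp
  show 3: "maps_linearly f (b - (b - a) / 4) b (d - (d - c) / 4) d"
    using maps_linearly_sub[OF assms, of "3/4" 1] unfolding e by simp
  show "f ` primary_arc a b = primary_arc c d"
    unfolding primary_arc_def using maps_linearly_ends(2)[OF 1] maps_linearly_ends(1)[OF 3] by simp
qed

text \<open>A linear map commutes with the subdivision of intervals in the ratio \<open>1:2:1\<close>.\<close>

lemma rearranges_refine:
  assumes r: "rearranges f D R" and ab: "circle_interval D a b"
  obtains c d where "circle_interval R c d" "maps_linearly f a b c d"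
    "rearranges f (insert (primary_arc a b) D) (insert (primary_arc c d) R)"
proof -
  have f: "f \<in> Bij circle" "arc_diagram D" "arc_diagram R" "(`) f ` D = R"
    "\<And>a b. circle_interval D a b \<Longrightarrow> \<exists>c d. circle_interval R c d \<and> maps_linearly f a b c d"
    using r unfolding rearranges_def by auto
  obtain c d where cd: "circle_interval R c d" "maps_linearly f a b c d" using f(5)[OF ab] by blast
  let ?D = "insert (primary_arc a b) D" and ?R = "insert (primary_arc c d) R"
  have "\<exists>w z. circle_interval ?R w z \<and> maps_linearly f u v w z" if uv: "circle_interval ?D u v" for u v
    using uv unfolding circle_interval_insert[OF ab]
  proof (elim disjE exE conjE)
    assume u: "circle_interval D u v" "\<nexists>n::int. u = a + of_int n \<and> v = b + of_int n"
    then obtain w z where w: "circle_interval R w z" "maps_linearly f u v w z" using f(5) by blast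
    have "\<not> (w = c + of_int n)" for n :: int
    proof
      assume "w = c + of_int n"
      hence "f (point u) = f (point a)" using maps_linearly_ends(1)[OF w(2)] maps_linearly_ends(1)[OF cd(2)] by simp
      hence "point a = point u" using Bij_inj[OF f(1)] point_in_circle by (metis inj_onD)
      then obtain n :: int where "u = a + of_int n" "v = b + of_int n" using circle_interval_same_start[OF ab u(1)] by blast
      thus False using u(2) by blast
    qed
    hence "circle_interval ?R w z" using w(1) unfolding circle_interval_insert[OF cd(1)] by blast
    thus ?thesis using w(2) by blast
  next
    fix n :: int assume uv': "(u + of_int n, v + of_int n) \<in> children a b"
    have "\<exists>w z. (w, z) \<in> children c d \<and> maps_linearly f x y w z" if "(x, y) \<in> children a b" for x y
      using that maps_linearly_children[OF cd(2)] by (simp only: insert_iff Pair_inject empty_iff) blast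
    from this[OF uv'] obtain w z where wz: "(w, z) \<in> children c d" "maps_linearly f (u + of_int n) (v + of_int n) w z"
      by (elim exE conjE)
    show ?thesis using circle_interval_child[OF cd(1) wz(1)] wz(2) unfolding maps_linearly_shift by blast
  qed
  moreover have "arc_diagram ?D" "arc_diagram ?R" using arc_diagram.step f ab cd by auto
  moreover have "(`) f ` ?D = ?R" using f(4) maps_linearly_children(4)[OF cd(2)] by simp
  ultimately have "rearranges f ?D ?R" unfolding rearranges_def using f(1) by blast
  thus ?thesis using that cd by blast
qed

text \<open>Two diagrams have a common refinement.  It is obtained by repeating on \<open>D\<close> the subdivisions that
produce \<open>D'\<close>: each of them refines an interval of the current diagram or is present already.\<close>

lemma rearranges_union:
  assumes r: "rearranges f D R" shows "arc_diagram D' \<Longrightarrow> \<exists>R'. rearranges f (D \<union> D') R'"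
proof (induction rule: arc_diagram.induct)
  case base
  have D: "arc_diagram D" using r by (simp add: rearranges_def)
  have "{{point (1/3), point (2/3)}, {point (1/6), point (5/6)}} \<subseteq> D"
    using arcA_in_diagram[OF D] primary_B_in_diagram[OF D] unfolding primary_arc_B by simp
  hence "D \<union> {{point (1/3), point (2/3)}, {point (1/6), point (5/6)}} = D" by blast
  thus ?case using r by metis
next
  case (step D' a b)
  then obtain R' where R': "rearranges f (D \<union> D') R'" by blast
  hence U: "arc_diagram (D \<union> D')" by (simp add: rearranges_def)
  show ?case
  proof (cases "primary_arc a b \<in> D \<union> D'")
    case True
    hence "D \<union> insert (primary_arc a b) D' = D \<union> D'" by blast
    thus ?thesis using R' by metis
  next
    case False
    obtain n t and k :: int where k: "piece n t (a + of_int k) (b + of_int k)" using interval_is_piece step by blast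
    have "vertex_angles (D \<union> D') \<inter> {a + of_int k<..<b + of_int k} = {}"
      using diagram_refines_piece[OF U k] False by simp
    moreover have "circle_interval D' (a + of_int k) (b + of_int k)" using step by simp
    ultimately have "circle_interval (D \<union> D') (a + of_int k) (b + of_int k)"
      unfolding circle_interval_consecutive consecutive_def vertex_angles_def by auto
    hence "circle_interval (D \<union> D') a b" by simp
    then obtain c d where "rearranges f (insert (primary_arc a b) (D \<union> D')) (insert (primary_arc c d) R')"
      using rearranges_refine[OF R'] by blast
    moreover have "insert (primary_arc a b) (D \<union> D') = D \<union> insert (primary_arc a b) D'" by blast
    ultimately show ?thesis by metis
  qed
qed

text \<open>The range of \<open>f\<close> and the domain of \<open>g\<close> are refined to a common diagram.\<close>

lemma rearranges_compose:
  assumes f: "rearranges f D R" and g: "rearranges g D' R'"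
  obtains D2 R2 where "rearranges (compose circle g f) D2 R2"
proof -
  have fB: "f \<in> Bij circle" "g \<in> Bij circle" and d: "arc_diagram R" "arc_diagram D'" using f g by (auto simp: rearranges_def)
  obtain D2 where "rearranges (circle_inv f) (R \<union> D') D2" using rearranges_union[OF rearranges_inv[OF f] d(2)] by blast
  from rearranges_inv[OF this] have 1: "rearranges f D2 (R \<union> D')" using circle_inv_inv[OF fB(1)] by simp
  obtain R2 where 2: "rearranges g (R \<union> D') R2" using rearranges_union[OF g d(1)] by (metis Un_commute)
  have "(`) (compose circle g f) ` D2 = R2"
  proof -
    have "arc_diagram D2" using 1 by (simp add: rearranges_def)
    hence D2: "e \<subseteq> circle" if "e \<in> D2" for e using that diagram_arc_circle by metis
    have "compose circle g f ` e = g ` (f ` e)" if "e \<in> D2" for e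
      unfolding image_image using D2[OF that] by (intro image_cong refl) (simp add: compose_def subset_iff)
    hence "(`) (compose circle g f) ` D2 = (\<lambda>e. g ` (f ` e)) ` D2" by (rule image_cong[OF refl])
    also have "\<dots> = (`) g ` ((`) f ` D2)" by (simp add: image_image)
    also have "\<dots> = R2" using 1 2 by (simp add: rearranges_def)
    finally show ?thesis .
  qed
  moreover have "\<exists>c d. circle_interval R2 c d \<and> maps_linearly (compose circle g f) a b c d" if "circle_interval D2 a b" for a b
    using that 1 2 maps_linearly_comp unfolding rearranges_def by meson
  moreover have "compose circle g f \<in> Bij circle" using fB by (simp add: compose_Bij)
  ultimately have "rearranges (compose circle g f) D2 R2" using 1 2 unfolding rearranges_def by blast
  thus ?thesis using that by blast
qed

lemma rearranges_lamination:
  assumes "rearranges f D R" shows "(`) f ` lamination = lamination"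
proof -
  have *: "f ` e \<in> lamination" if r: "rearranges f D R" and e: "e \<in> lamination" for f D R e
  proof -
    obtain D' where D': "arc_diagram D'" "e \<in> D'" using e by (auto simp: lamination_def)
    obtain R' where "rearranges f (D \<union> D') R'" using rearranges_union[OF r D'(1)] by blast
    thus ?thesis using D' unfolding rearranges_def lamination_def by blast
  qed
  have f: "f \<in> Bij circle" using assms by (simp add: rearranges_def)
  have "e \<in> (`) f ` lamination" if e: "e \<in> lamination" for e
  proof
    show "circle_inv f ` e \<in> lamination" using *[OF rearranges_inv[OF assms] e] .
    have "e \<subseteq> circle" using e lamination_is_arc arc_subset_circle by blast
    thus "e = f ` (circle_inv f ` e)" using circle_inv_right[OF f] by (force simp: image_image)
  qed
  thus ?thesis using *[OF assms] by blast
qed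

section \<open>Rearrangements are homeomorphisms and respect regions\<close>

lemma maps_linearly_continuous:
  assumes "maps_linearly f a b c d" "a < b" shows "continuous_on {a..b} (f \<circ> point)"
proof -
  have "continuous_on {a..b} (\<lambda>x. point (c + (x - a) * (d - c) / (b - a)))"
    unfolding point_def using assms(2) by (intro continuous_intros) auto
  thus ?thesis using maps_linearlyD[OF assms] by (subst continuous_on_cong[OF refl]) auto
qed

lemma chain_continuous:
  "chain p xs q \<Longrightarrow> (\<And>a b. (a, b) \<in> set xs \<Longrightarrow> continuous_on {a..b} (F :: real \<Rightarrow> complex)) \<Longrightarrow> continuous_on {p..q} F"
proof (induction p xs q rule: chain.induct)
  case (2 p a b xs q)
  hence "continuous_on {a..b} F" "continuous_on {b..q} F" by auto
  hence "continuous_on ({a..b} \<union> {b..q}) F" by (intro continuous_on_closed_Un) auto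
  moreover have "{a..b} \<union> {b..q} = {p..q}" using 2 chain_le[of b xs q] by auto
  ultimately show ?case by simp
qed simp

text \<open>Each point is interior to the union of two adjacent translates of \<open>[p, p + 1]\<close>, so that continuity
on closed intervals of length 1 suffices.\<close>

lemma periodic_continuous:
  fixes F :: "real \<Rightarrow> complex"
  assumes F: "\<And>x. F (x + 1) = F x" and c: "continuous_on {p..p + 1} F"
  shows "continuous_on UNIV F"
proof -
  have int: "F (x + of_int n) = F x" for x and n :: int
  proof (induction n rule: int_induct[of _ 0])
    case (step1 i) thus ?case using F[of "x + of_int i"] by (simp add: algebra_simps)
  next
    case (step2 i) thus ?case using F[of "x + of_int (i - 1)"] by (simp add: algebra_simps)
  qed simp
  have shift: "continuous_on {p + of_int n..p + of_int n + 1} F" for n :: int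
  proof -
    have "continuous_on {p + of_int n..p + of_int n + 1} (\<lambda>x. F (x + of_int (- n)))"
      by (intro continuous_on_compose2[OF c] continuous_intros) auto
    thus ?thesis unfolding int .
  qed
  have "isCont F x" for x
  proof -
    define n where "n = \<lfloor>x - p\<rfloor>"
    have n: "p + of_int n \<le> x" "x < p + of_int n + 1" unfolding n_def by linarith+
    have "continuous_on ({p + of_int (n - 1)..p + of_int (n - 1) + 1} \<union> {p + of_int n..p + of_int n + 1}) F"
      by (intro continuous_on_closed_Un shift) auto
    moreover have "{p + of_int (n - 1)..p + of_int (n - 1) + 1} \<union> {p + of_int n..p + of_int n + 1} = {p + of_int n - 1..p + of_int n + 1}"
      by auto
    ultimately have "continuous_on {p + of_int n - 1..p + of_int n + 1} F" by simp
    moreover have "x \<in> interior {p + of_int n - 1..p + of_int n + 1}" using n by (simp add: interior_atLeastAtMost_real)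
    ultimately show ?thesis by (rule continuous_on_interior)
  qed
  thus ?thesis by (simp add: continuous_on_eq_continuous_at)
qed

lemma rearranges_continuous:
  assumes "rearranges f D R" shows "continuous_on UNIV (f \<circ> point)"
proof (rule periodic_continuous[of _ "1/3"])
  have D: "arc_diagram D" and lin: "\<And>a b. circle_interval D a b \<Longrightarrow> \<exists>c d. maps_linearly f a b c d"
    using assms unfolding rearranges_def by blast+
  obtain \<tau> \<sigma> where L: "has_intervals D (leaves2 \<tau> \<sigma>)" using diagram_leaves[OF D] by blast
  have "continuous_on {1/3..4/3} (f \<circ> point)"
  proof (rule chain_continuous[OF chain_leaves2[of \<tau> \<sigma>]])
    fix a b assume ab: "(a, b) \<in> set (leaves2 \<tau> \<sigma>)"
    have "circle_interval D a b" using has_intervals_member[OF L ab] .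
    thus "continuous_on {a..b} (f \<circ> point)" using lin maps_linearly_continuous circle_interval_less by blast
  qed
  thus "continuous_on {1/3..1/3 + 1} (f \<circ> point)" by simp
qed simp

lemma is_arc_image:
  assumes "f \<in> Bij circle" "is_arc e" shows "is_arc (f ` e)"
proof -
  obtain p q where pq: "p \<in> circle" "q \<in> circle" "p \<noteq> q" "e = {p, q}" using assms(2) is_arc_def by auto
  hence "f p \<in> circle" "f q \<in> circle" "f p \<noteq> f q" using Bij_in[OF assms(1)] Bij_inj[OF assms(1)] by (blast, blast, metis inj_onD)
  thus ?thesis unfolding is_arc_def using pq by blast
qed

text \<open>Two points on the same side of \<open>e\<close> are joined by an open interval of the circle that avoids \<open>e\<close>; its
image is connected and avoids the endpoints of the image arc.\<close>

lemma continuous_side_image: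
  assumes f: "f \<in> Bij circle" and c: "continuous_on UNIV (f \<circ> point)" and e: "is_arc e"
    and p: "p \<in> circle" and q: "q \<in> circle" and pq: "side e p * side e q > 0"
  shows "side (f ` e) (f p) * side (f ` e) (f q) > 0"
proof -
  obtain a b where ab: "a < b" "b < a + 1" "e = {point a, point b}" using is_arc_ends[OF e] .
  obtain x where x: "a \<le> x" "x < a + 1" "p = point x" using circle_point[OF p] .
  obtain y where y: "a \<le> y" "y < a + 1" "q = point y" using circle_point[OF q] .
  have s: "arc_side a b (point x) * arc_side a b (point y) > 0" using pq side_arc_side(1)[OF e ab(3)] x y by simp
  hence ne: "x \<noteq> a" "x \<noteq> b" "y \<noteq> a" "y \<noteq> b" using arc_side_ends by auto
  have sx: "if x < b then arc_side a b (point x) > 0 else arc_side a b (point x) < 0" if "a \<le> x" "x < a + 1" "x \<noteq> a" "x \<noteq> b" for x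
    using that arc_side_point_pos[of a x b] arc_side_point_neg[of a b x] ab by auto
  have "x < b \<longleftrightarrow> y < b" using sx[of x] sx[of y] x y ne s by (auto simp: zero_less_mult_iff split: if_splits)
  hence "\<exists>u v. x \<in> {u<..<v} \<and> y \<in> {u<..<v} \<and> point ` {u<..<v} \<inter> e = {}"
  proof (cases "x < b")
    case True
    have "point z \<notin> e" if "z \<in> {a<..<b}" for z using that ab point_inj[of z a] point_inj[of z b] by auto
    thus ?thesis using True \<open>x < b \<longleftrightarrow> y < b\<close> x y ne by (intro exI[of _ a] exI[of _ b]) auto
  next
    case False
    have "point z \<notin> e" if "z \<in> {b<..<a + 1}" for z
      using that ab point_inj[of z "a + 1"] point_inj[of z b] by auto
    thus ?thesis using False \<open>x < b \<longleftrightarrow> y < b\<close> x y ne by (intro exI[of _ b] exI[of _ "a + 1"]) auto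
  qed
  then obtain u v where uv: "x \<in> {u<..<v}" "y \<in> {u<..<v}" "point ` {u<..<v} \<inter> e = {}" by blast
  let ?T = "(f \<circ> point) ` {u<..<v}"
  have arc: "is_arc (f ` e)" using is_arc_image[OF f e] .
  have "side (f ` e) z \<noteq> 0" if z: "z \<in> ?T" for z
  proof
    obtain w where w: "w \<in> {u<..<v}" "z = f (point w)" using z by auto
    assume "side (f ` e) z = 0"
    hence "f (point w) \<in> f ` e" using side_circle_zero[OF arc] w Bij_in[OF f point_in_circle] by simp
    hence "point w \<in> e" using Bij_inj[OF f] arc_subset_circle[OF e] point_in_circle by (meson inj_on_image_mem_iff)
    thus False using uv(3) w by blast
  qed
  hence zero: "0 \<notin> side (f ` e) ` ?T" by auto
  have con: "connected (side (f ` e) ` ?T)"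
    by (intro connected_continuous_image continuous_on_side continuous_on_subset[OF c] subset_UNIV) simp
  have mem: "side (f ` e) (f p) \<in> side (f ` e) ` ?T" "side (f ` e) (f q) \<in> side (f ` e) ` ?T" using uv x y by auto
  have "\<not> (r \<le> 0 \<and> 0 \<le> s)" if "r \<in> side (f ` e) ` ?T" "s \<in> side (f ` e) ` ?T" for r s
    using connectedD_interval[OF con that] zero by blast
  from this[OF mem] this[OF mem(2,1)] show ?thesis by (auto simp: zero_less_mult_iff not_le)
qed

lemma rearranges_side:
  assumes r: "rearranges f D R" and e: "is_arc e" and p: "p \<in> circle" and q: "q \<in> circle"
  shows "side (f ` e) (f p) * side (f ` e) (f q) > 0 \<longleftrightarrow> side e p * side e q > 0"
proof
  have f: "f \<in> Bij circle" using r by (simp add: rearranges_def)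
  show "side e p * side e q > 0 \<Longrightarrow> side (f ` e) (f p) * side (f ` e) (f q) > 0"
    using continuous_side_image[OF f rearranges_continuous[OF r] e p q] .
  assume "side (f ` e) (f p) * side (f ` e) (f q) > 0"
  from continuous_side_image[OF circle_inv_Bij[OF f] rearranges_continuous[OF rearranges_inv[OF r]]
      is_arc_image[OF f e] Bij_in[OF f p] Bij_in[OF f q] this]
  show "side e p * side e q > 0"
    using circle_inv_left[OF f] p q circle_inv_image[OF f arc_subset_circle[OF e]] by simp
qed

text \<open>The map \<open>f\<close> does not act on the disk; the region of \<open>y\<close> takes the place of the image of the
region of \<open>x\<close>, because it has the corresponding sides and the corresponding trace on the circle.\<close>

lemma rearranges_region:
  assumes r: "rearranges f D R" and L: "L \<subseteq> lamination" and x: "x \<in> open_cells L"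
  obtains y where "y \<in> open_cells ((`) f ` L)"
    "\<And>e p. e \<in> L \<Longrightarrow> p \<in> circle \<Longrightarrow> side (f ` e) y * side (f ` e) (f p) > 0 \<longleftrightarrow> side e x * side e p > 0"
    "closure (region ((`) f ` L) y) \<inter> circle = f ` (closure (region L x) \<inter> circle)"
proof -
  have f: "f \<in> Bij circle" using r by (simp add: rearranges_def)
  have arcs: "is_arc e" if "e \<in> L" for e using that L lamination_is_arc by blast
  obtain P where P: "P \<subseteq> circle \<inter> closure (region L x)" "card P = 3" using region_three_points[OF L x] .
  obtain y where y: "y \<in> open_cells ((`) f ` L)"
    "\<And>e p. e \<in> L \<Longrightarrow> p \<in> circle \<Longrightarrow> side e x * side e p > 0 \<longleftrightarrow> side (f ` e) y * side (f ` e) (f p) > 0"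
  proof (rule region_transport[OF arcs _ Bij_inj[OF f] _ _ x P])
    show "f \<in> circle \<rightarrow> circle" using Bij_in[OF f] by blast
  qed (use rearranges_side[OF r arcs] in auto)
  have arcs': "is_arc e" if "e \<in> (`) f ` L" for e using that is_arc_image[OF f] arcs by blast
  have iff: "f p \<in> closure (region ((`) f ` L) y) \<longleftrightarrow> p \<in> closure (region L x)" if p: "p \<in> circle" for p
  proof -
    have fp: "f p \<in> circle" using Bij_in[OF f p] .
    have "side (f ` e) y * side (f ` e) (f p) \<ge> 0 \<longleftrightarrow> side e x * side e p \<ge> 0" if e: "e \<in> L" for e
    proof -
      have "side e x \<noteq> 0" using open_cells_side[of L x] arcs x e by blast
      moreover have "side (f ` e) y \<noteq> 0" using open_cells_side[of "(`) f ` L" y] arcs' y(1) e by blast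
      moreover have "side e p = 0 \<longleftrightarrow> side (f ` e) (f p) = 0"
        using side_circle_zero[OF arcs[OF e] p] side_circle_zero[OF is_arc_image[OF f arcs[OF e]] fp]
          Bij_inj[OF f] arc_subset_circle[OF arcs[OF e]] p by (metis inj_on_image_mem_iff)
      ultimately show ?thesis using y(2)[OF e p] by (simp add: order_le_less)
    qed
    moreover have "norm p \<le> 1" "norm (f p) \<le> 1" using p fp by auto
    ultimately show ?thesis using closure_region[of L x] closure_region[of "(`) f ` L" y] arcs arcs' x y(1) by auto
  qed
  have "closure (region ((`) f ` L) y) \<inter> circle = f ` (closure (region L x) \<inter> circle)"
  proof (intro equalityI subsetI)
    fix z assume z: "z \<in> closure (region ((`) f ` L) y) \<inter> circle"
    then obtain p where p: "p \<in> circle" "z = f p" using Bij_image[OF f] by blast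
    thus "z \<in> f ` (closure (region L x) \<inter> circle)" using iff[OF p(1)] z by blast
  next
    fix z assume "z \<in> f ` (closure (region L x) \<inter> circle)"
    then obtain p where p: "p \<in> circle" "p \<in> closure (region L x)" "z = f p" by blast
    thus "z \<in> closure (region ((`) f ` L) y) \<inter> circle" using iff[OF p(1)] Bij_in[OF f p(1)] by blast
  qed
  thus ?thesis using that[of y] y by blast
qed

section \<open>Isomorphisms of 2-complexes\<close>

lemma geodesic_not_in_circle: assumes "is_arc e" shows "\<not> geodesic e \<subseteq> circle"
proof -
  obtain p q where pq: "p \<in> circle" "q \<in> circle" "p \<noteq> q" "e = {p, q}" using assms is_arc_def by auto
  define w where "w = of_real (1 - 1/2) * p + of_real (1/2) * q"
  have w: "norm w < 1" using midpoint_in_disk[OF pq(1-3)] by (simp add: w_def field_simps)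
  have "chord e p = 0" "chord e q = 0"
    using side_circle_zero[OF assms pq(1)] side_circle_zero[OF assms pq(2)] pq(4) side_chord[of e p] side_chord[of e q]
      klein_circle[OF pq(1)] klein_circle[OF pq(2)] side_factor_pos[of p] side_factor_pos[of q] by auto
  hence "chord e w = 0" unfolding w_def chord_convex by simp
  hence "unklein w \<in> geodesic e"
    using side_chord[of e "unklein w"] klein_unklein[of w] w norm_unklein_le[of w] by (simp add: geodesic_side[OF assms])
  moreover have "unklein w \<notin> circle" using norm_unklein_less[OF w] by simp
  ultimately show ?thesis by blast
qed

lemma segment_circle: "segment a b \<subseteq> circle"
  unfolding segment_def using point_in_circle by blast

lemma region_closure_not_in_circle:
  assumes "D \<subseteq> lamination" "x \<in> open_cells D" shows "\<not> closure (region D x) \<subseteq> circle"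
proof -
  have "x \<in> closure (region D x)"
    using region_self[OF _ assms(2)] closure_subset assms(1) lamination_is_arc by blast
  moreover have "x \<notin> circle" using assms(2) by (auto simp: open_cells_def)
  ultimately show ?thesis by blast
qed

lemma region_trace_not_in_arc:
  assumes D: "D \<subseteq> lamination" "x \<in> open_cells D" and e: "is_arc e"
  shows "\<not> closure (region D x) \<inter> circle \<subseteq> e"
proof
  assume a: "closure (region D x) \<inter> circle \<subseteq> e"
  obtain P where P: "P \<subseteq> circle \<inter> closure (region D x)" "card P = 3" using region_three_points[OF D] .
  obtain p q where "e = {p, q}" using e is_arc_def by auto
  moreover have "P \<subseteq> e" using a P by blast
  ultimately have "card P \<le> card {p, q}" by (intro card_mono) auto
  also have "card {p, q} \<le> 2" by (simp add: card_insert_if)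
  finally show False using P by simp
qed

text \<open>An arc that separated the two regions would contain the trace of the first one, which has at least
three points.\<close>

lemma region_trace_subset:
  assumes D: "D \<subseteq> lamination" and x: "x \<in> open_cells D" and y: "y \<in> open_cells D"
    and sub: "closure (region D x) \<inter> circle \<subseteq> closure (region D y)"
  shows "region D x = region D y"
proof -
  have arcs: "is_arc e" if "e \<in> D" for e using that D lamination_is_arc by blast
  have "side e x * side e y > 0" if e: "e \<in> D" for e
  proof (rule ccontr)
    assume n: "\<not> side e x * side e y > 0"
    have nz: "side e x \<noteq> 0" "side e y \<noteq> 0" using open_cells_side[of D] arcs x y e by blast+
    have "p \<in> e" if p: "p \<in> closure (region D x)" "p \<in> circle" for p
    proof -
      have "p \<in> closure (region D y)" using p sub by blast
      hence "side e x * side e p \<ge> 0" "side e y * side e p \<ge> 0"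
        using p(1) closure_region[of D x] closure_region[of D y] arcs x y e by auto
      hence "side e p = 0" using n nz by (auto simp: zero_less_mult_iff zero_le_mult_iff)
      thus ?thesis using side_circle_zero[OF arcs[OF e] p(2)] by simp
    qed
    thus False using region_trace_not_in_arc[OF D x arcs[OF e]] by blast
  qed
  hence "y \<in> region D x" using y by (auto simp: region_def open_cells_def)
  thus ?thesis using region_eq by metis
qed

lemma face_cells_eq:
  assumes "D \<subseteq> lamination" shows "face_cells D = {closure (region D x) | x. x \<in> open_cells D}"
proof -
  have "is_arc e" if "e \<in> D" for e using that assms lamination_is_arc by blast
  from complementary_regions_eq[OF this] show ?thesis unfolding face_cells_def by auto
qed

text \<open>Inclusion between arcs and faces can be tested on the circle.  The disjointness of the arcs is used
when both cells are arcs.\<close>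

lemma inner_cell_trace:
  assumes D: "D \<subseteq> lamination" and s: "s \<in> arc_cells D \<union> face_cells D" and t: "t \<in> arc_cells D \<union> face_cells D"
    and sub: "s \<inter> circle \<subseteq> t \<inter> circle"
  shows "s \<subseteq> t"
proof -
  have arcs: "is_arc e" if "e \<in> D" for e using that D lamination_is_arc by blast
  from s consider e where "e \<in> D" "s = geodesic e" | x where "x \<in> open_cells D" "s = closure (region D x)"
    unfolding face_cells_eq[OF D] arc_cells_def by blast
  thus ?thesis
  proof cases
    case 1
    have se: "s \<inter> circle = e" using geodesic_circle[OF arcs[OF 1(1)]] 1(2) by simp
    from t consider e' where "e' \<in> D" "t = geodesic e'" | x where "x \<in> open_cells D" "t = closure (region D x)"
      unfolding face_cells_eq[OF D] arc_cells_def by blast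
    thus ?thesis
    proof cases
      case (1 e')
      have "t \<inter> circle = e'" using geodesic_circle[OF arcs[OF 1(1)]] 1(2) by simp
      hence "e \<subseteq> e'" using se sub by simp
      moreover have "e \<noteq> {}" using arcs[OF \<open>e \<in> D\<close>] by (auto simp: is_arc_def)
      ultimately have "e = e'" using lamination_disjoint D \<open>e \<in> D\<close> 1 by blast
      thus ?thesis using 1 \<open>s = geodesic e\<close> by simp
    next
      case (2 x)
      have "e \<subseteq> closure (region D x)" using sub se 2 by blast
      thus ?thesis using geodesic_closure_region[OF arcs 2(1) arcs[OF \<open>e \<in> D\<close>]] 2 \<open>s = geodesic e\<close> by simp
    qed
  next
    case (2 x)
    from t consider e' where "e' \<in> D" "t = geodesic e'" | y where "y \<in> open_cells D" "t = closure (region D y)"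
      unfolding face_cells_eq[OF D] arc_cells_def by blast
    thus ?thesis
    proof cases
      case (1 e')
      hence "t \<inter> circle = e'" using geodesic_circle[OF arcs[OF 1(1)]] by simp
      thus ?thesis using region_trace_not_in_arc[OF D 2(1) arcs[OF 1(1)]] sub 2 by simp
    next
      case (2 y)
      thus ?thesis using region_trace_subset[OF D \<open>x \<in> open_cells D\<close> 2(1)] sub \<open>s = closure (region D x)\<close> by auto
    qed
  qed
qed

lemma inner_cell_not_in_circle:
  assumes D: "D \<subseteq> lamination" and s: "s \<in> arc_cells D \<union> face_cells D" shows "\<not> s \<subseteq> circle"
proof -
  from s consider e where "e \<in> D" "s = geodesic e" | x where "x \<in> open_cells D" "s = closure (region D x)"
    unfolding face_cells_eq[OF D] arc_cells_def by blast
  thus ?thesis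
  proof cases
    case (1 e) thus ?thesis using geodesic_not_in_circle lamination_is_arc D by blast
  next
    case (2 x) thus ?thesis using region_closure_not_in_circle[OF D] by blast
  qed
qed

lemma outer_cell_in_circle:
  assumes D: "arc_diagram D" and s: "s \<in> vertex_cells D \<union> interval_cells D" shows "s \<subseteq> circle"
proof -
  from s consider v where "v \<in> \<Union>D" "s = {v}" | a b where "s = segment a b"
    unfolding vertex_cells_def interval_cells_def by blast
  thus ?thesis
  proof cases
    case (1 v) thus ?thesis using diagram_arc_circle[OF D] by blast
  next
    case (2 a b) thus ?thesis using segment_circle by simp
  qed
qed

text \<open>The vertices and intervals are subsets of the circle and are mapped pointwise; arcs and faces are
determined by their traces on the circle.\<close>

definition induced_cell_map ::
  "(complex \<Rightarrow> complex) \<Rightarrow> complex set set \<Rightarrow> complex set \<Rightarrow> complex set" where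
  "induced_cell_map f R s = (if s \<subseteq> circle then f ` s
     else (THE t. t \<in> arc_cells R \<union> face_cells R \<and> t \<inter> circle = f ` (s \<inter> circle)))"

lemma induced_cell_map_inner:
  assumes R: "arc_diagram R" and s: "\<not> s \<subseteq> circle"
    and t: "t \<in> arc_cells R \<union> face_cells R" "t \<inter> circle = f ` (s \<inter> circle)"
  shows "induced_cell_map f R s = t"
proof -
  have "(THE t. t \<in> arc_cells R \<union> face_cells R \<and> t \<inter> circle = f ` (s \<inter> circle)) = t"
  proof (rule the_equality)
    fix u assume u: "u \<in> arc_cells R \<union> face_cells R \<and> u \<inter> circle = f ` (s \<inter> circle)"
    have eq: "u \<inter> circle = t \<inter> circle" using u t by (simp only:)
    show "u = t"
    proof (rule equalityI)
      show "u \<subseteq> t" by (rule inner_cell_trace[OF diagram_subset_lamination[OF R]]) (use u t eq in blast)+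
      show "t \<subseteq> u" by (rule inner_cell_trace[OF diagram_subset_lamination[OF R]]) (use u t eq in blast)+
    qed
  qed (use t in blast)
  thus ?thesis unfolding induced_cell_map_def using s by simp
qed

lemma induced_cell_map_arc:
  assumes r: "rearranges f D R" and s: "s \<in> arc_cells D"
  shows "induced_cell_map f R s \<in> arc_cells R \<and> induced_cell_map f R s \<inter> circle = f ` (s \<inter> circle)"
proof -
  have f: "f \<in> Bij circle" "arc_diagram D" "arc_diagram R" "(`) f ` D = R" using r by (auto simp: rearranges_def)
  obtain e where e: "e \<in> D" "s = geodesic e" using s by (auto simp: arc_cells_def)
  have arc: "is_arc e" using e diagram_subset_lamination[OF f(2)] lamination_is_arc by blast
  have fe: "f ` e \<in> R" using e f(4) by blast
  have 1: "geodesic (f ` e) \<in> arc_cells R" using fe by (auto simp: arc_cells_def)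
  have 2: "geodesic (f ` e) \<inter> circle = f ` (s \<inter> circle)"
    unfolding e(2) geodesic_circle[OF arc] geodesic_circle[OF is_arc_image[OF f(1) arc]] ..
  have "\<not> s \<subseteq> circle" using geodesic_not_in_circle[OF arc] e(2) by simp
  from induced_cell_map_inner[OF f(3) this _ 2] show ?thesis using 1 2 by simp
qed

lemma induced_cell_map_face:
  assumes r: "rearranges f D R" and s: "s \<in> face_cells D"
  shows "induced_cell_map f R s \<in> face_cells R \<and> induced_cell_map f R s \<inter> circle = f ` (s \<inter> circle)"
proof -
  have f: "f \<in> Bij circle" "arc_diagram D" "arc_diagram R" "(`) f ` D = R" using r by (auto simp: rearranges_def)
  note DL = diagram_subset_lamination[OF f(2)] and RL = diagram_subset_lamination[OF f(3)]
  obtain x where x: "x \<in> open_cells D" "s = closure (region D x)" using s face_cells_eq[OF DL] by blast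
  obtain y where y: "y \<in> open_cells R" "closure (region R y) \<inter> circle = f ` (closure (region D x) \<inter> circle)"
    using rearranges_region[OF r DL x(1)] unfolding f(4) by metis
  have 1: "closure (region R y) \<in> face_cells R" using y(1) face_cells_eq[OF RL] by blast
  have "\<not> s \<subseteq> circle" using region_closure_not_in_circle[OF DL x(1)] x(2) by simp
  from induced_cell_map_inner[OF f(3) this _ y(2)[folded x(2)]] show ?thesis using 1 y(2) x(2) by simp
qed

lemma induced_cell_map_outer: "s \<subseteq> circle \<Longrightarrow> induced_cell_map f R s = f ` s"
  by (simp add: induced_cell_map_def)

lemma image_circle_subset_iff:
  assumes "f \<in> Bij circle" "s \<subseteq> circle" "t \<subseteq> circle" shows "f ` s \<subseteq> f ` t \<longleftrightarrow> s \<subseteq> t"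
  using inj_on_image_subset_iff[OF Bij_inj[OF assms(1)] assms(2,3)] .

lemma image_circle_inv:
  assumes "f \<in> Bij circle" "s \<subseteq> circle" shows "f ` (circle_inv f ` s) = s"
  using circle_inv_image[OF circle_inv_Bij[OF assms(1)] assms(2)] circle_inv_inv[OF assms(1)] by simp

lemma rearranges_interval_segment:
  assumes r: "rearranges f D R" and ab: "circle_interval D a b"
  obtains c d where "circle_interval R c d" "maps_linearly f a b c d" "f ` segment a b = segment c d"
  using assms maps_linearly_image circle_interval_less unfolding rearranges_def by meson

text \<open>Both incidence and inverse are controlled by traces: the cell map of the inverse bijection is the
inverse cell map.\<close>

lemma complex_iso_induced:
  assumes r: "rearranges f D R" shows "complex_iso D R (induced_cell_map f R)"
proof -
  let ?\<phi> = "induced_cell_map f R" and ?g = "circle_inv f"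
  have f: "f \<in> Bij circle" "arc_diagram D" "arc_diagram R" "(`) f ` D = R" using r by (auto simp: rearranges_def)
  note DL = diagram_subset_lamination[OF f(2)] and RL = diagram_subset_lamination[OF f(3)]
  note r' = rearranges_inv[OF r]
  have UR: "\<Union>R = f ` \<Union>D" using rearranges_Union[OF r] .
  have DC: "\<Union>D \<subseteq> circle" using diagram_arc_circle[OF f(2)] by blast
  have sub: "f ` (s \<inter> circle) \<subseteq> f ` (t \<inter> circle) \<longleftrightarrow> s \<inter> circle \<subseteq> t \<inter> circle" for s t
    by (rule image_circle_subset_iff[OF f(1)]) blast+
  have inner: "?\<phi> s \<in> arc_cells R \<union> face_cells R \<and> ?\<phi> s \<inter> circle = f ` (s \<inter> circle)"
    if "s \<in> arc_cells D \<union> face_cells D" for s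
    using that induced_cell_map_arc[OF r] induced_cell_map_face[OF r] by blast
  have inner_iff: "?\<phi> s \<subseteq> ?\<phi> t \<longleftrightarrow> s \<subseteq> t"
    if s: "s \<in> arc_cells D \<union> face_cells D" and t: "t \<in> arc_cells D \<union> face_cells D" for s t
  proof -
    have "s \<subseteq> t \<longleftrightarrow> s \<inter> circle \<subseteq> t \<inter> circle" using inner_cell_trace[OF DL s t] by blast
    also have "\<dots> \<longleftrightarrow> ?\<phi> s \<inter> circle \<subseteq> ?\<phi> t \<inter> circle" using sub inner[OF s] inner[OF t] by metis
    also have "\<dots> \<longleftrightarrow> ?\<phi> s \<subseteq> ?\<phi> t" using inner_cell_trace[OF RL, of "?\<phi> s" "?\<phi> t"] inner[OF s] inner[OF t] by blast
    finally show ?thesis by simp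
  qed
  have inj: "inj_on ?\<phi> (arc_cells D \<union> face_cells D)"
    by (intro inj_onI equalityI) (use inner_iff in blast)+
  have inverse: "?\<phi> (induced_cell_map ?g D t) = t" if t: "t \<in> arc_cells R \<union> face_cells R" for t
  proof -
    let ?s = "induced_cell_map ?g D t"
    have s: "?s \<in> arc_cells D \<union> face_cells D" "?s \<inter> circle = ?g ` (t \<inter> circle)"
      using t induced_cell_map_arc[OF r'] induced_cell_map_face[OF r'] by blast+
    have "f ` (?s \<inter> circle) = t \<inter> circle" unfolding s(2) by (rule image_circle_inv[OF f(1)]) blast
    thus ?thesis using induced_cell_map_inner[OF f(3) inner_cell_not_in_circle[OF DL s(1)] t] by simp
  qed
  have arcs: "bij_betw ?\<phi> (arc_cells D) (arc_cells R)"
  proof (rule bij_betwI')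
    show "?\<phi> x = ?\<phi> y \<longleftrightarrow> x = y" if "x \<in> arc_cells D" "y \<in> arc_cells D" for x y
      using inj that by (auto dest: inj_onD)
    show "\<exists>x\<in>arc_cells D. t = ?\<phi> x" if t: "t \<in> arc_cells R" for t
      by (rule bexI[of _ "induced_cell_map ?g D t"]) (use t inverse induced_cell_map_arc[OF r'] in auto)
  qed (use induced_cell_map_arc[OF r] in blast)
  have faces: "bij_betw ?\<phi> (face_cells D) (face_cells R)"
  proof (rule bij_betwI')
    show "?\<phi> x = ?\<phi> y \<longleftrightarrow> x = y" if "x \<in> face_cells D" "y \<in> face_cells D" for x y
      using inj that by (auto dest: inj_onD)
    show "\<exists>x\<in>face_cells D. t = ?\<phi> x" if t: "t \<in> face_cells R" for t
      by (rule bexI[of _ "induced_cell_map ?g D t"]) (use t inverse induced_cell_map_face[OF r'] in auto)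
  qed (use induced_cell_map_face[OF r] in blast)
  have outer: "?\<phi> s = f ` s \<and> s \<subseteq> circle \<and> f ` s \<subseteq> circle" if "s \<in> vertex_cells D \<union> interval_cells D" for s
    using outer_cell_in_circle[OF f(2) that] induced_cell_map_outer Bij_image[OF f(1)] by blast
  have outer_inj: "?\<phi> s = ?\<phi> t \<longleftrightarrow> s = t"
    if s: "s \<in> vertex_cells D \<union> interval_cells D" and t: "t \<in> vertex_cells D \<union> interval_cells D" for s t
    using outer[OF s] outer[OF t] inj_on_image_eq_iff[OF Bij_inj[OF f(1)], of s t] by simp
  have vertices: "bij_betw ?\<phi> (vertex_cells D) (vertex_cells R)"
  proof (rule bij_betwI')
    show "?\<phi> x = ?\<phi> y \<longleftrightarrow> x = y" if "x \<in> vertex_cells D" "y \<in> vertex_cells D" for x y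
      using outer_inj that by blast
    show "?\<phi> x \<in> vertex_cells R" if x: "x \<in> vertex_cells D" for x
    proof -
      obtain v where v: "v \<in> \<Union>D" "x = {v}" using x unfolding vertex_cells_def by blast
      have "?\<phi> x = {f v}" using outer[of x] x v by simp
      moreover have "f v \<in> \<Union>R" using UR v by blast
      ultimately show ?thesis unfolding vertex_cells_def by blast
    qed
    show "\<exists>x\<in>vertex_cells D. t = ?\<phi> x" if t: "t \<in> vertex_cells R" for t
    proof -
      obtain v where v: "v \<in> \<Union>D" "t = {f v}" using t UR unfolding vertex_cells_def by blast
      hence x: "{v} \<in> vertex_cells D" unfolding vertex_cells_def by blast
      hence "?\<phi> {v} = t" using outer[of "{v}"] v by simp
      thus ?thesis using x by blast
    qed
  qed
  have intervals: "bij_betw ?\<phi> (interval_cells D) (interval_cells R)"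
  proof (rule bij_betwI')
    show "?\<phi> x = ?\<phi> y \<longleftrightarrow> x = y" if "x \<in> interval_cells D" "y \<in> interval_cells D" for x y
      using outer_inj that by blast
    show "?\<phi> x \<in> interval_cells R" if x: "x \<in> interval_cells D" for x
    proof -
      obtain a b where ab: "circle_interval D a b" "x = segment a b" using x unfolding interval_cells_def by blast
      then obtain c d where "circle_interval R c d" "f ` segment a b = segment c d" using rearranges_interval_segment[OF r] by metis
      thus ?thesis using outer[of x] x ab unfolding interval_cells_def by auto
    qed
    show "\<exists>x\<in>interval_cells D. t = ?\<phi> x" if t: "t \<in> interval_cells R" for t
    proof -
      obtain c d where cd: "circle_interval R c d" "t = segment c d" using t unfolding interval_cells_def by blast
      obtain a b where ab: "circle_interval D a b" "?g ` segment c d = segment a b" using rearranges_interval_segment[OF r' cd(1)] by metis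
      have "f ` segment a b = t" using image_circle_inv[OF f(1) segment_circle[of c d]] ab(2) cd(2) by simp
      moreover have s: "segment a b \<in> interval_cells D" using ab(1) unfolding interval_cells_def by blast
      ultimately show ?thesis using outer[of "segment a b"] by (intro bexI[OF _ s]) simp
    qed
  qed
  have "s \<subseteq> t \<longleftrightarrow> ?\<phi> s \<subseteq> ?\<phi> t" if s: "s \<in> cells D" and t: "t \<in> cells D" for s t
  proof -
    have tr: "?\<phi> u \<inter> circle = f ` (u \<inter> circle)" if u: "u \<in> cells D" for u
    proof (cases "u \<in> arc_cells D \<union> face_cells D")
      case True thus ?thesis using inner by blast
    next
      case False
      hence "u \<in> vertex_cells D \<union> interval_cells D" using u by (auto simp: cells_def)
      from outer[OF this] show ?thesis by (metis inf.absorb1)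
    qed
    show ?thesis
    proof (cases "s \<in> arc_cells D \<union> face_cells D")
      case True
      show ?thesis
      proof (cases "t \<in> arc_cells D \<union> face_cells D")
        case True thus ?thesis using inner_iff \<open>s \<in> arc_cells D \<union> face_cells D\<close> by blast
      next
        case False
        hence "t \<in> vertex_cells D \<union> interval_cells D" using t by (auto simp: cells_def)
        moreover have "\<not> s \<subseteq> circle" using inner_cell_not_in_circle[OF DL True] .
        moreover have "\<not> ?\<phi> s \<subseteq> circle" using inner_cell_not_in_circle[OF RL] inner[OF True] by blast
        ultimately show ?thesis using outer[of t] by (metis order_trans)
      qed
    next
      case False
      hence so: "s \<in> vertex_cells D \<union> interval_cells D" using s by (auto simp: cells_def)
      have "s \<subseteq> t \<longleftrightarrow> s \<subseteq> t \<inter> circle" using outer[OF so] by blast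
      also have "\<dots> \<longleftrightarrow> f ` s \<subseteq> f ` (t \<inter> circle)"
        by (rule image_circle_subset_iff[OF f(1), symmetric]) (use outer[OF so] in blast)+
      also have "\<dots> \<longleftrightarrow> ?\<phi> s \<subseteq> ?\<phi> t \<inter> circle" using tr[OF t] outer[OF so] by metis
      also have "\<dots> \<longleftrightarrow> ?\<phi> s \<subseteq> ?\<phi> t" using outer[OF so] by auto
      finally show ?thesis .
    qed
  qed
  thus ?thesis unfolding complex_iso_def using vertices arcs intervals faces by blast
qed

lemma rearranges_imp_dyadic:
  assumes r: "rearranges f D R" shows "f \<in> dyadic_rearrangements"
proof -
  let ?\<phi> = "induced_cell_map f R"
  have f: "f \<in> Bij circle" "arc_diagram D" "arc_diagram R" using r by (auto simp: rearranges_def)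
  have "orientation_preserving D R ?\<phi>"
    unfolding orientation_preserving_def
  proof (intro allI impI)
    fix a b assume ab: "circle_interval D a b"
    obtain c d where cd: "circle_interval R c d" "maps_linearly f a b c d" "f ` segment a b = segment c d"
      using rearranges_interval_segment[OF r ab] .
    have "?\<phi> (segment a b) = segment c d" using induced_cell_map_outer[OF segment_circle] cd(3) by simp
    moreover have "?\<phi> {point a} = {point c}" "?\<phi> {point b} = {point d}"
      using maps_linearly_ends[OF cd(2)] by (simp_all add: induced_cell_map_def)
    ultimately show "\<exists>c d. circle_interval R c d \<and> ?\<phi> (segment a b) = segment c d \<and>
              ?\<phi> {point a} = {point c} \<and> ?\<phi> {point b} = {point d}" using cd(1) by blast
  qed
  moreover have "maps_linearly f a b c d"
    if as: "circle_interval D a b \<and> circle_interval R c d \<and> ?\<phi> (segment a b) = segment c d" for a b c d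
  proof -
    obtain c' d' where cd: "circle_interval R c' d'" "maps_linearly f a b c' d'" "f ` segment a b = segment c' d'"
      using rearranges_interval_segment[OF r] as by blast
    have "segment c' d' = segment c d" using induced_cell_map_outer[OF segment_circle] cd(3) as by metis
    then obtain n :: int where "c = c' + of_int n" "d = d' + of_int n"
      using circle_interval_same_segment[OF cd(1)] as by blast
    thus ?thesis using cd(2) by simp
  qed
  ultimately show ?thesis unfolding dyadic_rearrangements_def using f complex_iso_induced[OF r] by blast
qed

text \<open>The incidences of vertices with arcs force the isomorphism to act on arcs as \<open>f\<close> acts on their
endpoints.\<close>

lemma dyadic_imp_rearranges:
  assumes "f \<in> dyadic_rearrangements" obtains D R where "rearranges f D R"
proof -
  obtain D R \<phi> where f: "f \<in> Bij circle" and D: "arc_diagram D" and R: "arc_diagram R"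
    and iso: "complex_iso D R \<phi>" and ori: "orientation_preserving D R \<phi>"
    and lin: "\<And>a b c d. circle_interval D a b \<Longrightarrow> circle_interval R c d \<Longrightarrow> \<phi> (segment a b) = segment c d
        \<Longrightarrow> maps_linearly f a b c d"
    using assms unfolding dyadic_rearrangements_def by blast
  have bij: "\<phi> ` arc_cells D = arc_cells R" using iso by (simp add: complex_iso_def bij_betw_def)
  have incl: "\<And>s t. s \<in> cells D \<Longrightarrow> t \<in> cells D \<Longrightarrow> s \<subseteq> t \<Longrightarrow> \<phi> s \<subseteq> \<phi> t"
    using iso by (simp add: complex_iso_def)
  have int: "\<exists>c d. circle_interval R c d \<and> maps_linearly f a b c d \<and> \<phi> {point a} = {point c}"
    if ab: "circle_interval D a b" for a b
  proof -
    obtain c d where cd: "circle_interval R c d" "\<phi> (segment a b) = segment c d" "\<phi> {point a} = {point c}"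
      using ori ab unfolding orientation_preserving_def by blast
    show ?thesis using lin[OF ab cd(1,2)] cd by blast
  qed
  have vert: "\<phi> {v} = {f v}" if v: "v \<in> \<Union>D" for v
  proof -
    obtain a b where ab: "circle_interval D a b" "v = point a" using diagram_vertex_start[OF D v] .
    obtain c d where cd: "maps_linearly f a b c d" "\<phi> {point a} = {point c}" using int[OF ab(1)] by blast
    have "f v = point c" using maps_linearly_ends(1)[OF cd(1)] ab(2) by simp
    thus ?thesis using cd ab(2) by simp
  qed
  have arcsD: "is_arc e" if "e \<in> D" for e using that diagram_subset_lamination[OF D] lamination_is_arc by blast
  have arcsR: "is_arc e" if "e \<in> R" for e using that diagram_subset_lamination[OF R] lamination_is_arc by blast
  have arc_image: "f ` e \<in> R \<and> \<phi> (geodesic e) = geodesic (f ` e)" if e: "e \<in> D" for e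
  proof -
    have ge: "geodesic e \<in> arc_cells D" using e by (auto simp: arc_cells_def)
    hence "\<phi> (geodesic e) \<in> arc_cells R" using bij by blast
    then obtain e' where e': "e' \<in> R" "\<phi> (geodesic e) = geodesic e'" by (auto simp: arc_cells_def)
    have "f v \<in> e'" if v: "v \<in> e" for v
    proof -
      have vD: "v \<in> \<Union>D" using v e by blast
      hence "{v} \<in> cells D" "geodesic e \<in> cells D" using ge by (auto simp: cells_def vertex_cells_def)
      moreover have "{v} \<subseteq> geodesic e" using arc_subset_geodesic[OF arcsD[OF e]] v by blast
      ultimately have "\<phi> {v} \<subseteq> geodesic e'" using incl e'(2) by metis
      hence "f v \<in> geodesic e'" using vert[OF vD] by simp
      moreover have "v \<in> circle" using arc_subset_circle[OF arcsD[OF e]] v by blast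
      ultimately show ?thesis using geodesic_circle[OF arcsR[OF e'(1)]] Bij_in[OF f] by blast
    qed
    hence "f ` e \<subseteq> e'" by blast
    moreover have "card (f ` e) = 2" "card e' = 2"
      using is_arc_image[OF f arcsD[OF e]] arcsR[OF e'(1)] by (auto simp: is_arc_def)
    ultimately have "f ` e = e'" by (metis card_subset_eq card.infinite zero_neq_numeral)
    thus ?thesis using e' by simp
  qed
  have "(`) f ` D = R"
  proof (intro equalityI subsetI)
    fix e' assume e': "e' \<in> R"
    hence "geodesic e' \<in> arc_cells R" by (auto simp: arc_cells_def)
    then obtain e where e: "e \<in> D" "\<phi> (geodesic e) = geodesic e'"
      using bij unfolding arc_cells_def by (metis (no_types, lifting) imageE)
    hence "geodesic (f ` e) = geodesic e'" using arc_image by simp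
    hence "f ` e = e'" using geodesic_circle[OF is_arc_image[OF f arcsD[OF e(1)]]] geodesic_circle[OF arcsR[OF e']] by metis
    thus "e' \<in> (`) f ` D" using e by blast
  qed (use arc_image in blast)
  hence "rearranges f D R" unfolding rearranges_def using f D R int by blast
  thus ?thesis using that by blast
qed

lemma dyadic_iff_rearranges: "f \<in> dyadic_rearrangements \<longleftrightarrow> (\<exists>D R. rearranges f D R)"
  using rearranges_imp_dyadic dyadic_imp_rearranges by blast

section \<open>The group of dyadic rearrangements\<close>

lemma maps_linearly_identity: "maps_linearly (\<lambda>z\<in>circle. z) a b a b"
  unfolding maps_linearly_def by (simp add: restrict_def)

lemma rearranges_identity:
  assumes "arc_diagram D" shows "rearranges (\<lambda>z\<in>circle. z) D D"
proof -
  have "(\<lambda>z\<in>circle. z) ` e = e" if "e \<in> D" for e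
    using diagram_arc_circle[OF assms that] by (force simp: restrict_def)
  hence "(`) (\<lambda>z\<in>circle. z) ` D = D" by simp
  moreover have "(\<lambda>z\<in>circle. z) \<in> Bij circle" by (rule id_Bij)
  ultimately show ?thesis unfolding rearranges_def using assms maps_linearly_identity by blast
qed

lemma dyadic_subgroup: "subgroup dyadic_rearrangements (BijGroup circle)"
proof (rule group.subgroupI[OF group_BijGroup])
  show "dyadic_rearrangements \<subseteq> carrier (BijGroup circle)"
    by (auto simp: Bij_carrier dyadic_rearrangements_def)
  show "dyadic_rearrangements \<noteq> {}"
    using rearranges_imp_dyadic[OF rearranges_identity[OF arc_diagram.base]] by blast
  show "circle_inv f \<in> dyadic_rearrangements" if "f \<in> dyadic_rearrangements" for f
    using that rearranges_inv dyadic_iff_rearranges by blast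
  show "g \<otimes>\<^bsub>BijGroup circle\<^esub> f \<in> dyadic_rearrangements"
    if g: "g \<in> dyadic_rearrangements" and f: "f \<in> dyadic_rearrangements" for g f
  proof -
    obtain D R D' R' where 1: "rearranges f D R" "rearranges g D' R'" using f g dyadic_iff_rearranges by meson
    hence "g \<otimes>\<^bsub>BijGroup circle\<^esub> f = compose circle g f" by (intro BijGroup_mult) (auto simp: rearranges_def)
    thus ?thesis using rearranges_compose[OF 1] dyadic_iff_rearranges by metis
  qed
qed

lemma group_T_B: "group T_B"
  unfolding T_B_def using subgroup.subgroup_is_group[OF dyadic_subgroup group_BijGroup] .

section \<open>Piecewise linear maps of the circle\<close>

text \<open>A condition under which \<open>pl_map\<close> is a well-defined bijection.\<close>

definition circle_breaks :: "(real \<times> real) list \<Rightarrow> bool" where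
  "circle_breaks ps \<longleftrightarrow> ps \<noteq> [] \<and> successively (\<lambda>(a, c) (b, d). a < b \<and> c < d) ps \<and>
    last ps = (fst (hd ps) + 1, snd (hd ps) + 1)"

lemma breaks_cover:
  "ps \<noteq> [] \<Longrightarrow> fst (hd ps) \<le> x \<Longrightarrow> x < fst (last ps) \<Longrightarrow>
    \<exists>i. Suc i < length ps \<and> fst (ps ! i) \<le> x \<and> x < fst (ps ! Suc i)" for x :: real
proof (induction ps)
  case (Cons p ps)
  show ?case
  proof (cases "ps = []")
    case True thus ?thesis using Cons.prems by simp
  next
    case False
    show ?thesis
    proof (cases "x < fst (hd ps)")
      case True
      thus ?thesis using False Cons.prems by (intro exI[of _ 0]) (auto simp: hd_conv_nth)
    next
      case F: False
      then obtain i where "Suc i < length ps \<and> fst (ps ! i) \<le> x \<and> x < fst (ps ! Suc i)"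
        using Cons False by auto
      thus ?thesis by (intro exI[of _ "Suc i"]) auto
    qed
  qed
qed simp

lemma breaks_point:
  assumes ps: "circle_breaks ps" and z: "z \<in> circle"
  obtains a b c d x where "a < b" "c < d" "a \<le> x" "x < b" "z = point x"
    "\<And>P. successively (\<lambda>(a, c) (b, d). P a b c d) ps \<Longrightarrow> P a b c d"
proof -
  obtain x where x: "fst (hd ps) \<le> x" "x < fst (hd ps) + 1" "z = point x" using circle_point[OF z] .
  have "x < fst (last ps)" using ps x by (auto simp: circle_breaks_def)
  then obtain i where i: "Suc i < length ps" "fst (ps ! i) \<le> x" "x < fst (ps ! Suc i)"
    using breaks_cover[of ps x] x ps by (auto simp: circle_breaks_def)
  obtain a c b d where e: "ps ! i = (a, c)" "ps ! Suc i = (b, d)" by (meson surj_pair)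
  have P: "P a b c d" if "successively (\<lambda>(a, c) (b, d). P a b c d) ps" for P
    using successively_nth[OF that i(1)] e by simp
  have "a < b \<and> c < d" using P[of "\<lambda>a b c d. a < b \<and> c < d"] ps by (simp add: circle_breaks_def)
  thus ?thesis by (intro that[of a b c d x]) (use i e x P in auto)
qed

lemma breaks_increasing:
  "successively (\<lambda>(a, c) (b, d). a < b \<and> c < d) ((a0, c0) # ps) \<Longrightarrow> (a, c) \<in> set ps \<Longrightarrow> a0 < (a::real)"
  for c0 c :: real
proof (induction ps arbitrary: a0 c0)
  case (Cons q ps)
  obtain b d where q: "q = (b, d)" by (cases q)
  show ?case using Cons q by force
qed simp

text \<open>The piecewise linear function on the line, which is then transferred to the circle by choosing
representatives in a fundamental domain.\<close>

lemma pl_lift: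
  "successively (\<lambda>(a, c) (b, d). a < b \<and> c < d) ((a0, c0) # ps) \<Longrightarrow>
    \<exists>F :: real \<Rightarrow> real. (\<forall>(a, c) \<in> set ((a0, c0) # ps). F a = c) \<and>
      successively (\<lambda>(a, c) (b, d). \<forall>x. a \<le> x \<longrightarrow> x \<le> b \<longrightarrow> F x = c + (x - a) * (d - c) / (b - a)) ((a0, c0) # ps)"
proof (induction ps arbitrary: a0 c0)
  case Nil thus ?case by auto
next
  case (Cons q ps)
  obtain b d where q: "q = (b, d)" by (cases q)
  have ab: "a0 < b" "c0 < d" using Cons.prems q by auto
  have tail: "successively (\<lambda>(a, c) (b, d). a < b \<and> c < d) ((b, d) # ps)" using Cons.prems q by simp
  then obtain F where F: "\<forall>(a, c) \<in> set ((b, d) # ps). F a = c"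
    "successively (\<lambda>(a, c) (b, d). \<forall>x. a \<le> x \<longrightarrow> x \<le> b \<longrightarrow> F x = c + (x - a) * (d - c) / (b - a)) ((b, d) # ps)"
    using Cons.IH by blast
  define F' where "F' x = (if x < b then c0 + (x - a0) * (d - c0) / (b - a0) else F x)" for x
  have ge: "b \<le> a" if "(a, c) \<in> set ((b, d) # ps)" for a c
    using breaks_increasing[OF tail, of a c] that by auto
  have 1: "F' a = c" if "(a, c) \<in> set ((a0, c0) # (b, d) # ps)" for a c
  proof (cases "(a, c) \<in> set ((b, d) # ps)")
    case True
    thus ?thesis using F(1) ge[OF True] unfolding F'_def by auto
  next
    case False
    hence "a = a0" "c = c0" using that by auto
    thus ?thesis using ab by (simp add: F'_def)
  qed
  have tail': "successively (\<lambda>(a, c) (b, d). \<forall>x. a \<le> x \<longrightarrow> x \<le> b \<longrightarrow> F' x = c + (x - a) * (d - c) / (b - a)) ((b, d) # ps)"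
  proof (rule successively_mono[OF F(2)], clarify)
    fix a c a' c' x
    assume "(a, c) \<in> set ((b, d) # ps)" "a \<le> x" "x \<le> a'"
      and F: "\<forall>x. a \<le> x \<longrightarrow> x \<le> a' \<longrightarrow> F x = c + (x - a) * (c' - c) / (a' - a)"
    hence "F' x = F x" using ge by (force simp: F'_def)
    thus "F' x = c + (x - a) * (c' - c) / (a' - a)" using F \<open>a \<le> x\<close> \<open>x \<le> a'\<close> by simp
  qed
  have "F b = d" using F(1) by simp
  hence head: "F' x = c0 + (x - a0) * (d - c0) / (b - a0)" if "x \<le> b" for x
    using that ab by (auto simp: F'_def)
  show ?case
  proof (intro exI[of _ F'] conjI)
    show "\<forall>(a, c) \<in> set ((a0, c0) # q # ps). F' a = c" using 1 unfolding q by blast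
    show "successively (\<lambda>(a, c) (b, d). \<forall>x. a \<le> x \<longrightarrow> x \<le> b \<longrightarrow> F' x = c + (x - a) * (d - c) / (b - a)) ((a0, c0) # q # ps)"
      unfolding q successively.simps using head tail' by simp
  qed
qed

lemma pl_exists:
  assumes ps: "circle_breaks ps"
  shows "\<exists>f \<in> extensional circle. successively (\<lambda>(a, c) (b, d). maps_linearly f a b c d) ps"
proof -
  obtain a0 c0 ps' where e: "ps = (a0, c0) # ps'" using ps unfolding circle_breaks_def by (metis list.exhaust surj_pair)
  have inc: "successively (\<lambda>(a, c) (b, d). a < b \<and> c < d) ps" using ps by (simp add: circle_breaks_def)
  from pl_lift[OF inc[unfolded e]] obtain F :: "real \<Rightarrow> real" where F0: "\<forall>(a, c) \<in> set ps. F a = c"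
    and F2: "successively (\<lambda>(a, c) (b, d). \<forall>x. a \<le> x \<longrightarrow> x \<le> b \<longrightarrow> F x = c + (x - a) * (d - c) / (b - a)) ps"
    unfolding e[symmetric] by (elim exE conjE)
  have F1: "F a = c" if "(a, c) \<in> set ps" for a c using F0 that by auto
  note F = F1 F2
  have last: "last ps = (a0 + 1, c0 + 1)" using ps by (simp add: circle_breaks_def e)
  hence "(a0 + 1, c0 + 1) \<in> set ps" using e last_in_set[of ps] by auto
  hence F1: "F (a0 + 1) = c0 + 1" "F a0 = c0" using F(1) e by auto
  define f where "f = (\<lambda>z\<in>circle. point (F (SOME x. a0 \<le> x \<and> x < a0 + 1 \<and> z = point x)))"
  have f: "f (point x) = point (F x)" if x: "a0 \<le> x" "x \<le> a0 + 1" for x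
  proof (cases "x = a0 + 1")
    case False
    have "(SOME y. a0 \<le> y \<and> y < a0 + 1 \<and> point x = point y) = x"
    proof (rule some_equality)
      fix y assume y: "a0 \<le> y \<and> y < a0 + 1 \<and> point x = point y"
      hence "\<bar>x - y\<bar> < 1" using x False by auto
      thus "y = x" using point_inj[of x y] y by simp
    qed (use x False in auto)
    thus ?thesis unfolding f_def by simp
  next
    case True
    have "(SOME y. a0 \<le> y \<and> y < a0 + 1 \<and> point x = point y) = a0"
    proof (rule some_equality)
      fix y assume y: "a0 \<le> y \<and> y < a0 + 1 \<and> point x = point y"
      hence "\<bar>a0 - y\<bar> < 1" by auto
      thus "y = a0" using point_inj[of a0 y] True y by simp
    qed (use True in auto)
    thus ?thesis unfolding f_def using True F1 by simp
  qed
  have range: "a0 \<le> fst p \<and> fst p \<le> a0 + 1" if "p \<in> set ps" for p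
  proof -
    have "sorted_wrt (\<lambda>p q. fst p < fst q) ps"
      by (subst successively_conv_sorted_wrt[symmetric])
        (auto intro: transpI successively_mono[OF inc])
    hence "sorted_wrt (\<lambda>p q. fst p < fst q) (butlast ps @ [last ps])" using e by simp
    hence "fst p \<le> a0 + 1" using that last e unfolding sorted_wrt_append
      by (metis append_butlast_last_id fst_conv in_set_conv_decomp less_imp_le list.distinct(1) order_refl rotate1.simps(2) set_ConsD set_rotate1)
    moreover have "a0 \<le> fst p" using that breaks_increasing[of a0 c0 ps' "fst p" "snd p"] inc unfolding e by auto
    ultimately show ?thesis by simp
  qed
  have "successively (\<lambda>(a, c) (b, d). (\<forall>x. a \<le> x \<longrightarrow> x \<le> b \<longrightarrow> F x = c + (x - a) * (d - c) / (b - a)) \<and> a < b) ps"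
    using F(2) inc unfolding successively_conv_nth by (auto split: prod.splits)
  hence "successively (\<lambda>(a, c) (b, d). maps_linearly f a b c d) ps"
  proof (rule successively_mono, clarify)
    fix a c b d assume "(a, c) \<in> set ps" "(b, d) \<in> set ps" "a < b"
      and Fx: "\<forall>x. a \<le> x \<longrightarrow> x \<le> b \<longrightarrow> F x = c + (x - a) * (d - c) / (b - a)"
    hence "a0 \<le> a" "b \<le> a0 + 1" using range[of "(a, c)"] range[of "(b, d)"] by auto
    thus "maps_linearly f a b c d" using f Fx \<open>a < b\<close> by (intro maps_linearlyI) auto
  qed
  moreover have "f \<in> extensional circle" by (simp add: f_def)
  ultimately show ?thesis by blast
qed

lemma pl_unique:
  assumes ps: "circle_breaks ps" and f: "f \<in> extensional circle" and g: "g \<in> extensional circle"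
    and lf: "successively (\<lambda>(a, c) (b, d). maps_linearly f a b c d) ps"
    and lg: "successively (\<lambda>(a, c) (b, d). maps_linearly g a b c d) ps"
  shows "f = g"
proof (rule extensionalityI[OF f g])
  fix z assume "z \<in> circle"
  then obtain a b c d x where x: "a < b" "a \<le> x" "x < b" "z = point x"
    "\<And>P. successively (\<lambda>(a, c) (b, d). P a b c d) ps \<Longrightarrow> P a b c d" using breaks_point[OF ps] by metis
  show "f z = g z"
    using maps_linearlyD[OF x(5)[OF lf] x(1,2)] maps_linearlyD[OF x(5)[OF lg] x(1,2)] x by simp
qed

lemma pl_inverse:
  assumes ps: "circle_breaks ps" and z: "z \<in> circle"
    and lf: "successively (\<lambda>(a, c) (b, d). maps_linearly f a b c d) ps"
    and lg: "successively (\<lambda>(a, c) (b, d). maps_linearly g a b c d) (map prod.swap ps)"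
  shows "g (f z) = z \<and> f z \<in> circle"
proof -
  obtain a b c d x where x: "a < b" "c < d" "a \<le> x" "x < b" "z = point x"
    "\<And>P. successively (\<lambda>(a, c) (b, d). P a b c d) ps \<Longrightarrow> P a b c d" using breaks_point[OF ps z] by metis
  have lg': "successively (\<lambda>(a, c) (b, d). maps_linearly g c d a b) ps"
    using lg by (simp add: successively_map case_prod_beta)
  have "maps_linearly (compose circle g f) a b a b" by (rule maps_linearly_comp[OF x(6)[OF lf] x(6)[OF lg']])
  hence "compose circle g f (point x) = point x" using maps_linearlyD[of _ a b a b x] x by simp
  moreover have "f z \<in> circle" using maps_linearlyD[OF x(6)[OF lf] x(1,3)] x point_in_circle by simp
  ultimately show ?thesis using z x(5) by (simp add: compose_def)
qed

lemma pl_map: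
  assumes ps: "circle_breaks ps"
  shows "pl_map ps \<in> Bij circle \<and> successively (\<lambda>(a, c) (b, d). maps_linearly (pl_map ps) a b c d) ps"
proof -
  let ?lin = "\<lambda>f. successively (\<lambda>(a, c) (b, d). maps_linearly f a b c d)"
  obtain f where f: "f \<in> extensional circle" "?lin f ps" using pl_exists[OF ps] by blast
  have "pl_map ps = f"
    unfolding pl_map_def by (rule the_equality) (use f pl_unique[OF ps] in auto)
  have ps': "circle_breaks (map prod.swap ps)"
    using ps unfolding circle_breaks_def
    by (auto simp: successively_map case_prod_beta last_map hd_map conj_commute)
  obtain g where g: "g \<in> extensional circle" "?lin g (map prod.swap ps)" using pl_exists[OF ps'] by blast
  have ss: "map prod.swap (map prod.swap ps) = ps" by simp
  have gf: "g (f z) = z \<and> f z \<in> circle" if "z \<in> circle" for z using pl_inverse[OF ps that f(2) g(2)] .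
  have fg: "f (g z) = z \<and> g z \<in> circle" if "z \<in> circle" for z
    by (rule pl_inverse[OF ps' that g(2)]) (unfold ss, rule f(2))
  have "bij_betw f circle circle" by (rule bij_betwI[of _ _ _ g]) (use gf fg in blast)+
  thus ?thesis using f \<open>pl_map ps = f\<close> by (simp add: Bij_def)
qed

section \<open>The generators\<close>

text \<open>The form in which the data of the generators are used: restriction to a subinterval, with integer
shifts \<open>m\<close> in the domain and \<open>k\<close> in the range that move both into \<open>[1/3, 4/3]\<close>.\<close>

lemma maps_linearly_subinterval:
  fixes m k :: int
  assumes "maps_linearly f a b c d" "a < b" "a \<le> u + of_int m" "u < v" "v + of_int m \<le> b"
    "c' = c + (u + of_int m - a) * (d - c) / (b - a) + of_int k"
    "d' = c + (v + of_int m - a) * (d - c) / (b - a) + of_int k"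
  shows "maps_linearly f u v c' d'"
proof -
  define s t where "s = (u + of_int m - a) / (b - a)" "t = (v + of_int m - a) / (b - a)"
  have "0 \<le> s" "s \<le> t" "t \<le> 1" using assms(2-5) by (auto simp: s_t_def divide_simps)
  from maps_linearly_sub[OF assms(1) this]
  have "maps_linearly f (a + s * (b - a)) (a + t * (b - a)) (c + s * (d - c)) (c + t * (d - c))" .
  moreover have "a + s * (b - a) = u + of_int m" "a + t * (b - a) = v + of_int m" using assms(2) by (simp_all add: s_t_def)
  moreover have "c + s * (d - c) + of_int k = c'" "c + t * (d - c) + of_int k = d'" using assms(6,7) by (simp_all add: s_t_def)
  ultimately show ?thesis using maps_linearly_shift(1)[of f u m v] maps_linearly_shift(2)[of f u v] by metis
qed

lemma \<alpha>_lin: "\<alpha>\<^sub>B \<in> Bij circle" "maps_linearly \<alpha>\<^sub>B (-1/3) (1/3) (-1/6) (1/6)" "maps_linearly \<alpha>\<^sub>B (1/3) (2/3) (1/6) (5/6)"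
  using pl_map[of "[(-1/3, -1/6), (1/3, 1/6), (2/3, 5/6)]"] unfolding \<alpha>\<^sub>B_def by (simp_all add: circle_breaks_def)

lemma \<beta>_lin: "\<beta>\<^sub>B \<in> Bij circle" "maps_linearly \<beta>\<^sub>B (-1/6) (1/6) (-1/6) (1/6)" "maps_linearly \<beta>\<^sub>B (1/6) (2/3) (1/6) (7/24)"
    "maps_linearly \<beta>\<^sub>B (2/3) (17/24) (7/24) (1/3)" "maps_linearly \<beta>\<^sub>B (17/24) (5/6) (1/3) (5/6)"
  using pl_map[of "[(-1/6, -1/6), (1/6, 1/6), (2/3, 7/24), (17/24, 1/3), (5/6, 5/6)]"]
  unfolding \<beta>\<^sub>B_def by (simp_all add: circle_breaks_def)

lemma \<gamma>_lin: "\<gamma>\<^sub>B \<in> Bij circle" "maps_linearly \<gamma>\<^sub>B (-2/3) (1/6) (-2/3) (1/6)" "maps_linearly \<gamma>\<^sub>B (1/6) (7/24) (1/6) (19/96)"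
    "maps_linearly \<gamma>\<^sub>B (7/24) (29/96) (19/96) (5/24)" "maps_linearly \<gamma>\<^sub>B (29/96) (1/3) (5/24) (1/3)"
  using pl_map[of "[(-2/3, -2/3), (1/6, 1/6), (7/24, 19/96), (29/96, 5/24), (1/3, 1/3)]"]
  unfolding \<gamma>\<^sub>B_def by (simp_all add: circle_breaks_def)

lemma \<delta>_Bij: "\<delta>\<^sub>B \<in> Bij circle" and \<delta>_point: "\<delta>\<^sub>B (point x) = point (x + 1/2)"
proof -
  have d: "\<delta>\<^sub>B \<in> Bij circle" "maps_linearly \<delta>\<^sub>B 0 1 (1/2) (3/2)"
    using pl_map[of "[(0, 1/2), (1, 3/2)]"] unfolding \<delta>\<^sub>B_def by (simp_all add: circle_breaks_def)
  show "\<delta>\<^sub>B \<in> Bij circle" by (rule d(1))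
  obtain y where y: "0 \<le> y" "y < 0 + 1" "point x = point y" using circle_point[OF point_in_circle] .
  then obtain n :: int where n: "y = x + of_int n" using point_eq_iff by metis
  have "\<delta>\<^sub>B (point y) = point (y + 1/2)" using maps_linearlyD[OF d(2), of y] y by (simp add: add.commute)
  also have "y + 1/2 = (x + 1/2) + of_int n" using n by simp
  finally show "\<delta>\<^sub>B (point x) = point (x + 1/2)" using y(3) by simp
qed

lemma \<delta>_lin: "maps_linearly \<delta>\<^sub>B a b (a + 1/2) (b + 1/2)"
  unfolding maps_linearly_def \<delta>_point by (simp add: algebra_simps)

lemma rearrangesI:
  assumes "f \<in> Bij circle" "arc_diagram D" "has_intervals D xs" "arc_diagram R" "has_intervals R ys" "(`) f ` D = R"
    and "\<forall>(a, b) \<in> set xs. \<exists>(c, d) \<in> set ys. maps_linearly f a b c d"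
  shows "rearranges f D R"
proof -
  have "\<exists>c d. circle_interval R c d \<and> maps_linearly f a b c d" if ab: "circle_interval D a b" for a b
  proof -
    obtain n :: int where n: "(a + of_int n, b + of_int n) \<in> set xs" using ab assms(3) unfolding has_intervals_def by blast
    obtain c d where "(c, d) \<in> set ys" "maps_linearly f (a + of_int n) (b + of_int n) c d" using assms(7) n by blast
    thus ?thesis using has_intervals_member[OF assms(5)] by auto
  qed
  thus ?thesis unfolding rearranges_def using assms by blast
qed

abbreviation base :: "complex set set" where
  "base \<equiv> insert (primary_arc (2/3) (4/3)) {arcA}"

text \<open>The domains and ranges of the generators: \<open>\<alpha>\<close> maps \<open>left\<close> to \<open>right\<close>, \<open>\<beta>\<close> maps \<open>lower\<close> to
\<open>upper\<close>, and \<open>\<gamma>\<close> maps \<open>upper_right\<close> to \<open>upper_left\<close>.\<close>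

lemma diagram_left: "arc_diagram (insert (primary_arc (1/3) (2/3)) base)"
    "has_intervals (insert (primary_arc (1/3) (2/3)) base)
      [(1/3, 5/12), (5/12, 7/12), (7/12, 2/3), (2/3, 5/6), (5/6, 7/6), (7/6, 4/3)]"
  and diagram_right: "arc_diagram (insert (primary_arc (5/6) (7/6)) base)"
    "has_intervals (insert (primary_arc (5/6) (7/6)) base)
      [(1/3, 2/3), (2/3, 5/6), (5/6, 11/12), (11/12, 13/12), (13/12, 7/6), (7/6, 4/3)]"
  and diagram_lower: "arc_diagram (insert (primary_arc (2/3) (5/6)) base)"
    "has_intervals (insert (primary_arc (2/3) (5/6)) base)
      [(1/3, 2/3), (2/3, 17/24), (17/24, 19/24), (19/24, 5/6), (5/6, 7/6), (7/6, 4/3)]"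
  and diagram_upper: "arc_diagram (insert (primary_arc (7/6) (4/3)) base)"
    "has_intervals (insert (primary_arc (7/6) (4/3)) base)
      [(1/3, 2/3), (2/3, 5/6), (5/6, 7/6), (7/6, 29/24), (29/24, 31/24), (31/24, 4/3)]"
proof -
  note ins = has_intervals_insert[of base _ _ _ _ "1/3"]
  show "has_intervals (insert (primary_arc (1/3) (2/3)) base)
      [(1/3, 5/12), (5/12, 7/12), (7/12, 2/3), (2/3, 5/6), (5/6, 7/6), (7/6, 4/3)]"
    using ins[of "[]" "1/3" "2/3" "[(2/3, 5/6), (5/6, 7/6), (7/6, 4/3)]"] has_intervals_base by simp
  show "has_intervals (insert (primary_arc (5/6) (7/6)) base)
      [(1/3, 2/3), (2/3, 5/6), (5/6, 11/12), (11/12, 13/12), (13/12, 7/6), (7/6, 4/3)]"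
    using ins[of "[(1/3, 2/3), (2/3, 5/6)]" "5/6" "7/6" "[(7/6, 4/3)]"] has_intervals_base by simp
  show "has_intervals (insert (primary_arc (2/3) (5/6)) base)
      [(1/3, 2/3), (2/3, 17/24), (17/24, 19/24), (19/24, 5/6), (5/6, 7/6), (7/6, 4/3)]"
    using ins[of "[(1/3, 2/3)]" "2/3" "5/6" "[(5/6, 7/6), (7/6, 4/3)]"] has_intervals_base by simp
  show "has_intervals (insert (primary_arc (7/6) (4/3)) base)
      [(1/3, 2/3), (2/3, 5/6), (5/6, 7/6), (7/6, 29/24), (29/24, 31/24), (31/24, 4/3)]"
    using ins[of "[(1/3, 2/3), (2/3, 5/6), (5/6, 7/6)]" "7/6" "4/3" "[]"] has_intervals_base by simp
  have "circle_interval base a b" if "(a, b) \<in> {(1/3, 2/3), (2/3, 5/6), (5/6, 7/6), (7/6, 4/3)}" for a b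
    using has_intervals_member[OF has_intervals_base, of a b] that by (simp del: Pair_inject)
  thus "arc_diagram (insert (primary_arc (1/3) (2/3)) base)" "arc_diagram (insert (primary_arc (5/6) (7/6)) base)"
    "arc_diagram (insert (primary_arc (2/3) (5/6)) base)" "arc_diagram (insert (primary_arc (7/6) (4/3)) base)"
    using arc_diagram.step[OF base_diagram] by blast+
qed

lemma diagram_upper_right:
    "arc_diagram (insert (primary_arc (31/24) (4/3)) (insert (primary_arc (7/6) (4/3)) base))"
    "has_intervals (insert (primary_arc (31/24) (4/3)) (insert (primary_arc (7/6) (4/3)) base))
      [(1/3, 2/3), (2/3, 5/6), (5/6, 7/6), (7/6, 29/24), (29/24, 31/24), (31/24, 125/96), (125/96, 127/96), (127/96, 4/3)]"
  and diagram_upper_left: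
    "arc_diagram (insert (primary_arc (7/6) (29/24)) (insert (primary_arc (7/6) (4/3)) base))"
    "has_intervals (insert (primary_arc (7/6) (29/24)) (insert (primary_arc (7/6) (4/3)) base))
      [(1/3, 2/3), (2/3, 5/6), (5/6, 7/6), (7/6, 113/96), (113/96, 115/96), (115/96, 29/24), (29/24, 31/24), (31/24, 4/3)]"
proof -
  note ins = has_intervals_insert[of "insert (primary_arc (7/6) (4/3)) base" _ _ _ _ "1/3"]
  show "has_intervals (insert (primary_arc (31/24) (4/3)) (insert (primary_arc (7/6) (4/3)) base))
      [(1/3, 2/3), (2/3, 5/6), (5/6, 7/6), (7/6, 29/24), (29/24, 31/24), (31/24, 125/96), (125/96, 127/96), (127/96, 4/3)]"
    using ins[of "[(1/3, 2/3), (2/3, 5/6), (5/6, 7/6), (7/6, 29/24), (29/24, 31/24)]" "31/24" "4/3" "[]"] diagram_upper(2) by simp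
  show "has_intervals (insert (primary_arc (7/6) (29/24)) (insert (primary_arc (7/6) (4/3)) base))
      [(1/3, 2/3), (2/3, 5/6), (5/6, 7/6), (7/6, 113/96), (113/96, 115/96), (115/96, 29/24), (29/24, 31/24), (31/24, 4/3)]"
    using ins[of "[(1/3, 2/3), (2/3, 5/6), (5/6, 7/6)]" "7/6" "29/24" "[(29/24, 31/24), (31/24, 4/3)]"] diagram_upper(2) by simp
  have "circle_interval (insert (primary_arc (7/6) (4/3)) base) a b" if "(a, b) \<in> {(31/24, 4/3), (7/6, 29/24)}" for a b
    by (rule has_intervals_member[OF diagram_upper(2)]) (use that in auto)
  thus "arc_diagram (insert (primary_arc (31/24) (4/3)) (insert (primary_arc (7/6) (4/3)) base))"
    "arc_diagram (insert (primary_arc (7/6) (29/24)) (insert (primary_arc (7/6) (4/3)) base))"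
    using arc_diagram.step[OF diagram_upper(1)] by blast+
qed

lemma primary_arcs:
  "primary_arc (2/3) (4/3) = {point (5/6), point (7/6)}" "primary_arc (1/3) (2/3) = {point (5/12), point (7/12)}"
  "primary_arc (5/6) (7/6) = {point (11/12), point (13/12)}" "primary_arc (2/3) (5/6) = {point (17/24), point (19/24)}"
  "primary_arc (7/6) (4/3) = {point (29/24), point (31/24)}" "primary_arc (31/24) (4/3) = {point (125/96), point (127/96)}"
  "primary_arc (7/6) (29/24) = {point (113/96), point (115/96)}"
  by (simp_all add: primary_arc_def)

lemma rearranges_\<alpha>: "rearranges \<alpha>\<^sub>B (insert (primary_arc (1/3) (2/3)) base) (insert (primary_arc (5/6) (7/6)) base)"
proof (rule rearrangesI[OF \<alpha>_lin(1) diagram_left diagram_right])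
  note A = maps_linearly_subinterval[OF \<alpha>_lin(3)] and B = maps_linearly_subinterval[OF \<alpha>_lin(2)]
  have lin: "maps_linearly \<alpha>\<^sub>B (1/3) (5/12) (7/6) (4/3)" "maps_linearly \<alpha>\<^sub>B (5/12) (7/12) (1/3) (2/3)"
    "maps_linearly \<alpha>\<^sub>B (7/12) (2/3) (2/3) (5/6)" "maps_linearly \<alpha>\<^sub>B (2/3) (5/6) (5/6) (11/12)"
    "maps_linearly \<alpha>\<^sub>B (5/6) (7/6) (11/12) (13/12)" "maps_linearly \<alpha>\<^sub>B (7/6) (4/3) (13/12) (7/6)"
    by - ((rule A[of _ 0 _ _ 1]; simp), (rule A[of _ 0 _ _ 0]; simp), (rule A[of _ 0 _ _ 0]; simp),
        (rule B[of _ "-1" _ _ 1]; simp), (rule B[of _ "-1" _ _ 1]; simp), (rule B[of _ "-1" _ _ 1]; simp))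
  show "\<forall>(a, b) \<in> set [(1/3, 5/12), (5/12, 7/12), (7/12, 2/3), (2/3, 5/6), (5/6, 7/6), (7/6, 4/3)]. \<exists>(c, d) \<in> set [(1/3, 2/3), (2/3, 5/6), (5/6, 11/12), (11/12, 13/12), (13/12, 7/6), (7/6, 4/3)].
      maps_linearly \<alpha>\<^sub>B a b c d" using lin by simp
  show "(`) \<alpha>\<^sub>B ` insert (primary_arc (1/3) (2/3)) base = insert (primary_arc (5/6) (7/6)) base"
    unfolding primary_arcs image_insert maps_linearly_ends[OF lin(2)] maps_linearly_ends[OF lin(5)] maps_linearly_ends(1)[OF lin(1)] maps_linearly_ends(2)[OF lin(3)] image_empty by blast
qed

lemma rearranges_\<beta>: "rearranges \<beta>\<^sub>B (insert (primary_arc (2/3) (5/6)) base) (insert (primary_arc (7/6) (4/3)) base)"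
proof (rule rearrangesI[OF \<beta>_lin(1) diagram_lower diagram_upper])
  have lin: "maps_linearly \<beta>\<^sub>B (1/3) (2/3) (29/24) (31/24)" "maps_linearly \<beta>\<^sub>B (2/3) (17/24) (31/24) (4/3)"
    "maps_linearly \<beta>\<^sub>B (17/24) (19/24) (1/3) (2/3)" "maps_linearly \<beta>\<^sub>B (19/24) (5/6) (2/3) (5/6)"
    "maps_linearly \<beta>\<^sub>B (5/6) (7/6) (5/6) (7/6)" "maps_linearly \<beta>\<^sub>B (7/6) (4/3) (7/6) (29/24)"
    by - ((rule maps_linearly_subinterval[OF \<beta>_lin(3), of _ 0 _ _ 1]; simp),
        (rule maps_linearly_subinterval[OF \<beta>_lin(4), of _ 0 _ _ 1]; simp),
        (rule maps_linearly_subinterval[OF \<beta>_lin(5), of _ 0 _ _ 0]; simp),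
        (rule maps_linearly_subinterval[OF \<beta>_lin(5), of _ 0 _ _ 0]; simp),
        (rule maps_linearly_subinterval[OF \<beta>_lin(2), of _ "-1" _ _ 1]; simp),
        (rule maps_linearly_subinterval[OF \<beta>_lin(3), of _ "-1" _ _ 1]; simp))
  show "\<forall>(a, b) \<in> set [(1/3, 2/3), (2/3, 17/24), (17/24, 19/24), (19/24, 5/6), (5/6, 7/6), (7/6, 4/3)]. \<exists>(c, d) \<in> set [(1/3, 2/3), (2/3, 5/6), (5/6, 7/6), (7/6, 29/24), (29/24, 31/24), (31/24, 4/3)].
      maps_linearly \<beta>\<^sub>B a b c d" using lin by simp
  show "(`) \<beta>\<^sub>B ` insert (primary_arc (2/3) (5/6)) base = insert (primary_arc (7/6) (4/3)) base"
    unfolding primary_arcs image_insert maps_linearly_ends[OF lin(1)] maps_linearly_ends[OF lin(3)] maps_linearly_ends[OF lin(5)] image_empty by blast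
qed

lemma rearranges_\<gamma>:
  "rearranges \<gamma>\<^sub>B (insert (primary_arc (31/24) (4/3)) (insert (primary_arc (7/6) (4/3)) base))
    (insert (primary_arc (7/6) (29/24)) (insert (primary_arc (7/6) (4/3)) base))"
proof (rule rearrangesI[OF \<gamma>_lin(1) diagram_upper_right diagram_upper_left])
  have lin: "maps_linearly \<gamma>\<^sub>B (1/3) (2/3) (1/3) (2/3)" "maps_linearly \<gamma>\<^sub>B (2/3) (5/6) (2/3) (5/6)"
    "maps_linearly \<gamma>\<^sub>B (5/6) (7/6) (5/6) (7/6)" "maps_linearly \<gamma>\<^sub>B (7/6) (29/24) (7/6) (113/96)"
    "maps_linearly \<gamma>\<^sub>B (29/24) (31/24) (113/96) (115/96)" "maps_linearly \<gamma>\<^sub>B (31/24) (125/96) (115/96) (29/24)"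
    "maps_linearly \<gamma>\<^sub>B (125/96) (127/96) (29/24) (31/24)" "maps_linearly \<gamma>\<^sub>B (127/96) (4/3) (31/24) (4/3)"
    by - ((rule maps_linearly_subinterval[OF \<gamma>_lin(2), of _ "-1" _ _ 1]; simp),
        (rule maps_linearly_subinterval[OF \<gamma>_lin(2), of _ "-1" _ _ 1]; simp),
        (rule maps_linearly_subinterval[OF \<gamma>_lin(2), of _ "-1" _ _ 1]; simp),
        (rule maps_linearly_subinterval[OF \<gamma>_lin(3), of _ "-1" _ _ 1]; simp),
        (rule maps_linearly_subinterval[OF \<gamma>_lin(3), of _ "-1" _ _ 1]; simp),
        (rule maps_linearly_subinterval[OF \<gamma>_lin(4), of _ "-1" _ _ 1]; simp),
        (rule maps_linearly_subinterval[OF \<gamma>_lin(5), of _ "-1" _ _ 1]; simp),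
        (rule maps_linearly_subinterval[OF \<gamma>_lin(5), of _ "-1" _ _ 1]; simp))
  show "\<forall>(a, b) \<in> set [(1/3, 2/3), (2/3, 5/6), (5/6, 7/6), (7/6, 29/24), (29/24, 31/24), (31/24, 125/96), (125/96, 127/96), (127/96, 4/3)]. \<exists>(c, d) \<in> set [(1/3, 2/3), (2/3, 5/6), (5/6, 7/6), (7/6, 113/96), (113/96, 115/96), (115/96, 29/24), (29/24, 31/24), (31/24, 4/3)].
      maps_linearly \<gamma>\<^sub>B a b c d" using lin by simp
  show "(`) \<gamma>\<^sub>B ` insert (primary_arc (31/24) (4/3)) (insert (primary_arc (7/6) (4/3)) base) =
      insert (primary_arc (7/6) (29/24)) (insert (primary_arc (7/6) (4/3)) base)"
    unfolding primary_arcs image_insert maps_linearly_ends[OF lin(1)] maps_linearly_ends[OF lin(3)]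
      maps_linearly_ends[OF lin(5)] maps_linearly_ends[OF lin(7)] image_empty by blast
qed

lemma rearranges_\<delta>: "rearranges \<delta>\<^sub>B base base"
proof (rule rearrangesI[OF \<delta>_Bij base_diagram has_intervals_base base_diagram has_intervals_base])
  have lin: "maps_linearly \<delta>\<^sub>B (1/3) (2/3) (5/6) (7/6)" "maps_linearly \<delta>\<^sub>B (2/3) (5/6) (7/6) (4/3)"
    "maps_linearly \<delta>\<^sub>B (5/6) (7/6) (1/3) (2/3)" "maps_linearly \<delta>\<^sub>B (7/6) (4/3) (2/3) (5/6)"
    by - ((rule maps_linearly_subinterval[OF \<delta>_lin, of "1/3" "2/3" _ 0 _ _ 0]; simp),
        (rule maps_linearly_subinterval[OF \<delta>_lin, of "2/3" "5/6" _ 0 _ _ 0]; simp),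
        (rule maps_linearly_subinterval[OF \<delta>_lin, of "5/6" "7/6" _ 0 _ _ "-1"]; simp),
        (rule maps_linearly_subinterval[OF \<delta>_lin, of "7/6" "4/3" _ 0 _ _ "-1"]; simp))
  show "\<forall>(a, b) \<in> set [(1/3, 2/3), (2/3, 5/6), (5/6, 7/6), (7/6, 4/3)]. \<exists>(c, d) \<in> set [(1/3, 2/3), (2/3, 5/6), (5/6, 7/6), (7/6, 4/3)].
      maps_linearly \<delta>\<^sub>B a b c d" using lin by simp
  show "(`) \<delta>\<^sub>B ` base = base"
    unfolding primary_arcs image_insert maps_linearly_ends[OF lin(1)] maps_linearly_ends[OF lin(3)] image_empty by blast
qed

lemma generators_dyadic:
  "\<alpha>\<^sub>B \<in> dyadic_rearrangements" "\<beta>\<^sub>B \<in> dyadic_rearrangements"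
  "\<gamma>\<^sub>B \<in> dyadic_rearrangements" "\<delta>\<^sub>B \<in> dyadic_rearrangements"
  using rearranges_\<alpha> rearranges_\<beta> rearranges_\<gamma> rearranges_\<delta> rearranges_imp_dyadic by blast+

section \<open>Generation: rotating trees into normal form\<close>

definition fixes_outside :: "(complex \<Rightarrow> complex) \<Rightarrow> real \<Rightarrow> real \<Rightarrow> bool" where
  "fixes_outside f a b \<longleftrightarrow> (\<forall>z\<in>circle. z \<notin> point ` {a<..<b} \<longrightarrow> f z = z)"

lemma maps_linearly_eq:
  "maps_linearly f a b c d \<Longrightarrow> a = a' \<Longrightarrow> b = b' \<Longrightarrow> c = c' \<Longrightarrow> d = d' \<Longrightarrow> maps_linearly f a' b' c' d'"
  by simp

lemma maps_linearly_fixes: "maps_linearly f a b a b \<Longrightarrow> a < b \<Longrightarrow> a \<le> x \<Longrightarrow> x \<le> b \<Longrightarrow> f (point x) = point x"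
  using maps_linearlyD[of f a b a b x] by simp

lemma fixes_outside_point:
  assumes "fixes_outside f a b" "b \<le> x \<and> x \<le> a + 1 \<or> b - 1 \<le> x \<and> x \<le> a" shows "f (point x) = point x"
proof -
  have "point x \<noteq> point y" if "a < y" "y < b" for y
  proof
    assume "point x = point y"
    moreover have "\<bar>x - y\<bar> < 1" using that assms(2) by auto
    ultimately show False using point_inj[of x y] assms(2) that by auto
  qed
  thus ?thesis using assms(1) point_in_circle unfolding fixes_outside_def by force
qed

lemma fixes_outside_before: "fixes_outside f a b \<Longrightarrow> u < v \<Longrightarrow> b - 1 \<le> u \<Longrightarrow> v \<le> a \<Longrightarrow> maps_linearly f u v u v"
  and fixes_outside_after: "fixes_outside f a b \<Longrightarrow> u < v \<Longrightarrow> b \<le> u \<Longrightarrow> v \<le> a + 1 \<Longrightarrow> maps_linearly f u v u v"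
  by (intro maps_linearlyI, assumption, simp add: fixes_outside_point)+

lemma fixes_outside_mono: "fixes_outside f u v \<Longrightarrow> a \<le> u \<Longrightarrow> v \<le> b \<Longrightarrow> fixes_outside f a b"
  unfolding fixes_outside_def by force

lemma fixes_outside_compose: "fixes_outside f a b \<Longrightarrow> fixes_outside g a b \<Longrightarrow> fixes_outside (compose circle g f) a b"
  unfolding fixes_outside_def compose_def by auto

abbreviation between :: "real \<Rightarrow> real \<Rightarrow> real \<Rightarrow> real" where
  "between a b s \<equiv> a + s * (b - a)"

text \<open>The map that is linear between the leaves of two ternary trees which differ by moving a node from
the left child of the root to its right child; the breakpoints \<open>3/16\<close> and \<open>1/4\<close> go to \<open>3/4\<close> and
\<open>13/16\<close>.  (The five leaves are grouped into three intervals of linearity.)\<close>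

definition is_rotation :: "(complex \<Rightarrow> complex) \<Rightarrow> real \<Rightarrow> real \<Rightarrow> bool" where
  "is_rotation f a b \<longleftrightarrow> f \<in> Bij circle \<and> fixes_outside f a b \<and>
    maps_linearly f (between a b 0) (between a b (3/16)) (between a b 0) (between a b (3/4)) \<and>
    maps_linearly f (between a b (3/16)) (between a b (1/4)) (between a b (3/4)) (between a b (13/16)) \<and>
    maps_linearly f (between a b (1/4)) (between a b 1) (between a b (13/16)) (between a b 1)"

abbreviation conjugate :: "(complex \<Rightarrow> complex) \<Rightarrow> (complex \<Rightarrow> complex) \<Rightarrow> complex \<Rightarrow> complex" where
  "conjugate k f \<equiv> compose circle k (compose circle f (circle_inv k))"

lemma rotation_conjugate:
  assumes f: "is_rotation f a b" and k: "k \<in> Bij circle" "maps_linearly k a b c d" and "a < b" "c < d"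
  shows "is_rotation (conjugate k f) c d"
proof -
  note k' = maps_linearly_inverse[OF k]
  have lin: "maps_linearly (conjugate k f) (between c d s) (between c d t) (between c d s') (between c d t')"
    if "maps_linearly f (between a b s) (between a b t) (between a b s') (between a b t')" "0 \<le> s" "s \<le> t" "t \<le> 1" "0 \<le> s'" "s' \<le> t'" "t' \<le> 1" for s t s' t'
    using maps_linearly_comp[OF maps_linearly_comp[OF maps_linearly_sub[OF k' that(2-4)] that(1)] maps_linearly_sub[OF k(2) that(5-7)]] .
  have "conjugate k f z = z" if z: "z \<in> circle" "z \<notin> point ` {c<..<d}" for z
  proof -
    have w: "circle_inv k z \<in> circle" using Bij_in[OF circle_inv_Bij[OF k(1)] z(1)] .
    have "circle_inv k z \<notin> point ` {a<..<b}"
    proof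
      assume "circle_inv k z \<in> point ` {a<..<b}"
      then obtain x where x: "a < x" "x < b" "circle_inv k z = point x" by auto
      hence "z = k (point x)" using circle_inv_right[OF k(1) z(1)] by simp
      also have "\<dots> = point (c + (x - a) * (d - c) / (b - a))" using maps_linearlyD[OF k(2)] x assms by simp
      finally have "z = point (c + (x - a) * (d - c) / (b - a))" .
      moreover have "c + (x - a) * (d - c) / (b - a) \<in> {c<..<d}"
      proof -
        have "(x - a) * (d - c) < (d - c) * (b - a)" "0 < b - a"
          using x assms mult_strict_right_mono[of "x - a" "b - a" "d - c"] by (auto simp: mult.commute)
        hence "(x - a) * (d - c) / (b - a) < d - c" by (simp only: pos_divide_less_eq)
        moreover have "0 < (x - a) * (d - c) / (b - a)" using x assms by (intro divide_pos_pos mult_pos_pos) auto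
        ultimately show ?thesis by simp
      qed
      ultimately show False using z(2) by blast
    qed
    hence "f (circle_inv k z) = circle_inv k z" using f w unfolding is_rotation_def fixes_outside_def by blast
    thus ?thesis using z w circle_inv_right[OF k(1) z(1)] by (simp add: compose_eq del: mem_sphere)
  qed
  moreover have "conjugate k f \<in> Bij circle"
    using f k circle_inv_Bij unfolding is_rotation_def by (intro compose_Bij) auto
  moreover have "maps_linearly f (between a b 0) (between a b (3/16)) (between a b 0) (between a b (3/4))"
    "maps_linearly f (between a b (3/16)) (between a b (1/4)) (between a b (3/4)) (between a b (13/16))"
    "maps_linearly f (between a b (1/4)) (between a b 1) (between a b (13/16)) (between a b 1)"
    using f unfolding is_rotation_def by blast+
  note this[THEN lin]
  ultimately show ?thesis unfolding is_rotation_def fixes_outside_def by simp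
qed

text \<open>The involution that exchanges the two initial intervals \<open>[1/3, 2/3]\<close> and \<open>[2/3, 4/3]\<close>.\<close>

definition \<sigma> :: "complex \<Rightarrow> complex" where
  "\<sigma> = compose circle \<delta>\<^sub>B \<alpha>\<^sub>B"

lemma \<sigma>_lin: "\<sigma> \<in> Bij circle" "maps_linearly \<sigma> (1/3) (2/3) (2/3) (4/3)" "maps_linearly \<sigma> (2/3) (4/3) (1/3) (2/3)"
proof -
  show "\<sigma> \<in> Bij circle" unfolding \<sigma>_def using compose_Bij \<delta>_Bij \<alpha>_lin(1) by blast
  show "maps_linearly \<sigma> (1/3) (2/3) (2/3) (4/3)"
    using maps_linearly_comp[OF \<alpha>_lin(3) \<delta>_lin] by (simp add: \<sigma>_def)
  have "maps_linearly \<alpha>\<^sub>B (2/3) (4/3) (-1/6) (1/6)"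
    by (rule maps_linearly_subinterval[OF \<alpha>_lin(2), of _ "-1" _ _ 0]; simp)
  thus "maps_linearly \<sigma> (2/3) (4/3) (1/3) (2/3)"
    using maps_linearly_comp[OF _ \<delta>_lin] by (fastforce simp add: \<sigma>_def)
qed

lemma rotation_\<gamma>: "is_rotation (circle_inv \<gamma>\<^sub>B) (7/6) (4/3)"
proof -
  have lin: "maps_linearly \<gamma>\<^sub>B (1/3) (7/6) (1/3) (7/6)" "maps_linearly \<gamma>\<^sub>B (7/6) (31/24) (7/6) (115/96)"
    "maps_linearly \<gamma>\<^sub>B (31/24) (125/96) (115/96) (29/24)" "maps_linearly \<gamma>\<^sub>B (125/96) (4/3) (29/24) (4/3)"
    by - ((rule maps_linearly_subinterval[OF \<gamma>_lin(2), of _ "-1" _ _ 1]; simp),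
        (rule maps_linearly_subinterval[OF \<gamma>_lin(3), of _ "-1" _ _ 1]; simp),
        (rule maps_linearly_subinterval[OF \<gamma>_lin(4), of _ "-1" _ _ 1]; simp),
        (rule maps_linearly_subinterval[OF \<gamma>_lin(5), of _ "-1" _ _ 1]; simp))
  have "circle_inv \<gamma>\<^sub>B z = z" if z: "z \<in> circle" "z \<notin> point ` {7/6<..<4/3}" for z
  proof -
    obtain x where x: "1/3 \<le> x" "x < 1/3 + 1" "z = point x" using circle_point[OF z(1)] .
    hence "x \<le> 7/6" using z(2) by force
    hence "\<gamma>\<^sub>B z = z" using maps_linearly_fixes[OF lin(1), of x] x by simp
    thus ?thesis using circle_inv_left[OF \<gamma>_lin(1) z(1)] by simp
  qed
  thus ?thesis unfolding is_rotation_def fixes_outside_def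
    using circle_inv_Bij[OF \<gamma>_lin(1)] lin(2-4)[THEN maps_linearly_inverse[OF \<gamma>_lin(1)]] by simp
qed

text \<open>The map \<open>\<beta>\<close> is supported in \<open>[1/6, 5/6]\<close>, so it is conjugated by the half turn in order to act
inside the initial interval \<open>[2/3, 4/3]\<close>.\<close>

lemma rotation_\<beta>: "is_rotation (circle_inv (compose circle \<delta>\<^sub>B (compose circle \<beta>\<^sub>B \<delta>\<^sub>B))) (2/3) (4/3)"
  (is "is_rotation (circle_inv ?f) _ _")
proof -
  have B: "?f \<in> Bij circle" using compose_Bij \<delta>_Bij \<beta>_lin(1) by blast
  have conj: "maps_linearly ?f u v u' v'"
    if "maps_linearly \<beta>\<^sub>B (u + 1/2) (v + 1/2) w x" "u' = w + 1/2" "v' = x + 1/2" for u v w x u' v'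
    using maps_linearly_comp[OF maps_linearly_comp[OF \<delta>_lin that(1)] \<delta>_lin] that(2,3) by simp
  have lin: "maps_linearly ?f (1/3) (2/3) (1/3) (2/3)" "maps_linearly ?f (2/3) (7/6) (2/3) (19/24)"
    "maps_linearly ?f (7/6) (29/24) (19/24) (5/6)" "maps_linearly ?f (29/24) (4/3) (5/6) (4/3)"
    by - ((rule conj[of _ _ "-1/6" "1/6"], rule maps_linearly_subinterval[OF \<beta>_lin(2), of _ "-1" _ _ 0]; simp),
        (rule conj[of _ _ "1/6" "7/24"], rule maps_linearly_subinterval[OF \<beta>_lin(3), of _ "-1" _ _ 0]; simp),
        (rule conj[of _ _ "7/24" "1/3"], rule maps_linearly_subinterval[OF \<beta>_lin(4), of _ "-1" _ _ 0]; simp),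
        (rule conj[of _ _ "1/3" "5/6"], rule maps_linearly_subinterval[OF \<beta>_lin(5), of _ "-1" _ _ 0]; simp))
  have "circle_inv ?f z = z" if z: "z \<in> circle" "z \<notin> point ` {2/3<..<4/3}" for z
  proof -
    obtain x where x: "1/3 \<le> x" "x < 1/3 + 1" "z = point x" using circle_point[OF z(1)] .
    hence "x \<le> 2/3" using z(2) by force
    hence "?f z = z" using maps_linearly_fixes[OF lin(1), of x] x by simp
    thus ?thesis using circle_inv_left[OF B z(1)] by metis
  qed
  thus ?thesis unfolding is_rotation_def fixes_outside_def
    using circle_inv_Bij[OF B] lin(2-4)[THEN maps_linearly_inverse[OF B]] by simp
qed

text \<open>Iterated rotation to the right: if \<open>l\<close> has only leaves as left children, then \<open>attach l m r\<close> is what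
\<open>Node l m r\<close> becomes when the nodes of \<open>l\<close> on its right spine are moved, one after the other, to
the right spine of the whole tree.\<close>

fun attach :: "tree \<Rightarrow> tree \<Rightarrow> tree \<Rightarrow> tree" where
  "attach Leaf m r = Node Leaf m r"
| "attach (Node l' m' r') m r = Node l' m' (attach r' m r)"

fun comb :: "tree \<Rightarrow> tree" where
  "comb Leaf = Leaf"
| "comb (Node l m r) = attach (comb l) (comb m) (comb r)"

fun normal :: "tree \<Rightarrow> bool" where
  "normal Leaf \<longleftrightarrow> True"
| "normal (Node l m r) \<longleftrightarrow> l = Leaf \<and> normal m \<and> normal r"

lemma normal_attach: "normal l \<Longrightarrow> normal m \<Longrightarrow> normal r \<Longrightarrow> normal (attach l m r)"
  by (induction l m r rule: attach.induct) auto

lemma normal_comb: "normal (comb \<tau>)"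
  by (induction \<tau>) (auto intro: normal_attach)

abbreviation maps_leaves :: "(complex \<Rightarrow> complex) \<Rightarrow> (real \<times> real) list \<Rightarrow> (real \<times> real) list \<Rightarrow> bool" where
  "maps_leaves f \<equiv> list_all2 (\<lambda>(a, b) (c, d). maps_linearly f a b c d)"

lemma maps_leaves_linear: "maps_linearly f a b c d \<Longrightarrow> maps_leaves f (leaves \<tau> a b) (leaves \<tau> c d)"
proof (induction \<tau> arbitrary: a b c d)
  case (Node l m r)
  show ?case unfolding leaves.simps
    by (intro list_all2_appendI Node.IH maps_linearly_children[OF Node.prems])
qed simp

lemma maps_leaves_compose:
  assumes "maps_leaves f xs ys" "maps_leaves g ys zs" shows "maps_leaves (compose circle g f) xs zs"
  by (rule list_all2_trans[OF _ assms]) (auto intro: maps_linearly_comp)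

text \<open>A rearrangement maps consecutive intervals to consecutive intervals, so it matches the two lists
of intervals once it matches their starting points.\<close>

lemma chain_maps:
  assumes r: "rearranges f D R"
  shows "chain p xs p' \<Longrightarrow> chain q ys q' \<Longrightarrow> f (point p) = point q \<Longrightarrow>
    (\<And>a b. (a, b) \<in> set xs \<Longrightarrow> circle_interval D a b) \<Longrightarrow> (\<And>a b. (a, b) \<in> set ys \<Longrightarrow> circle_interval R a b) \<Longrightarrow>
    \<forall>((a, b), (c, d)) \<in> set (zip xs ys). maps_linearly f a b c d"
proof (induction p xs p' arbitrary: q ys rule: chain.induct)
  case (2 p a b xs p')
  show ?case
  proof (cases ys)
    case (Cons y ys')
    obtain c d where y: "y = (c, d)" by (cases y)
    have ab: "circle_interval D a b" and cd: "circle_interval R c d" using 2 Cons y by auto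
    have pq: "a = p" "c = q" using 2 Cons y by auto
    obtain c' d' where cd': "circle_interval R c' d'" "maps_linearly f a b c' d'" using r ab unfolding rearranges_def by blast
    have "point c' = point c" using maps_linearly_ends(1)[OF cd'(2)] 2(4) pq by simp
    then obtain n :: int where "c = c' + of_int n" "d = d' + of_int n" using circle_interval_same_start[OF cd'(1) cd] by blast
    hence lin: "maps_linearly f a b c d" using cd'(2) by simp
    have "\<forall>((a, b), (c, d)) \<in> set (zip xs ys'). maps_linearly f a b c d"
      by (rule "2.IH"[of d ys']) (use 2 Cons y maps_linearly_ends(2)[OF lin] in auto)
    thus ?thesis using lin Cons y by auto
  qed simp
qed simp

text \<open>The first leaf below the root of a normal tree is its left quarter \<open>[a, p]\<close>, and it is the first leaf
of both trees; hence \<open>p\<close> is fixed.  Then the primary arc \<open>{p, q}\<close> of \<open>[a, b]\<close> is mapped to an arc of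
the lamination that contains \<open>p\<close>, so to itself, and \<open>q\<close> is fixed as well.  Now the argument applies
to the middle and to the right child.  The remaining lists \<open>X, X'\<close> carry the rest of the circle
through the induction.\<close>

lemma normal_trees_agree:
  assumes lam: "\<And>e. e \<in> lamination \<Longrightarrow> f ` e \<in> lamination" and f: "f \<in> Bij circle"
  shows "normal N \<Longrightarrow> normal N' \<Longrightarrow> piece n t a b \<Longrightarrow> f (point a) = point a \<Longrightarrow> f (point b) = point b \<Longrightarrow>
    \<forall>((a, b), (c, d)) \<in> set (zip (leaves N a b @ X) (leaves N' a b @ X')). maps_linearly f a b c d \<Longrightarrow>
    N = N' \<and> (\<forall>((a, b), (c, d)) \<in> set (zip X X'). maps_linearly f a b c d)"
proof (induction N arbitrary: N' n t a b X X')
  case Leaf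
  show ?case
  proof (cases N')
    case (Node l m r)
    hence "maps_linearly f a b a (a + (b - a) / 4)" using Leaf by simp
    hence "point b = point (a + (b - a) / 4)" using maps_linearly_ends(2) Leaf(5) by metis
    moreover have "\<bar>b - (a + (b - a) / 4)\<bar> < 1" "b \<noteq> a + (b - a) / 4"
      using piece_bounds[OF Leaf(3)] by (auto simp: field_simps abs_if)
    ultimately show ?thesis using point_inj by blast
  qed (use Leaf in auto)
next
  case (Node l m r)
  have l: "l = Leaf" "normal m" "normal r" using Node.prems(1) by auto
  obtain p q where pq: "primary_arc a b = {point p, point q}" "p = a + (b - a) / 4" "q = b - (b - a) / 4"
    "a < p" "p < q" "q < b" "1/3 < p" "q < 4/3" using piece_primary_arc[OF Node.prems(3)] by metis
  have bnd: "1/3 \<le> a" "b \<le> 4/3" using piece_bounds[OF Node.prems(3)] by auto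
  show ?case
  proof (cases N')
    case Leaf
    hence "maps_linearly f a p a b" using Node.prems(6) l pq by simp
    hence "f (point p) = f (point b)" using maps_linearly_ends(2) Node.prems(5) by metis
    hence "point p = point b" using Bij_inj[OF f] point_in_circle by (metis inj_onD)
    moreover have "\<bar>p - b\<bar> < 1" "p \<noteq> b" using pq(4-) bnd by auto
    ultimately show ?thesis using point_inj by blast
  next
    case N': (Node l' m' r')
    have l': "l' = Leaf" "normal m'" "normal r'" using Node.prems(2) N' by auto
    have Z: "\<forall>((a, b), (c, d)) \<in> set (zip ((a, p) # leaves m p q @ leaves r q b @ X) ((a, p) # leaves m' p q @ leaves r' q b @ X')). maps_linearly f a b c d"
      using Node.prems(6) unfolding N' l l' leaves.simps pq(2,3)[symmetric] by simp
    hence "maps_linearly f a p a p" by simp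
    hence fp: "f (point p) = point p" using maps_linearly_ends(2) by blast
    have fq: "f (point q) = point q"
    proof -
      have e: "primary_arc a b \<in> lamination" using primary_arc_lamination[OF Node.prems(3)] .
      have "point p \<in> f ` primary_arc a b" "point p \<in> primary_arc a b" unfolding pq(1) using fp by auto
      hence "f ` primary_arc a b = primary_arc a b" using lamination_disjoint[OF lam[OF e] e] by blast
      hence "f (point q) \<in> {point p, point q}" unfolding pq(1) by blast
      moreover have "f (point q) \<noteq> point p"
      proof
        assume "f (point q) = point p"
        hence "f (point q) = f (point p)" using fp by simp
        hence "point q = point p" using Bij_inj[OF f] point_in_circle by (metis inj_onD)
        moreover have "\<bar>q - p\<bar> < 1" using pq(4-) bnd by auto
        ultimately show False using point_inj[of q p] pq(5) by auto
      qed
      ultimately show ?thesis by blast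
    qed
    have pm: "piece (Suc n) True p q" and pr: "piece (Suc n) False q b"
      using piece.middle[OF Node.prems(3)] piece.right[OF Node.prems(3)] pq by auto
    have "\<forall>((a, b), (c, d)) \<in> set (zip (leaves m p q @ leaves r q b @ X) (leaves m' p q @ leaves r' q b @ X')). maps_linearly f a b c d"
      using Z by simp
    from Node.IH(2)[OF l(2) l'(2) pm fp fq this] have m: "m = m'"
      and Z2: "\<forall>((a, b), (c, d)) \<in> set (zip (leaves r q b @ X) (leaves r' q b @ X')). maps_linearly f a b c d" by auto
    from Node.IH(3)[OF l(3) l'(3) pr fq Node.prems(5) Z2] show ?thesis using N' l l' m by auto
  qed
qed

lemma fixes_leaves:
  assumes "\<forall>((a, b), (c, d)) \<in> set (zip xs xs). maps_linearly f a b c d" "chain p xs q" "p \<le> x" "x < q"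
  shows "f (point x) = point x"
proof -
  obtain a b where ab: "(a, b) \<in> set xs" "a \<le> x" "x < b" using chain_cover[OF assms(2-4)] by blast
  have "((a, b), (a, b)) \<in> set (zip xs xs)" using ab(1) by (auto simp: in_set_zip in_set_conv_nth)
  hence "maps_linearly f a b a b" using assms(1) by fastforce
  from maps_linearly_fixes[OF this] ab show ?thesis by simp
qed

lemma dyadic_Bij: "f \<in> dyadic_rearrangements \<Longrightarrow> f \<in> Bij circle"
  by (simp add: dyadic_rearrangements_def)

lemma dyadic_compose:
  "g \<in> dyadic_rearrangements \<Longrightarrow> f \<in> dyadic_rearrangements \<Longrightarrow> compose circle g f \<in> dyadic_rearrangements"
  using subgroup.m_closed[OF dyadic_subgroup] BijGroup_mult dyadic_Bij by metis

lemma dyadic_inv: "f \<in> dyadic_rearrangements \<Longrightarrow> circle_inv f \<in> dyadic_rearrangements"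
  using subgroup.m_inv_closed[OF dyadic_subgroup] .

text \<open>The subgroup is arbitrary so that the result applies to the union of two cosets.\<close>

locale generator_subgroup =
  fixes K :: "(complex \<Rightarrow> complex) set"
  assumes K: "subgroup K (BijGroup circle)" and K_dyadic: "K \<subseteq> dyadic_rearrangements"
    and gens: "\<alpha>\<^sub>B \<in> K" "\<beta>\<^sub>B \<in> K" "\<gamma>\<^sub>B \<in> K" "\<delta>\<^sub>B \<in> K"
begin

lemma K_Bij: "f \<in> K \<Longrightarrow> f \<in> Bij circle"
  using subgroup.subset[OF K] by (auto simp: Bij_carrier)

lemma K_compose: "g \<in> K \<Longrightarrow> f \<in> K \<Longrightarrow> compose circle g f \<in> K"
  using subgroup.m_closed[OF K] BijGroup_mult K_Bij by metis

lemma K_inv: "f \<in> K \<Longrightarrow> circle_inv f \<in> K"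
  using subgroup.m_inv_closed[OF K] .

lemma K_identity: "(\<lambda>z\<in>circle. z) \<in> K"
  using subgroup.one_closed[OF K] by (simp add: BijGroup_one)

lemma \<sigma>_K: "\<sigma> \<in> K"
  unfolding \<sigma>_def using K_compose gens by blast

definition linked :: "real \<Rightarrow> real \<Rightarrow> real \<Rightarrow> real \<Rightarrow> bool" where
  "linked a b c d \<longleftrightarrow> (\<exists>k\<in>K. maps_linearly k a b c d)"

lemma linked_refl: "linked a b a b"
  unfolding linked_def using K_identity maps_linearly_identity by blast

lemma linked_trans: "linked a b c d \<Longrightarrow> linked c d u v \<Longrightarrow> linked a b u v"
  unfolding linked_def using K_compose maps_linearly_comp by blast

lemma linked_children:
  assumes "linked a b c d"
  shows "linked a (a + (b - a) / 4) c (c + (d - c) / 4)"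
    "linked (a + (b - a) / 4) (b - (b - a) / 4) (c + (d - c) / 4) (d - (d - c) / 4)"
    "linked (b - (b - a) / 4) b (d - (d - c) / 4) d"
  using assms maps_linearly_children unfolding linked_def by meson+

lemma linked_\<beta>: "linked (7/6) (4/3) (7/6) (29/24)" "linked (1/3) (2/3) (29/24) (31/24)"
    "linked (2/3) (17/24) (31/24) (4/3)"
proof -
  have "maps_linearly \<beta>\<^sub>B (7/6) (4/3) (7/6) (29/24)" "maps_linearly \<beta>\<^sub>B (1/3) (2/3) (29/24) (31/24)"
    "maps_linearly \<beta>\<^sub>B (2/3) (17/24) (31/24) (4/3)"
    by - ((rule maps_linearly_subinterval[OF \<beta>_lin(3), of _ "-1" _ _ 1]; simp),
      (rule maps_linearly_subinterval[OF \<beta>_lin(3), of _ 0 _ _ 1]; simp),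
      (rule maps_linearly_subinterval[OF \<beta>_lin(4), of _ 0 _ _ 1]; simp))
  thus "linked (7/6) (4/3) (7/6) (29/24)" "linked (1/3) (2/3) (29/24) (31/24)" "linked (2/3) (17/24) (31/24) (4/3)"
    unfolding linked_def using gens(2) by blast+
qed

lemma linked_\<delta>: "linked (7/6) (4/3) (2/3) (5/6)" "linked (1/3) (2/3) (5/6) (7/6)" "linked (7/6) (29/24) (2/3) (17/24)"
proof -
  have "maps_linearly \<delta>\<^sub>B (7/6) (4/3) (2/3) (5/6)" "maps_linearly \<delta>\<^sub>B (1/3) (2/3) (5/6) (7/6)"
    "maps_linearly \<delta>\<^sub>B (7/6) (29/24) (2/3) (17/24)"
    by - ((rule maps_linearly_subinterval[OF \<delta>_lin, of "7/6" "4/3" _ 0 _ _ "-1"]; simp),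
        (rule maps_linearly_subinterval[OF \<delta>_lin, of "1/3" "2/3" _ 0 _ _ 0]; simp),
        (rule maps_linearly_subinterval[OF \<delta>_lin, of "7/6" "29/24" _ 0 _ _ "-1"]; simp))
  thus "linked (7/6) (4/3) (2/3) (5/6)" "linked (1/3) (2/3) (5/6) (7/6)" "linked (7/6) (29/24) (2/3) (17/24)"
    unfolding linked_def using gens(4) by blast+
qed

lemma linked_\<sigma>: "linked (1/3) (2/3) (2/3) (4/3)" "linked (2/3) (4/3) (1/3) (2/3)"
  unfolding linked_def using \<sigma>_K \<sigma>_lin by blast+

text \<open>Transitivity on the pieces of each type.  Linear maps carry children to children, so it is enough to
treat the three children of the representatives \<open>[1/3, 2/3]\<close> and \<open>[7/6, 4/3]\<close>.\<close>

lemma piece_linked: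
  "piece n t a b \<Longrightarrow> (if t then linked (1/3) (2/3) a b else linked (7/6) (4/3) a b)"
proof (induction rule: piece.induct)
  case pieceA show ?case using linked_refl by simp
next
  case pieceB show ?case using linked_\<sigma>(1) by simp
next
  case (left n t a b)
  show ?case
  proof (cases t)
    case True
    hence "linked (1/3) (5/12) a (a + (b - a) / 4)" using linked_children(1)[of "1/3" "2/3" a b] left by simp
    moreover have "linked (2/3) (5/6) (1/3) (5/12)" using linked_children(1)[OF linked_\<sigma>(2)] by simp
    ultimately have "linked (7/6) (4/3) a (a + (b - a) / 4)" using linked_\<delta>(1) linked_trans by blast
    thus ?thesis by simp
  next
    case False
    hence "linked (7/6) (29/24) a (a + (b - a) / 4)" using linked_children(1)[of "7/6" "4/3" a b] left by simp
    hence "linked (7/6) (4/3) a (a + (b - a) / 4)" using linked_\<beta>(1) linked_trans by blast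
    thus ?thesis by simp
  qed
next
  case (middle n t a b)
  show ?case
  proof (cases t)
    case True
    hence "linked (5/12) (7/12) (a + (b - a) / 4) (b - (b - a) / 4)" using linked_children(2)[of "1/3" "2/3" a b] middle by simp
    moreover have "linked (5/6) (7/6) (5/12) (7/12)" using linked_children(2)[OF linked_\<sigma>(2)] by simp
    ultimately have "linked (1/3) (2/3) (a + (b - a) / 4) (b - (b - a) / 4)" using linked_\<delta>(2) linked_trans by blast
    thus ?thesis by simp
  next
    case False
    hence "linked (29/24) (31/24) (a + (b - a) / 4) (b - (b - a) / 4)" using linked_children(2)[of "7/6" "4/3" a b] middle by simp
    hence "linked (1/3) (2/3) (a + (b - a) / 4) (b - (b - a) / 4)" using linked_\<beta>(2) linked_trans by blast
    thus ?thesis by simp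
  qed
next
  case (right n t a b)
  show ?case
  proof (cases t)
    case True
    hence "linked (7/12) (2/3) (b - (b - a) / 4) b" using linked_children(3)[of "1/3" "2/3" a b] right by simp
    moreover have "linked (7/6) (4/3) (7/12) (2/3)" using linked_children(3)[OF linked_\<sigma>(2)] by simp
    ultimately have "linked (7/6) (4/3) (b - (b - a) / 4) b" using linked_trans by blast
    thus ?thesis by simp
  next
    case False
    hence "linked (31/24) (4/3) (b - (b - a) / 4) b" using linked_children(3)[of "7/6" "4/3" a b] right by simp
    moreover have "linked (7/6) (4/3) (31/24) (4/3)" using linked_\<beta>(1,3) linked_\<delta>(3) linked_trans by blast
    ultimately have "linked (7/6) (4/3) (b - (b - a) / 4) b" using linked_trans by blast
    thus ?thesis by simp
  qed
qed

lemma conjugate_K: "k \<in> K \<Longrightarrow> f \<in> K \<Longrightarrow> conjugate k f \<in> K"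
  using K_compose K_inv by blast

text \<open>The generators provide rotations of the two representatives, which are transported by conjugation.\<close>

lemma piece_rotation:
  assumes "piece n t a b" obtains f where "f \<in> K" "is_rotation f a b"
proof -
  have ab: "a < b" using piece_bounds[OF assms] by simp
  have B: "circle_inv (compose circle \<delta>\<^sub>B (compose circle \<beta>\<^sub>B \<delta>\<^sub>B)) \<in> K" using K_inv K_compose gens by blast
  have A: "\<exists>f\<in>K. is_rotation f (1/3) (2/3)"
    using rotation_conjugate[OF rotation_\<beta> \<sigma>_lin(1,3)] conjugate_K[OF \<sigma>_K B] by auto
  have I: "\<exists>f\<in>K. is_rotation f (7/6) (4/3)" using rotation_\<gamma> K_inv gens by blast
  have "\<exists>f\<in>K. is_rotation f a b"
  proof (cases t)
    case True
    then obtain k where k: "k \<in> K" "maps_linearly k (1/3) (2/3) a b" using piece_linked[OF assms] by (auto simp: linked_def)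
    obtain f where f: "f \<in> K" "is_rotation f (1/3) (2/3)" using A by blast
    have "is_rotation (conjugate k f) a b" by (rule rotation_conjugate[OF f(2) K_Bij[OF k(1)] k(2)]) (use ab in auto)
    thus ?thesis using conjugate_K[OF k(1) f(1)] by blast
  next
    case False
    then obtain k where k: "k \<in> K" "maps_linearly k (7/6) (4/3) a b" using piece_linked[OF assms] by (auto simp: linked_def)
    obtain f where f: "f \<in> K" "is_rotation f (7/6) (4/3)" using I by blast
    have "is_rotation (conjugate k f) a b" by (rule rotation_conjugate[OF f(2) K_Bij[OF k(1)] k(2)]) (use ab in auto)
    thus ?thesis using conjugate_K[OF k(1) f(1)] by blast
  qed
  thus ?thesis using that by blast
qed

lemma rotation_leaves:
  assumes "is_rotation f a b"
  shows "maps_leaves f (leaves (Node (Node l m r) m' r') a b) (leaves (Node l m (Node r m' r')) a b)"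
proof -
  have lin: "maps_linearly f (between a b 0) (between a b (3/16)) (between a b 0) (between a b (3/4))"
    "maps_linearly f (between a b (3/16)) (between a b (1/4)) (between a b (3/4)) (between a b (13/16))"
    "maps_linearly f (between a b (1/4)) (between a b 1) (between a b (13/16)) (between a b 1)"
    using assms by (auto simp: is_rotation_def)
  let ?p = "a + (b - a) / 4" and ?q = "b - (b - a) / 4"
  have 1: "maps_linearly f a (a + (?p - a) / 4) a ?p"
    by (rule maps_linearly_eq[OF maps_linearly_sub[OF lin(1), of 0 "1/3"]]) (simp_all add: field_simps)
  have 2: "maps_linearly f (a + (?p - a) / 4) (?p - (?p - a) / 4) ?p ?q"
    by (rule maps_linearly_eq[OF maps_linearly_sub[OF lin(1), of "1/3" 1]]) (simp_all add: field_simps)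
  have 3: "maps_linearly f (?p - (?p - a) / 4) ?p ?q (?q + (b - ?q) / 4)"
    by (rule maps_linearly_eq[OF lin(2)]) (simp_all add: field_simps)
  have 4: "maps_linearly f ?p ?q (?q + (b - ?q) / 4) (b - (b - ?q) / 4)"
    by (rule maps_linearly_eq[OF maps_linearly_sub[OF lin(3), of 0 "2/3"]]) (simp_all add: field_simps)
  have 5: "maps_linearly f ?q b (b - (b - ?q) / 4) b"
    by (rule maps_linearly_eq[OF maps_linearly_sub[OF lin(3), of "2/3" 1]]) (simp_all add: field_simps)
  show ?thesis unfolding leaves.simps append.assoc
    by (intro list_all2_appendI maps_leaves_linear 1 2 3 4 5)
qed

text \<open>One rotation moves the topmost node of the left subtree to the right child of the root, and the
induction continues inside the interval of that child.\<close>

lemma attach_leaves: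
  "normal l \<Longrightarrow> piece n t a b \<Longrightarrow>
    \<exists>k\<in>K. fixes_outside k a b \<and> maps_leaves k (leaves (Node l m r) a b) (leaves (attach l m r) a b)"
proof (induction l m r arbitrary: n t a b rule: attach.induct)
  case (1 m r)
  have "maps_leaves (\<lambda>z\<in>circle. z) (leaves (Node Leaf m r) a b) (leaves (Node Leaf m r) a b)"
    by (rule maps_leaves_linear[OF maps_linearly_identity])
  moreover have "fixes_outside (\<lambda>z\<in>circle. z) a b" by (simp add: fixes_outside_def)
  ultimately show ?case using K_identity by auto
next
  case (2 l' m' r' m r)
  obtain f where f: "f \<in> K" "is_rotation f a b" using piece_rotation[OF 2(3)] .
  let ?p = "a + (b - a) / 4" and ?q = "b - (b - a) / 4"
  have ab: "a < ?p" "?p < ?q" "?q < b" "b \<le> a + 1" using piece_bounds[OF 2(3)] by (auto simp: field_simps)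
  obtain k where k: "k \<in> K" "fixes_outside k ?q b"
    "maps_leaves k (leaves (Node r' m r) ?q b) (leaves (attach r' m r) ?q b)"
    using "2.IH"[OF _ piece.right[OF 2(3)]] 2(2) by auto
  have "maps_linearly k a ?p a ?p" "maps_linearly k ?p ?q ?p ?q"
    by (rule fixes_outside_before[OF k(2)]; use ab in linarith)+
  hence "maps_leaves k (leaves (Node l' m' (Node r' m r)) a b) (leaves (Node l' m' (attach r' m r)) a b)"
    unfolding leaves.simps(2)[of l' m'] by (intro list_all2_appendI maps_leaves_linear k(3))
  from maps_leaves_compose[OF rotation_leaves[OF f(2)] this]
  have "maps_leaves (compose circle k f) (leaves (Node (Node l' m' r') m r) a b) (leaves (attach (Node l' m' r') m r) a b)" by simp
  moreover have "fixes_outside (compose circle k f) a b"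
  proof (rule fixes_outside_compose)
    show "fixes_outside f a b" using f(2) by (simp add: is_rotation_def)
    show "fixes_outside k a b" by (rule fixes_outside_mono[OF k(2)]; use ab in linarith)
  qed
  ultimately show ?case using K_compose[OF k(1) f(1)] by blast
qed

text \<open>The three subtrees are normalized independently, because the maps have disjoint supports.\<close>

lemma comb_leaves:
  "piece n t a b \<Longrightarrow> \<exists>k\<in>K. fixes_outside k a b \<and> maps_leaves k (leaves \<tau> a b) (leaves (comb \<tau>) a b)"
proof (induction \<tau> arbitrary: n t a b)
  case Leaf
  have "maps_leaves (\<lambda>z\<in>circle. z) (leaves Leaf a b) (leaves Leaf a b)"
    by (rule maps_leaves_linear[OF maps_linearly_identity])
  moreover have "fixes_outside (\<lambda>z\<in>circle. z) a b" by (simp add: fixes_outside_def)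
  ultimately show ?case using K_identity by auto
next
  case (Node l m r)
  let ?p = "a + (b - a) / 4" and ?q = "b - (b - a) / 4"
  have ab: "a < ?p" "?p < ?q" "?q < b" "b \<le> a + 1" using piece_bounds[OF Node(4)] by (auto simp: field_simps)
  obtain kl where kl: "kl \<in> K" "fixes_outside kl a ?p" "maps_leaves kl (leaves l a ?p) (leaves (comb l) a ?p)"
    using Node(1)[OF piece.left[OF Node(4)]] by blast
  obtain km where km: "km \<in> K" "fixes_outside km ?p ?q" "maps_leaves km (leaves m ?p ?q) (leaves (comb m) ?p ?q)"
    using Node(2)[OF piece.middle[OF Node(4)]] by blast
  obtain kr where kr: "kr \<in> K" "fixes_outside kr ?q b" "maps_leaves kr (leaves r ?q b) (leaves (comb r) ?q b)"
    using Node(3)[OF piece.right[OF Node(4)]] by blast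
  obtain k where k: "k \<in> K" "fixes_outside k a b"
    "maps_leaves k (leaves (Node (comb l) (comb m) (comb r)) a b) (leaves (comb (Node l m r)) a b)"
    using attach_leaves[OF normal_comb Node(4)] by (metis comb.simps(2))
  have idl: "maps_linearly kl ?p ?q ?p ?q" "maps_linearly kl ?q b ?q b"
    by (rule fixes_outside_after[OF kl(2)]; use ab in linarith)+
  have idm: "maps_linearly km a ?p a ?p" by (rule fixes_outside_before[OF km(2)]; use ab in linarith)
  have idm': "maps_linearly km ?q b ?q b" by (rule fixes_outside_after[OF km(2)]; use ab in linarith)
  have idr: "maps_linearly kr a ?p a ?p" "maps_linearly kr ?p ?q ?p ?q"
    by (rule fixes_outside_before[OF kr(2)]; use ab in linarith)+
  have 1: "maps_leaves kl (leaves (Node l m r) a b) (leaves (Node (comb l) m r) a b)"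
    unfolding leaves.simps by (intro list_all2_appendI kl(3) maps_leaves_linear idl)
  have 2: "maps_leaves km (leaves (Node (comb l) m r) a b) (leaves (Node (comb l) (comb m) r) a b)"
    unfolding leaves.simps by (intro list_all2_appendI km(3) maps_leaves_linear idm idm')
  have 3: "maps_leaves kr (leaves (Node (comb l) (comb m) r) a b) (leaves (Node (comb l) (comb m) (comb r)) a b)"
    unfolding leaves.simps by (intro list_all2_appendI kr(3) maps_leaves_linear idr)
  let ?k = "compose circle k (compose circle kr (compose circle km kl))"
  have "maps_leaves ?k (leaves (Node l m r) a b) (leaves (comb (Node l m r)) a b)"
    by (rule maps_leaves_compose[OF maps_leaves_compose[OF maps_leaves_compose[OF 1 2] 3] k(3)])
  moreover have "fixes_outside ?k a b"
    by (intro fixes_outside_compose k(2) fixes_outside_mono[OF kl(2)] fixes_outside_mono[OF km(2)] fixes_outside_mono[OF kr(2)];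
        use ab in linarith)
  moreover have "?k \<in> K" using K_compose kl km kr k by simp
  ultimately show ?case by blast
qed

lemma comb_leaves2:
  "\<exists>k\<in>K. k (point (1/3)) = point (1/3) \<and> k (point (2/3)) = point (2/3) \<and> maps_leaves k (leaves2 \<tau> \<sigma>') (leaves2 (comb \<tau>) (comb \<sigma>'))"
proof -
  obtain k where k: "k \<in> K" "fixes_outside k (1/3) (2/3)" "maps_leaves k (leaves \<tau> (1/3) (2/3)) (leaves (comb \<tau>) (1/3) (2/3))"
    using comb_leaves[OF pieceA] by blast
  obtain h where h: "h \<in> K" "fixes_outside h (2/3) (4/3)" "maps_leaves h (leaves \<sigma>' (2/3) (4/3)) (leaves (comb \<sigma>') (2/3) (4/3))"
    using comb_leaves[OF pieceB] by blast
  have idk: "maps_linearly k (2/3) (4/3) (2/3) (4/3)" by (rule fixes_outside_after[OF k(2)]) auto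
  have idh: "maps_linearly h (1/3) (2/3) (1/3) (2/3)" by (rule fixes_outside_before[OF h(2)]) auto
  have "maps_leaves (compose circle h k) (leaves2 \<tau> \<sigma>') (leaves2 (comb \<tau>) (comb \<sigma>'))"
    by (rule maps_leaves_compose[of _ _ "leaves2 (comb \<tau>) \<sigma>'"])
      (intro list_all2_appendI k(3) h(3) maps_leaves_linear idk idh)+
  moreover have "k (point (1/3)) = point (1/3)" "k (point (2/3)) = point (2/3)" "h (point (1/3)) = point (1/3)" "h (point (2/3)) = point (2/3)"
    using fixes_outside_point[OF k(2)] fixes_outside_point[OF h(2)] by auto
  ultimately show ?thesis using K_compose[OF h(1) k(1)] by (intro bexI[of _ "compose circle h k"]) (auto simp: compose_def)
qed

text \<open>Normalizing the trees of the domain by \<open>k\<close> and those of the range by \<open>h\<close> turns \<open>f\<close> into an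
element \<open>h f k\<^sup>-\<^sup>1\<close> between normal trees, which is the identity.\<close>

lemma stabilizer_K:
  assumes f: "f \<in> dyadic_rearrangements" and fix1: "f (point (1/3)) = point (1/3)" and fix2: "f (point (2/3)) = point (2/3)"
  shows "f \<in> K"
proof -
  obtain D R where r: "rearranges f D R" using f dyadic_iff_rearranges by blast
  hence fB: "f \<in> Bij circle" and D: "arc_diagram D" and R: "arc_diagram R" by (auto simp: rearranges_def)
  obtain \<tau> \<upsilon> where xs: "has_intervals D (leaves2 \<tau> \<upsilon>)" using diagram_leaves[OF D] by blast
  obtain \<tau>' \<upsilon>' where ys: "has_intervals R (leaves2 \<tau>' \<upsilon>')" using diagram_leaves[OF R] by blast
  have Z: "\<forall>((a, b), (c, d)) \<in> set (zip (leaves2 \<tau> \<upsilon>) (leaves2 \<tau>' \<upsilon>')). maps_linearly f a b c d"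
    by (rule chain_maps[OF r chain_leaves2 chain_leaves2 fix1]) (use has_intervals_member[OF xs] has_intervals_member[OF ys] in auto)
  obtain k where k: "k \<in> K" "k (point (1/3)) = point (1/3)" "k (point (2/3)) = point (2/3)"
    "maps_leaves k (leaves2 \<tau> \<upsilon>) (leaves2 (comb \<tau>) (comb \<upsilon>))" using comb_leaves2 by blast
  obtain h where h: "h \<in> K" "h (point (1/3)) = point (1/3)" "h (point (2/3)) = point (2/3)"
    "maps_leaves h (leaves2 \<tau>' \<upsilon>') (leaves2 (comb \<tau>') (comb \<upsilon>'))" using comb_leaves2 by blast
  define g where "g = compose circle h (compose circle f (circle_inv k))"
  have gd: "g \<in> dyadic_rearrangements"
    unfolding g_def using f k(1) h(1) K_dyadic by (intro dyadic_compose dyadic_inv) auto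
  then obtain D' R' where r': "rearranges g D' R'" using dyadic_iff_rearranges by blast
  have gB: "g \<in> Bij circle" using r' by (simp add: rearranges_def)
  have lam: "g ` e \<in> lamination" if "e \<in> lamination" for e using rearranges_lamination[OF r'] that by blast
  have kinv: "circle_inv k (point (1/3)) = point (1/3)" "circle_inv k (point (2/3)) = point (2/3)"
    using circle_inv_left[OF K_Bij[OF k(1)] point_in_circle] k by metis+
  have g1: "g (point (1/3)) = point (1/3)" "g (point (2/3)) = point (2/3)"
    unfolding g_def compose_def using kinv h fix1 fix2 by simp_all
  have g2: "g (point (4/3)) = point (4/3)" using g1(1) point_add_one[of "1/3"] by simp
  let ?xs = "leaves2 (comb \<tau>) (comb \<upsilon>)" and ?ys = "leaves2 (comb \<tau>') (comb \<upsilon>')"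
  have W: "\<forall>((a, b), (c, d)) \<in> set (zip ?xs ?ys). maps_linearly g a b c d"
  proof clarify
    fix a b c d assume "((a, b), (c, d)) \<in> set (zip ?xs ?ys)"
    then obtain i where i: "i < length ?xs" "i < length ?ys" "?xs ! i = (a, b)" "?ys ! i = (c, d)"
      unfolding in_set_zip by auto
    have len: "length (leaves2 \<tau> \<upsilon>) = length ?xs" "length (leaves2 \<tau>' \<upsilon>') = length ?ys"
      using list_all2_lengthD[OF k(4)] list_all2_lengthD[OF h(4)] by auto
    obtain a' b' c' d' where i': "leaves2 \<tau> \<upsilon> ! i = (a', b')" "leaves2 \<tau>' \<upsilon>' ! i = (c', d')" by (meson surj_pair)
    have "maps_linearly k a' b' a b" using list_all2_nthD[OF k(4), of i] len i i' by simp
    hence 1: "maps_linearly (circle_inv k) a b a' b'" using maps_linearly_inverse K_Bij k by blast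
    have 3: "maps_linearly h c' d' c d" using list_all2_nthD[OF h(4), of i] len i i' by simp
    have "((a', b'), (c', d')) \<in> set (zip (leaves2 \<tau> \<upsilon>) (leaves2 \<tau>' \<upsilon>'))"
      unfolding in_set_zip using i i' len by (intro exI[of _ i]) simp
    hence 2: "maps_linearly f a' b' c' d'" using Z by fastforce
    show "maps_linearly g a b c d" unfolding g_def by (rule maps_linearly_comp[OF maps_linearly_comp[OF 1 2] 3])
  qed
  from normal_trees_agree[OF lam gB normal_comb normal_comb pieceA g1 W]
  have 1: "comb \<tau> = comb \<tau>'" and W2: "\<forall>((a, b), (c, d)) \<in> set (zip (leaves (comb \<upsilon>) (2/3) (4/3)) (leaves (comb \<upsilon>') (2/3) (4/3))). maps_linearly g a b c d"
    by auto
  have 2: "comb \<upsilon> = comb \<upsilon>'"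
    using normal_trees_agree[OF lam gB normal_comb normal_comb pieceB g1(2) g2, of \<upsilon> "[]" \<upsilon>' "[]"] W2 by simp
  have gid: "g z = z" if z: "z \<in> circle" for z
  proof -
    obtain x where x: "1/3 \<le> x" "x < 1/3 + 1" "z = point x" using circle_point[OF z] .
    have "x < 4/3" using x by simp
    from fixes_leaves[OF W[folded 1 2] chain_leaves2 x(1) this] show ?thesis using x by simp
  qed
  have "f z = compose circle (circle_inv h) k z" if z: "z \<in> circle" for z
  proof -
    have kz: "k z \<in> circle" using Bij_in[OF K_Bij[OF k(1)] z] .
    have "g (k z) = h (f z)" unfolding g_def compose_def using kz circle_inv_left[OF K_Bij[OF k(1)] z] by (simp del: mem_sphere)
    hence "h (f z) = k z" using gid[OF kz] by simp
    hence "f z = circle_inv h (k z)" using circle_inv_left[OF K_Bij[OF h(1)] Bij_in[OF fB z]] by metis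
    thus ?thesis using z by (simp add: compose_def del: mem_sphere)
  qed
  hence "f = compose circle (circle_inv h) k"
    using fB by (intro extensionalityI[of _ circle]) (auto simp: Bij_def)
  thus ?thesis using K_compose K_inv k h by simp
qed

text \<open>An element of the subgroup moves the image of the arc \<open>{1/3, 2/3}\<close> back, and \<open>\<sigma>\<close> corrects an
exchange of its endpoints.\<close>

theorem dyadic_in_K: "dyadic_rearrangements \<subseteq> K"
proof
  fix f assume f: "f \<in> dyadic_rearrangements"
  obtain D R where r: "rearranges f D R" using f dyadic_iff_rearranges by blast
  hence fB: "f \<in> Bij circle" by (simp add: rearranges_def)
  have "f ` arcA \<in> lamination" using rearranges_lamination[OF r] arcA_lamination by blast
  hence "\<exists>a b. f ` arcA = {point a, point b} \<and> linked (1/3) (2/3) a b"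
    unfolding lamination_iff
  proof (elim disjE exE conjE)
    assume "f ` arcA = arcA" thus ?thesis using linked_refl by blast
  next
    fix n t a b assume ab: "piece n t a b" "f ` arcA = primary_arc a b"
    show ?thesis using piece_linked[OF piece.middle[OF ab(1)]] ab(2) unfolding primary_arc_def by auto
  qed
  then obtain a b k where ab: "f ` arcA = {point a, point b}" and k: "k \<in> K" "maps_linearly k (1/3) (2/3) a b"
    by (auto simp: linked_def)
  define g where "g = compose circle (circle_inv k) f"
  have g: "g \<in> dyadic_rearrangements"
    unfolding g_def using f k(1) K_dyadic by (intro dyadic_compose dyadic_inv) auto
  have kinv: "circle_inv k (point a) = point (1/3)" "circle_inv k (point b) = point (2/3)"
    using maps_linearly_ends[OF maps_linearly_inverse[OF K_Bij[OF k(1)] k(2)]] by auto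
  have "g ` arcA = circle_inv k ` (f ` arcA)" by (simp add: g_def compose_def image_image)
  hence gA: "g ` arcA = arcA" unfolding ab using kinv by simp
  have "g \<in> K"
  proof (cases "g (point (1/3)) = point (1/3)")
    case True
    have "point (1/3) \<noteq> point (2/3)" using point_inj[of "1/3" "2/3"] by auto
    hence "g (point (2/3)) = point (2/3)" using gA True by (auto simp: doubleton_eq_iff)
    thus ?thesis using stabilizer_K[OF g True] by simp
  next
    case False
    hence s: "g (point (1/3)) = point (2/3)" "g (point (2/3)) = point (1/3)" using gA by (auto simp: doubleton_eq_iff)
    have gB: "g \<in> Bij circle" using g by (simp add: dyadic_rearrangements_def)
    have \<sigma>1: "\<sigma> (point (1/3)) = point (2/3)" "\<sigma> (point (2/3)) = point (1/3)"
      using maps_linearly_ends[OF \<sigma>_lin(3)] by (simp_all, metis maps_linearly_ends(1) \<sigma>_lin(2))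
    have "compose circle \<sigma> g \<in> dyadic_rearrangements"
      using g \<sigma>_K K_dyadic by (intro dyadic_compose) auto
    hence "compose circle \<sigma> g \<in> K" by (rule stabilizer_K) (use s \<sigma>1 in \<open>simp_all add: compose_def\<close>)
    hence "compose circle (circle_inv \<sigma>) (compose circle \<sigma> g) \<in> K" using K_compose K_inv \<sigma>_K by blast
    moreover have "compose circle (circle_inv \<sigma>) (compose circle \<sigma> g) = g"
      using gB circle_inv_left[OF \<sigma>_lin(1)] Bij_in[OF gB]
      by (intro extensionalityI[of _ circle]) (auto simp: Bij_def compose_def simp del: mem_sphere)
    ultimately show ?thesis by simp
  qed
  hence "compose circle k g \<in> K" using K_compose k by blast
  moreover have "compose circle k g = f"
    using fB circle_inv_right[OF K_Bij[OF k(1)]] Bij_in[OF fB] unfolding g_def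
    by (intro extensionalityI[of _ circle]) (auto simp: Bij_def compose_def simp del: mem_sphere)
  ultimately show "f \<in> K" by simp
qed

end

section \<open>Relations between the generators\<close>

lemma between_subinterval:
  assumes "maps_linearly f (between a b s0) (between a b t0) (between a b s1) (between a b t1)"
    "s0 < t0" "s0 \<le> s" "s \<le> t" "t \<le> t0"
    "u = s1 + (s - s0) * (t1 - s1) / (t0 - s0)" "v = s1 + (t - s0) * (t1 - s1) / (t0 - s0)"
  shows "maps_linearly f (between a b s) (between a b t) (between a b u) (between a b v)"
proof -
  define x y where "x = (s - s0) / (t0 - s0)" "y = (t - s0) / (t0 - s0)"
  have xy: "0 \<le> x" "x \<le> y" "y \<le> 1" using assms(2-5) by (auto simp: x_y_def divide_simps)
  have s: "s0 + x * (t0 - s0) = s" "s0 + y * (t0 - s0) = t" using assms(2) by (simp_all add: x_y_def)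
  have u: "s1 + x * (t1 - s1) = u" "s1 + y * (t1 - s1) = v" using assms(6,7) by (simp_all add: x_y_def)
  have e: "between a b p + z * (between a b q - between a b p) = between a b (p + z * (q - p))" for p q z by (simp add: algebra_simps)
  show ?thesis using maps_linearly_sub[OF assms(1) xy] unfolding e s u .
qed

lemma maps_linearly_agree:
  "maps_linearly f a b c d \<Longrightarrow> maps_linearly g a b c d \<Longrightarrow> a < b \<Longrightarrow> a \<le> x \<Longrightarrow> x \<le> b \<Longrightarrow> f (point x) = g (point x)"
  using maps_linearlyD by metis

text \<open>Both sides move the three nodes on the left spine of a tree to its right spine: either by two
rotations at the root, or by a rotation at the left child, one at the root, and one at the right
child.\<close>

lemma pentagon:
  assumes f: "is_rotation f a b" and l: "is_rotation l a (a + (b - a) / 4)" and r: "is_rotation r (b - (b - a) / 4) b"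
    and ab: "a < b" "b \<le> a + 1"
  shows "compose circle f f = compose circle r (compose circle f l)"
proof -
  let ?B = "between a b"
  have f1: "maps_linearly f (?B 0) (?B (3/16)) (?B 0) (?B (3/4))"
    and f2: "maps_linearly f (?B (3/16)) (?B (1/4)) (?B (3/4)) (?B (13/16))"
    and f3: "maps_linearly f (?B (1/4)) (?B 1) (?B (13/16)) (?B 1)" using f by (auto simp: is_rotation_def)
  have l1: "maps_linearly l (?B 0) (?B (3/64)) (?B 0) (?B (3/16))"
    and l2: "maps_linearly l (?B (3/64)) (?B (1/16)) (?B (3/16)) (?B (13/64))"
    and l3: "maps_linearly l (?B (1/16)) (?B (1/4)) (?B (13/64)) (?B (1/4))"
  proof -
    have L: "maps_linearly l (between a (a + (b - a) / 4) 0) (between a (a + (b - a) / 4) (3/16)) (between a (a + (b - a) / 4) 0) (between a (a + (b - a) / 4) (3/4))"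
      "maps_linearly l (between a (a + (b - a) / 4) (3/16)) (between a (a + (b - a) / 4) (1/4)) (between a (a + (b - a) / 4) (3/4)) (between a (a + (b - a) / 4) (13/16))"
      "maps_linearly l (between a (a + (b - a) / 4) (1/4)) (between a (a + (b - a) / 4) 1) (between a (a + (b - a) / 4) (13/16)) (between a (a + (b - a) / 4) 1)"
      using l unfolding is_rotation_def by blast+
    show "maps_linearly l (?B 0) (?B (3/64)) (?B 0) (?B (3/16))" by (rule maps_linearly_eq[OF L(1)]) (simp_all add: field_simps)
    show "maps_linearly l (?B (3/64)) (?B (1/16)) (?B (3/16)) (?B (13/64))" by (rule maps_linearly_eq[OF L(2)]) (simp_all add: field_simps)
    show "maps_linearly l (?B (1/16)) (?B (1/4)) (?B (13/64)) (?B (1/4))" by (rule maps_linearly_eq[OF L(3)]) (simp_all add: field_simps)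
  qed
  have r1: "maps_linearly r (?B (3/4)) (?B (51/64)) (?B (3/4)) (?B (15/16))"
    and r2: "maps_linearly r (?B (51/64)) (?B (13/16)) (?B (15/16)) (?B (61/64))"
    and r3: "maps_linearly r (?B (13/16)) (?B 1) (?B (61/64)) (?B 1)"
  proof -
    have R: "maps_linearly r (between (b - (b - a) / 4) b 0) (between (b - (b - a) / 4) b (3/16)) (between (b - (b - a) / 4) b 0) (between (b - (b - a) / 4) b (3/4))"
      "maps_linearly r (between (b - (b - a) / 4) b (3/16)) (between (b - (b - a) / 4) b (1/4)) (between (b - (b - a) / 4) b (3/4)) (between (b - (b - a) / 4) b (13/16))"
      "maps_linearly r (between (b - (b - a) / 4) b (1/4)) (between (b - (b - a) / 4) b 1) (between (b - (b - a) / 4) b (13/16)) (between (b - (b - a) / 4) b 1)"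
      using r unfolding is_rotation_def by blast+
    show "maps_linearly r (?B (3/4)) (?B (51/64)) (?B (3/4)) (?B (15/16))" by (rule maps_linearly_eq[OF R(1)]) (simp_all add: field_simps)
    show "maps_linearly r (?B (51/64)) (?B (13/16)) (?B (15/16)) (?B (61/64))" by (rule maps_linearly_eq[OF R(2)]) (simp_all add: field_simps)
    show "maps_linearly r (?B (13/16)) (?B 1) (?B (61/64)) (?B 1)" by (rule maps_linearly_eq[OF R(3)]) (simp_all add: field_simps)
  qed
  have l4: "maps_linearly l (?B (1/4)) (?B 1) (?B (1/4)) (?B 1)"
    by (rule fixes_outside_after[of l a "a + (b - a) / 4"]) (use l ab in \<open>auto simp: is_rotation_def field_simps\<close>)
  have r0: "maps_linearly r (?B 0) (?B (3/4)) (?B 0) (?B (3/4))"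
    by (rule fixes_outside_before[of r "b - (b - a) / 4" b]) (use r ab in \<open>auto simp: is_rotation_def field_simps\<close>)
  note sub1 = between_subinterval[OF f1] and sub2 = between_subinterval[OF f2] and sub3 = between_subinterval[OF f3]
  let ?ff = "compose circle f f" and ?g = "compose circle r (compose circle f l)"
  have F: "maps_linearly ?ff (?B 0) (?B (3/64)) (?B 0) (?B (3/4))"
    "maps_linearly ?ff (?B (3/64)) (?B (1/16)) (?B (3/4)) (?B (13/16))"
    "maps_linearly ?ff (?B (1/16)) (?B (3/16)) (?B (13/16)) (?B (15/16))"
    "maps_linearly ?ff (?B (3/16)) (?B (1/4)) (?B (15/16)) (?B (61/64))"
    "maps_linearly ?ff (?B (1/4)) (?B 1) (?B (61/64)) (?B 1)"
  proof -
    show "maps_linearly ?ff (?B 0) (?B (3/64)) (?B 0) (?B (3/4))"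
      by (rule maps_linearly_comp[OF _ f1], rule sub1; simp)
    show "maps_linearly ?ff (?B (3/64)) (?B (1/16)) (?B (3/4)) (?B (13/16))"
      by (rule maps_linearly_comp[OF _ f2], rule sub1; simp)
    show "maps_linearly ?ff (?B (1/16)) (?B (3/16)) (?B (13/16)) (?B (15/16))"
    proof (rule maps_linearly_comp)
      show "maps_linearly f (?B (1/16)) (?B (3/16)) (?B (1/4)) (?B (3/4))" by (rule sub1; simp)
      show "maps_linearly f (?B (1/4)) (?B (3/4)) (?B (13/16)) (?B (15/16))" by (rule sub3; simp)
    qed
    show "maps_linearly ?ff (?B (3/16)) (?B (1/4)) (?B (15/16)) (?B (61/64))"
      by (rule maps_linearly_comp[OF f2], rule sub3; simp)
    show "maps_linearly ?ff (?B (1/4)) (?B 1) (?B (61/64)) (?B 1)"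
      by (rule maps_linearly_comp[OF f3], rule sub3; simp)
  qed
  have l31: "maps_linearly l (?B (1/16)) (?B (3/16)) (?B (13/64)) (?B (15/64))" by (rule between_subinterval[OF l3]; simp)
  have l32: "maps_linearly l (?B (3/16)) (?B (1/4)) (?B (15/64)) (?B (1/4))" by (rule between_subinterval[OF l3]; simp)
  have f21: "maps_linearly f (?B (3/16)) (?B (13/64)) (?B (3/4)) (?B (49/64))" by (rule sub2; simp)
  have f22: "maps_linearly f (?B (13/64)) (?B (15/64)) (?B (49/64)) (?B (51/64))" by (rule sub2; simp)
  have f23: "maps_linearly f (?B (15/64)) (?B (1/4)) (?B (51/64)) (?B (13/16))" by (rule sub2; simp)
  have r11: "maps_linearly r (?B (3/4)) (?B (49/64)) (?B (3/4)) (?B (13/16))" by (rule between_subinterval[OF r1]; simp)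
  have r12: "maps_linearly r (?B (49/64)) (?B (51/64)) (?B (13/16)) (?B (15/16))" by (rule between_subinterval[OF r1]; simp)
  note comp = maps_linearly_comp[OF maps_linearly_comp]
  have G: "maps_linearly ?g (?B 0) (?B (3/64)) (?B 0) (?B (3/4))"
    "maps_linearly ?g (?B (3/64)) (?B (1/16)) (?B (3/4)) (?B (13/16))"
    "maps_linearly ?g (?B (1/16)) (?B (3/16)) (?B (13/16)) (?B (15/16))"
    "maps_linearly ?g (?B (3/16)) (?B (1/4)) (?B (15/16)) (?B (61/64))"
    "maps_linearly ?g (?B (1/4)) (?B 1) (?B (61/64)) (?B 1)"
    using comp[OF l1 f1 r0] comp[OF l2 f21 r11] comp[OF l31 f22 r12] comp[OF l32 f23 r2] comp[OF l4 f3 r3] by blast+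
  have "fixes_outside l a (a + (b - a) / 4)" "fixes_outside r (b - (b - a) / 4) b" "fixes_outside f a b"
    using f l r by (simp_all only: is_rotation_def)
  hence fixo: "fixes_outside f a b" "fixes_outside l a b" "fixes_outside r a b"
    using fixes_outside_mono[of l a "a + (b - a) / 4" a b] fixes_outside_mono[of r "b - (b - a) / 4" b a b] ab
    by (simp_all add: field_simps)
  show ?thesis
  proof (rule extensionalityI[of _ circle])
    fix z assume z: "z \<in> circle"
    obtain x where x: "a \<le> x" "x < a + 1" "z = point x" using circle_point[OF z] .
    show "?ff z = ?g z"
    proof (cases "b \<le> x")
      case True
      hence "f z = z" "l z = z" "r z = z" using fixo[THEN fixes_outside_point, of x] x by auto
      thus ?thesis using z by (simp add: compose_def)
    next
      case False
      have inc: "?B s < ?B t" if "s < t" for s t using that ab by simp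
      have x01: "?B 0 \<le> x" "x \<le> ?B 1" using x False by auto
      from x01 consider "x \<le> ?B (3/64)" | "?B (3/64) \<le> x" "x \<le> ?B (1/16)" | "?B (1/16) \<le> x" "x \<le> ?B (3/16)"
        | "?B (3/16) \<le> x" "x \<le> ?B (1/4)" | "?B (1/4) \<le> x" by linarith
      thus ?thesis
      proof cases
        case 1 thus ?thesis using maps_linearly_agree[OF F(1) G(1) inc x01(1)] x(3) by simp
      next
        case 2 thus ?thesis using maps_linearly_agree[OF F(2) G(2) inc] x(3) by simp
      next
        case 3 thus ?thesis using maps_linearly_agree[OF F(3) G(3) inc] x(3) by simp
      next
        case 4 thus ?thesis using maps_linearly_agree[OF F(4) G(4) inc] x(3) by simp
      next
        case 5 thus ?thesis using maps_linearly_agree[OF F(5) G(5) inc _ x01(2)] x(3) by simp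
      qed
    qed
  qed (simp_all add: compose_def)
qed

lemma \<delta>_involution: "compose circle \<delta>\<^sub>B \<delta>\<^sub>B = (\<lambda>z\<in>circle. z)"
proof (rule extensionalityI[of _ circle])
  fix z assume z: "z \<in> circle"
  obtain x where "z = point x" using circle_point[OF z] by metis
  thus "compose circle \<delta>\<^sub>B \<delta>\<^sub>B z = (\<lambda>z\<in>circle. z) z"
    using z point_add_one[of x] by (simp add: compose_def \<delta>_point add.commute)
qed (simp_all add: compose_def)

lemma \<sigma>_involution: "compose circle \<sigma> \<sigma> = (\<lambda>z\<in>circle. z)"
proof (rule extensionalityI[of _ circle])
  fix z assume z: "z \<in> circle"
  obtain x where x: "1/3 \<le> x" "x < 1/3 + 1" "z = point x" using circle_point[OF z] .
  have "compose circle \<sigma> \<sigma> (point x) = point x"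
  proof (cases "x \<le> 2/3")
    case True
    show ?thesis by (rule maps_linearly_fixes[OF maps_linearly_comp[OF \<sigma>_lin(2,3)]]) (use x True in auto)
  next
    case False
    show ?thesis by (rule maps_linearly_fixes[OF maps_linearly_comp[OF \<sigma>_lin(3,2)]]) (use x False in auto)
  qed
  thus "compose circle \<sigma> \<sigma> z = (\<lambda>z\<in>circle. z) z" using z x(3) by simp
qed (simp_all add: compose_def)

text \<open>The map \<open>\<delta>\<beta>\<close> permutes six intervals in two cycles of length three.\<close>

lemma \<delta>\<beta>_order_three:
  defines "h \<equiv> compose circle \<delta>\<^sub>B \<beta>\<^sub>B"
  shows "compose circle h (compose circle h h) = (\<lambda>z\<in>circle. z)"
proof -
  have lin: "maps_linearly h u v u' v'" if "maps_linearly \<beta>\<^sub>B u v w x" "u' = w + 1/2" "v' = x + 1/2" for u v w x u' v'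
    using maps_linearly_comp[OF that(1) \<delta>_lin] that(2,3) by (simp add: h_def)
  have h: "maps_linearly h (5/6) (7/6) (1/3) (2/3)" "maps_linearly h (1/3) (2/3) (17/24) (19/24)"
    "maps_linearly h (17/24) (19/24) (5/6) (7/6)" "maps_linearly h (7/6) (4/3) (2/3) (17/24)"
    "maps_linearly h (2/3) (17/24) (19/24) (5/6)" "maps_linearly h (19/24) (5/6) (7/6) (4/3)"
    by - ((rule lin[of _ _ "-1/6" "1/6"], rule maps_linearly_subinterval[OF \<beta>_lin(2), of _ "-1" _ _ 0]; simp),
        (rule lin[of _ _ "5/24" "7/24"], rule maps_linearly_subinterval[OF \<beta>_lin(3), of _ 0 _ _ 0]; simp),
        (rule lin[of _ _ "1/3" "2/3"], rule maps_linearly_subinterval[OF \<beta>_lin(5), of _ 0 _ _ 0]; simp),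
        (rule lin[of _ _ "1/6" "5/24"], rule maps_linearly_subinterval[OF \<beta>_lin(3), of _ "-1" _ _ 0]; simp),
        (rule lin[of _ _ "7/24" "1/3"], rule maps_linearly_subinterval[OF \<beta>_lin(4), of _ 0 _ _ 0]; simp),
        (rule lin[of _ _ "2/3" "5/6"], rule maps_linearly_subinterval[OF \<beta>_lin(5), of _ 0 _ _ 0]; simp))
  let ?h3 = "compose circle h (compose circle h h)"
  note c = maps_linearly_comp[OF maps_linearly_comp]
  have h3: "maps_linearly ?h3 (1/3) (2/3) (1/3) (2/3)" "maps_linearly ?h3 (2/3) (17/24) (2/3) (17/24)"
    "maps_linearly ?h3 (17/24) (19/24) (17/24) (19/24)" "maps_linearly ?h3 (19/24) (5/6) (19/24) (5/6)"
    "maps_linearly ?h3 (5/6) (7/6) (5/6) (7/6)" "maps_linearly ?h3 (7/6) (4/3) (7/6) (4/3)"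
    using c[OF h(2,3,1)] c[OF h(5,6,4)] c[OF h(3,1,2)] c[OF h(6,4,5)] c[OF h(1,2,3)] c[OF h(4,5,6)] by blast+
  show ?thesis
  proof (rule extensionalityI[of _ circle])
    fix z assume z: "z \<in> circle"
    obtain x where x: "1/3 \<le> x" "x < 1/3 + 1" "z = point x" using circle_point[OF z] .
    have x4: "x < 4/3" using x by simp
    have "?h3 (point x) = point x"
      by (rule fixes_leaves[of "[(1/3, 2/3), (2/3, 17/24), (17/24, 19/24), (19/24, 5/6), (5/6, 7/6), (7/6, 4/3)]" _ "1/3" "4/3"])
        (use h3 x(1) x4 in simp_all)
    thus "?h3 z = (\<lambda>z\<in>circle. z) z" using z x(3) by simp
  qed (simp_all add: compose_def)
qed

section \<open>Commutator subgroups and subgroups of index two\<close>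

context group begin

lemma conjugate_in_derived:
  "x \<in> derived G (carrier G) \<Longrightarrow> k \<in> carrier G \<Longrightarrow> k \<otimes> x \<otimes> inv k \<in> derived G (carrier G)"
  using normal.inv_op_closed2[OF derived_self_is_normal] by simp

lemma commutator_in_derived:
  "x \<in> carrier G \<Longrightarrow> y \<in> carrier G \<Longrightarrow> x \<otimes> y \<otimes> inv x \<otimes> inv y \<in> derived G (carrier G)"
  unfolding derived_def by (rule generate.incl) blast

lemma derived_mult: "x \<in> derived G (carrier G) \<Longrightarrow> y \<in> derived G (carrier G) \<Longrightarrow> x \<otimes> y \<in> derived G (carrier G)"
  using subgroup.m_closed[OF derived_is_subgroup[OF subset_refl]] .

lemma derived_inv: "x \<in> derived G (carrier G) \<Longrightarrow> inv x \<in> derived G (carrier G)"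
  using subgroup.m_inv_closed[OF derived_is_subgroup[OF subset_refl]] .

lemma derived_mem: "x \<in> derived G (carrier G) \<Longrightarrow> x \<in> carrier G"
  using subgroup.mem_carrier[OF derived_is_subgroup[OF subset_refl]] .

text \<open>Modulo commutators the equation reads \<open>r\<^sup>2 = r\<close>.\<close>

lemma in_derived_of_square:
  assumes r: "r \<in> carrier G" and st: "s \<in> derived G (carrier G)" "t \<in> derived G (carrier G)"
    and eq: "r \<otimes> r = s \<otimes> r \<otimes> t"
  shows "r \<in> derived G (carrier G)"
proof -
  have c: "s \<in> carrier G" "t \<in> carrier G" using derived_mem st by auto
  have "r \<otimes> r = (s \<otimes> (r \<otimes> t \<otimes> inv r)) \<otimes> r" using eq r c by (simp add: m_assoc)
  hence "r = s \<otimes> (r \<otimes> t \<otimes> inv r)" using r c right_cancel by simp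
  moreover have "s \<otimes> (r \<otimes> t \<otimes> inv r) \<in> derived G (carrier G)"
    using derived_mult[OF st(1) conjugate_in_derived[OF st(2) r]] .
  ultimately show ?thesis by simp
qed

text \<open>Modulo commutators the equation reads \<open>r\<^sup>2 = r\<^sup>3\<close>.\<close>

lemma in_derived_of_conjugates:
  assumes c: "r \<in> carrier G" "k \<in> carrier G" "l \<in> carrier G"
    and eq: "r \<otimes> r = (k \<otimes> r \<otimes> inv k) \<otimes> r \<otimes> (l \<otimes> r \<otimes> inv l)"
  shows "r \<in> derived G (carrier G)"
proof -
  define x y where "x = k \<otimes> r \<otimes> inv k \<otimes> inv r" "y = l \<otimes> r \<otimes> inv l \<otimes> inv r"
  have xy: "x \<in> derived G (carrier G)" "y \<in> derived G (carrier G)" using commutator_in_derived c unfolding x_y_def by auto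
  have xc: "x \<in> carrier G" "y \<in> carrier G" using derived_mem xy by auto
  have k: "k \<otimes> r \<otimes> inv k = x \<otimes> r" "l \<otimes> r \<otimes> inv l = y \<otimes> r" using c by (simp_all add: x_y_def m_assoc)
  define z where "z = (r \<otimes> r) \<otimes> y \<otimes> inv (r \<otimes> r)"
  have z: "z \<in> derived G (carrier G)" unfolding z_def using conjugate_in_derived[OF xy(2)] c by simp
  have zc: "z \<in> carrier G" using derived_mem[OF z] .
  have zr: "z \<otimes> (r \<otimes> r) = (r \<otimes> r) \<otimes> y" unfolding z_def using c xc by (simp add: m_assoc)
  have "(x \<otimes> r) \<otimes> r \<otimes> (y \<otimes> r) = x \<otimes> ((r \<otimes> r) \<otimes> y) \<otimes> r" using c xc by (simp add: m_assoc)
  hence "r \<otimes> r = x \<otimes> ((r \<otimes> r) \<otimes> y) \<otimes> r" using eq k by (simp only:)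
  also have "\<dots> = x \<otimes> (z \<otimes> (r \<otimes> r)) \<otimes> r" using zr by simp
  also have "\<dots> = (x \<otimes> z \<otimes> r) \<otimes> (r \<otimes> r)" using c xc zc by (simp add: m_assoc)
  finally have "\<one> \<otimes> (r \<otimes> r) = (x \<otimes> z \<otimes> r) \<otimes> (r \<otimes> r)" using c by simp
  hence "\<one> = x \<otimes> z \<otimes> r" using right_cancel[of "r \<otimes> r" \<one> "x \<otimes> z \<otimes> r"] c xc zc by simp
  hence "inv r = x \<otimes> z" using inv_equality[of "x \<otimes> z" r] c xc zc by simp
  hence "inv r \<in> derived G (carrier G)" using derived_mult[OF xy(1) z] by simp
  hence "inv (inv r) \<in> derived G (carrier G)" by (rule derived_inv)
  thus ?thesis using c by simp
qed

text \<open>Modulo commutators the equations read \<open>d\<^sup>2 = 1\<close> and \<open>d\<^sup>3 = 1\<close>.\<close>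

lemma in_derived_of_orders:
  assumes c: "d \<in> carrier G" and b: "b \<in> derived G (carrier G)" and d: "d \<otimes> d = \<one>"
    and db: "(d \<otimes> b) \<otimes> ((d \<otimes> b) \<otimes> (d \<otimes> b)) = \<one>"
  shows "d \<in> derived G (carrier G)"
proof -
  have bc: "b \<in> carrier G" using derived_mem[OF b] .
  have id: "inv d = d" using inv_equality[OF d] c by simp
  have x: "d \<otimes> b \<otimes> d \<in> derived G (carrier G)" using conjugate_in_derived[OF b c] id by simp
  have xc: "d \<otimes> b \<otimes> d \<in> carrier G" using c bc by simp
  have "(d \<otimes> b \<otimes> d \<otimes> b) \<otimes> (d \<otimes> b) = \<one>" using db c bc by (simp add: m_assoc)
  hence "d \<otimes> b \<otimes> d \<otimes> b = inv (d \<otimes> b)" using inv_equality[of "d \<otimes> b \<otimes> d \<otimes> b" "d \<otimes> b"] c bc by simp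
  hence "inv (d \<otimes> b \<otimes> d \<otimes> b) = d \<otimes> b" using c bc by simp
  hence "d = inv (d \<otimes> b \<otimes> d \<otimes> b) \<otimes> inv b" using c bc by (simp add: m_assoc)
  moreover have "inv (d \<otimes> b \<otimes> d \<otimes> b) \<otimes> inv b \<in> derived G (carrier G)"
    by (rule derived_mult[OF derived_inv[OF derived_mult[OF x b]] derived_inv[OF b]])
  ultimately show ?thesis by simp
qed

lemma generate_conjugate:
  assumes S: "S \<subseteq> carrier G" and a: "a \<in> carrier G" and H: "subgroup H G" and conj: "\<And>s. s \<in> S \<Longrightarrow> inv a \<otimes> s \<otimes> a \<in> H"
    and h: "h \<in> generate G S"
  shows "inv a \<otimes> h \<otimes> a \<in> H"
  using h
proof (induction rule: generate.induct)
  case one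
  thus ?case using a subgroup.one_closed[OF H] by simp
next
  case (incl s) thus ?case using conj by blast
next
  case (inv s)
  have s: "s \<in> carrier G" using inv S by blast
  have "inv a \<otimes> inv s \<otimes> a = inv (inv a \<otimes> s \<otimes> a)" using a s by (simp add: inv_mult_group m_assoc)
  thus ?case using subgroup.m_inv_closed[OF H conj[OF inv]] by simp
next
  case (eng h1 h2)
  have c: "h1 \<in> carrier G" "h2 \<in> carrier G" using generate_in_carrier[OF S] eng by auto
  have "inv a \<otimes> (h1 \<otimes> h2) \<otimes> a = (inv a \<otimes> h1 \<otimes> a) \<otimes> (inv a \<otimes> h2 \<otimes> a)"
  proof -
    have "a \<otimes> (inv a \<otimes> (h2 \<otimes> a)) = h2 \<otimes> a" using a c by (simp add: m_assoc[symmetric])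
    thus ?thesis using a c by (simp add: m_assoc)
  qed
  thus ?case using subgroup.m_closed[OF H] eng by simp
qed

lemma index_two_union:
  assumes H: "subgroup H G" and a: "a \<in> carrier G" and aa: "a \<otimes> a \<in> H"
    and conj: "\<And>h. h \<in> H \<Longrightarrow> inv a \<otimes> h \<otimes> a \<in> H"
  shows "subgroup (H \<union> (\<lambda>h. a \<otimes> h) ` H) G"
proof -
  note Hc = subgroup.mem_carrier[OF H] and Hm = subgroup.m_closed[OF H] and Hi = subgroup.m_inv_closed[OF H]
  \<comment> \<open>It equals \<open>a\<^sup>2 (a\<^sup>-\<^sup>1 h a) a\<^sup>-\<^sup>2\<close>.\<close>
  have conj': "a \<otimes> h \<otimes> inv a \<in> H" if h: "h \<in> H" for h
  proof -
    have "(a \<otimes> a) \<otimes> (inv a \<otimes> h \<otimes> a) \<otimes> inv (a \<otimes> a) \<in> H" using Hm Hi aa conj[OF h] by blast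
    moreover have "(a \<otimes> a) \<otimes> (inv a \<otimes> h \<otimes> a) \<otimes> inv (a \<otimes> a) = a \<otimes> h \<otimes> inv a"
    proof -
      have "a \<otimes> (inv a \<otimes> (h \<otimes> inv a)) = h \<otimes> inv a" "a \<otimes> (inv a \<otimes> inv a) = inv a"
        using a Hc[OF h] by (simp_all add: m_assoc[symmetric])
      thus ?thesis using a Hc[OF h] by (simp add: m_assoc inv_mult_group)
    qed
    ultimately show ?thesis by simp
  qed
  show ?thesis
  proof (rule subgroupI)
    show "H \<union> (\<lambda>h. a \<otimes> h) ` H \<subseteq> carrier G" using Hc a by auto
    show "H \<union> (\<lambda>h. a \<otimes> h) ` H \<noteq> {}" using subgroup.one_closed[OF H] by blast
  next
    fix x assume "x \<in> H \<union> (\<lambda>h. a \<otimes> h) ` H"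
    then consider "x \<in> H" | h where "h \<in> H" "x = a \<otimes> h" by blast
    thus "inv x \<in> H \<union> (\<lambda>h. a \<otimes> h) ` H"
    proof cases
      case 2
      have "inv x = a \<otimes> (inv (a \<otimes> a) \<otimes> (a \<otimes> inv h \<otimes> inv a))"
        using a Hc[OF 2(1)] 2(2) by (simp add: inv_mult_group m_assoc[symmetric])
      moreover have "inv (a \<otimes> a) \<otimes> (a \<otimes> inv h \<otimes> inv a) \<in> H" using Hm Hi aa conj' 2(1) by blast
      ultimately show ?thesis by blast
    qed (use Hi in blast)
  next
    fix x y assume x: "x \<in> H \<union> (\<lambda>h. a \<otimes> h) ` H" and y: "y \<in> H \<union> (\<lambda>h. a \<otimes> h) ` H"
    from x consider "x \<in> H" | h where "h \<in> H" "x = a \<otimes> h" by blast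
    thus "x \<otimes> y \<in> H \<union> (\<lambda>h. a \<otimes> h) ` H"
    proof cases
      case 1
      from y consider "y \<in> H" | k where "k \<in> H" "y = a \<otimes> k" by blast
      thus ?thesis
      proof cases
        case (2 k)
        have "x \<otimes> y = a \<otimes> ((inv a \<otimes> x \<otimes> a) \<otimes> k)" using a Hc[OF 1] Hc[OF 2(1)] 2(2) by (simp add: m_assoc[symmetric])
        moreover have "(inv a \<otimes> x \<otimes> a) \<otimes> k \<in> H" using Hm conj[OF 1] 2(1) by blast
        ultimately show ?thesis by blast
      qed (use Hm 1 in blast)
    next
      case (2 h)
      from y consider "y \<in> H" | k where "k \<in> H" "y = a \<otimes> k" by blast
      thus ?thesis
      proof cases
        case 1
        have "x \<otimes> y = a \<otimes> (h \<otimes> y)" using a Hc[OF 2(1)] Hc[OF 1] 2(2) by (simp add: m_assoc)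
        thus ?thesis using Hm 2(1) 1 by blast
      next
        case (2 k)
        have "x \<otimes> y = (a \<otimes> a) \<otimes> ((inv a \<otimes> h \<otimes> a) \<otimes> k)"
        proof -
          have "a \<otimes> (inv a \<otimes> (h \<otimes> (a \<otimes> k))) = h \<otimes> (a \<otimes> k)" using a Hc[OF \<open>h \<in> H\<close>] Hc[OF 2(1)] by (simp add: m_assoc[symmetric])
          thus ?thesis using a Hc[OF \<open>h \<in> H\<close>] Hc[OF 2(1)] 2(2) \<open>x = a \<otimes> h\<close> by (simp add: m_assoc)
        qed
        moreover have "(a \<otimes> a) \<otimes> ((inv a \<otimes> h \<otimes> a) \<otimes> k) \<in> H" using Hm aa conj[OF \<open>h \<in> H\<close>] 2(1) by blast
        ultimately show ?thesis by simp
      qed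
    qed
  qed
qed

end

section \<open>The generators lie in the commutator subgroup\<close>

lemma T_B_carrier: "carrier T_B = dyadic_rearrangements"
  by (simp add: T_B_def)

lemma T_B_mult:
  "g \<in> dyadic_rearrangements \<Longrightarrow> f \<in> dyadic_rearrangements \<Longrightarrow> g \<otimes>\<^bsub>T_B\<^esub> f = compose circle g f"
  using BijGroup_mult[OF dyadic_Bij dyadic_Bij, of g f] by (simp add: T_B_def)

lemma T_B_inv: "f \<in> dyadic_rearrangements \<Longrightarrow> inv\<^bsub>T_B\<^esub> f = circle_inv f"
  unfolding T_B_def using group.m_inv_consistent[OF group_BijGroup dyadic_subgroup] .

lemma T_B_one: "\<one>\<^bsub>T_B\<^esub> = (\<lambda>z\<in>circle. z)"
  by (simp add: T_B_def BijGroup_one)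

lemma T_B_conjugate:
  "k \<in> dyadic_rearrangements \<Longrightarrow> f \<in> dyadic_rearrangements \<Longrightarrow> conjugate k f = k \<otimes>\<^bsub>T_B\<^esub> f \<otimes>\<^bsub>T_B\<^esub> inv\<^bsub>T_B\<^esub> k"
  using monoid.m_assoc[OF group.is_monoid[OF group_T_B], of k f "circle_inv k"]
  by (simp add: T_B_carrier T_B_mult T_B_inv dyadic_compose dyadic_inv)

lemma T_B_mult3:
  "h \<in> dyadic_rearrangements \<Longrightarrow> g \<in> dyadic_rearrangements \<Longrightarrow> f \<in> dyadic_rearrangements
    \<Longrightarrow> compose circle h (compose circle g f) = h \<otimes>\<^bsub>T_B\<^esub> g \<otimes>\<^bsub>T_B\<^esub> f"
  using monoid.m_assoc[OF group.is_monoid[OF group_T_B], of h g f]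
  by (simp add: T_B_carrier T_B_mult dyadic_compose)

lemma conjugate_dyadic:
  "k \<in> dyadic_rearrangements \<Longrightarrow> f \<in> dyadic_rearrangements \<Longrightarrow> conjugate k f \<in> dyadic_rearrangements"
  by (simp add: dyadic_compose dyadic_inv)

abbreviation T_B' :: "(complex \<Rightarrow> complex) set" where
  "T_B' \<equiv> derived T_B (carrier T_B)"

text \<open>The inverse of \<open>\<gamma>\<close> is the rotation of \<open>[7/6, 4/3]\<close>.  The outer quarters of this interval have its own
type, so their rotations are conjugate to it: the left one by \<open>\<beta>\<close>, the right one by \<open>\<beta>\<delta>\<beta>\<close>.\<close>

lemma \<gamma>_derived: "\<gamma>\<^sub>B \<in> T_B'"
proof -
  interpret T: group T_B by (rule group_T_B)
  let ?r = "circle_inv \<gamma>\<^sub>B" and ?k = "compose circle \<beta>\<^sub>B (compose circle \<delta>\<^sub>B \<beta>\<^sub>B)"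
  note g = generators_dyadic
  have rd: "?r \<in> dyadic_rearrangements" "?k \<in> dyadic_rearrangements" using dyadic_inv dyadic_compose g by auto
  have b: "maps_linearly \<beta>\<^sub>B (7/6) (4/3) (7/6) (29/24)" "maps_linearly \<beta>\<^sub>B (2/3) (17/24) (31/24) (4/3)"
    by - ((rule maps_linearly_subinterval[OF \<beta>_lin(3), of _ "-1" _ _ 1]; simp),
        (rule maps_linearly_subinterval[OF \<beta>_lin(4), of _ 0 _ _ 1]; simp))
  have d: "maps_linearly \<delta>\<^sub>B (7/6) (29/24) (2/3) (17/24)"
    by (rule maps_linearly_subinterval[OF \<delta>_lin, of "7/6" "29/24" _ 0 _ _ "-1"]; simp)
  have left: "is_rotation (conjugate \<beta>\<^sub>B ?r) (7/6) (29/24)"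
    by (rule rotation_conjugate[OF rotation_\<gamma> \<beta>_lin(1) b(1)]) auto
  have right: "is_rotation (conjugate ?k ?r) (31/24) (4/3)"
    by (rule rotation_conjugate[OF rotation_\<gamma> dyadic_Bij[OF rd(2)] maps_linearly_comp[OF maps_linearly_comp[OF b(1) d] b(2)]]) auto
  have "compose circle ?r ?r = compose circle (conjugate ?k ?r) (compose circle ?r (conjugate \<beta>\<^sub>B ?r))"
    by (rule pentagon[OF rotation_\<gamma>]) (use left right in simp_all)
  hence "?r \<otimes>\<^bsub>T_B\<^esub> ?r = (?k \<otimes>\<^bsub>T_B\<^esub> ?r \<otimes>\<^bsub>T_B\<^esub> inv\<^bsub>T_B\<^esub> ?k) \<otimes>\<^bsub>T_B\<^esub> ?r \<otimes>\<^bsub>T_B\<^esub> (\<beta>\<^sub>B \<otimes>\<^bsub>T_B\<^esub> ?r \<otimes>\<^bsub>T_B\<^esub> inv\<^bsub>T_B\<^esub> \<beta>\<^sub>B)"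
    by (simp only: T_B_mult[OF rd(1) rd(1), symmetric] T_B_mult3[OF conjugate_dyadic[OF rd(2,1)] rd(1) conjugate_dyadic[OF g(2) rd(1)]]
        T_B_conjugate[OF rd(2,1), symmetric] T_B_conjugate[OF g(2) rd(1), symmetric])
  hence "?r \<in> T_B'" using rd g by (intro T.in_derived_of_conjugates[of ?r ?k "\<beta>\<^sub>B"]) (auto simp: T_B_carrier)
  hence "inv\<^bsub>T_B\<^esub> ?r \<in> T_B'" by (rule T.derived_inv)
  thus ?thesis using T_B_inv[OF rd(1)] circle_inv_inv[OF \<gamma>_lin(1)] by simp
qed

lemma \<delta>_T_B: "inv\<^bsub>T_B\<^esub> \<delta>\<^sub>B = \<delta>\<^sub>B" "\<delta>\<^sub>B \<otimes>\<^bsub>T_B\<^esub> \<delta>\<^sub>B = \<one>\<^bsub>T_B\<^esub>"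
proof -
  interpret T: group T_B by (rule group_T_B)
  show "\<delta>\<^sub>B \<otimes>\<^bsub>T_B\<^esub> \<delta>\<^sub>B = \<one>\<^bsub>T_B\<^esub>" using \<delta>_involution generators_dyadic by (simp add: T_B_mult T_B_one)
  thus "inv\<^bsub>T_B\<^esub> \<delta>\<^sub>B = \<delta>\<^sub>B" using T.inv_equality generators_dyadic by (simp add: T_B_carrier)
qed

text \<open>Up to conjugation by \<open>\<delta>\<close>, the inverse of \<open>\<beta>\<close> is the rotation of \<open>[2/3, 4/3]\<close>, whose outer quarters
have the type of \<open>[7/6, 4/3]\<close>.\<close>

lemma \<beta>_derived: "\<beta>\<^sub>B \<in> T_B'"
proof -
  interpret T: group T_B by (rule group_T_B)
  note g = generators_dyadic
  let ?f = "compose circle \<delta>\<^sub>B (compose circle \<beta>\<^sub>B \<delta>\<^sub>B)"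
  let ?r = "circle_inv ?f" and ?s = "circle_inv \<gamma>\<^sub>B"
  have fd: "?f \<in> dyadic_rearrangements" using dyadic_compose g by auto
  have rd: "?r \<in> dyadic_rearrangements" "?s \<in> dyadic_rearrangements" using dyadic_inv fd g by auto
  have d: "maps_linearly \<delta>\<^sub>B (7/6) (4/3) (2/3) (5/6)"
    by (rule maps_linearly_subinterval[OF \<delta>_lin, of "7/6" "4/3" _ 0 _ _ "-1"]; simp)
  have left: "is_rotation (conjugate \<delta>\<^sub>B ?s) (2/3) (5/6)"
    by (rule rotation_conjugate[OF rotation_\<gamma> \<delta>_Bij d]) auto
  have "compose circle ?r ?r = compose circle ?s (compose circle ?r (conjugate \<delta>\<^sub>B ?s))"
    by (rule pentagon[OF rotation_\<beta>]) (use left rotation_\<gamma> in simp_all)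
  hence eq: "?r \<otimes>\<^bsub>T_B\<^esub> ?r = ?s \<otimes>\<^bsub>T_B\<^esub> ?r \<otimes>\<^bsub>T_B\<^esub> (\<delta>\<^sub>B \<otimes>\<^bsub>T_B\<^esub> ?s \<otimes>\<^bsub>T_B\<^esub> inv\<^bsub>T_B\<^esub> \<delta>\<^sub>B)"
    by (simp only: T_B_mult[OF rd(1) rd(1), symmetric] T_B_mult3[OF rd(2,1) conjugate_dyadic[OF g(4) rd(2)]]
        T_B_conjugate[OF g(4) rd(2), symmetric])
  have s: "?s \<in> T_B'" using T.derived_inv[OF \<gamma>_derived] T_B_inv[OF g(3)] by simp
  have "?r \<in> T_B'"
    by (rule T.in_derived_of_square[OF _ s T.conjugate_in_derived[OF s] eq]) (use rd g in \<open>auto simp: T_B_carrier\<close>)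
  hence "inv\<^bsub>T_B\<^esub> ?r \<in> T_B'" by (rule T.derived_inv)
  hence "?f \<in> T_B'" using T_B_inv[OF rd(1)] circle_inv_inv[OF dyadic_Bij[OF fd]] by simp
  moreover have "?f = \<delta>\<^sub>B \<otimes>\<^bsub>T_B\<^esub> \<beta>\<^sub>B \<otimes>\<^bsub>T_B\<^esub> \<delta>\<^sub>B"
    by (rule T_B_mult3) (use g in auto)
  ultimately have "\<delta>\<^sub>B \<otimes>\<^bsub>T_B\<^esub> (\<delta>\<^sub>B \<otimes>\<^bsub>T_B\<^esub> \<beta>\<^sub>B \<otimes>\<^bsub>T_B\<^esub> \<delta>\<^sub>B) \<otimes>\<^bsub>T_B\<^esub> inv\<^bsub>T_B\<^esub> \<delta>\<^sub>B \<in> T_B'"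
    using T.conjugate_in_derived g by (simp add: T_B_carrier)
  moreover have "\<delta>\<^sub>B \<otimes>\<^bsub>T_B\<^esub> (\<delta>\<^sub>B \<otimes>\<^bsub>T_B\<^esub> \<beta>\<^sub>B \<otimes>\<^bsub>T_B\<^esub> \<delta>\<^sub>B) \<otimes>\<^bsub>T_B\<^esub> inv\<^bsub>T_B\<^esub> \<delta>\<^sub>B = \<beta>\<^sub>B"
  proof -
    have c: "\<delta>\<^sub>B \<in> carrier T_B" "\<beta>\<^sub>B \<in> carrier T_B" using g by (auto simp: T_B_carrier)
    have "\<delta>\<^sub>B \<otimes>\<^bsub>T_B\<^esub> (\<delta>\<^sub>B \<otimes>\<^bsub>T_B\<^esub> \<beta>\<^sub>B \<otimes>\<^bsub>T_B\<^esub> \<delta>\<^sub>B) \<otimes>\<^bsub>T_B\<^esub> \<delta>\<^sub>B = (\<delta>\<^sub>B \<otimes>\<^bsub>T_B\<^esub> \<delta>\<^sub>B) \<otimes>\<^bsub>T_B\<^esub> \<beta>\<^sub>B \<otimes>\<^bsub>T_B\<^esub> (\<delta>\<^sub>B \<otimes>\<^bsub>T_B\<^esub> \<delta>\<^sub>B)"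
      using c by (simp only: T.m_assoc T.m_closed)
    thus ?thesis using \<delta>_T_B c by simp
  qed
  ultimately show ?thesis by simp
qed

lemma \<delta>_derived: "\<delta>\<^sub>B \<in> T_B'"
proof -
  interpret T: group T_B by (rule group_T_B)
  note g = generators_dyadic
  show ?thesis
    using \<delta>\<beta>_order_three g
    by (intro T.in_derived_of_orders[OF _ \<beta>_derived \<delta>_T_B(2)]) (auto simp: T_B_carrier T_B_mult T_B_one dyadic_compose)
qed

lemma conj_\<alpha>_T_B:
  assumes "g \<in> dyadic_rearrangements"
  shows "conj_\<alpha> g = inv\<^bsub>T_B\<^esub> \<alpha>\<^sub>B \<otimes>\<^bsub>T_B\<^esub> g \<otimes>\<^bsub>T_B\<^esub> \<alpha>\<^sub>B"
  unfolding conj_\<alpha>_def using T_B_inv[OF generators_dyadic(1)] by (simp add: T_B_def)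

text \<open>The relation \<open>\<sigma>\<^sup>2 = (\<delta>\<alpha>)\<^sup>2 = 1\<close> in another form.\<close>

lemma \<alpha>_square: "\<alpha>\<^sub>B \<otimes>\<^bsub>T_B\<^esub> \<alpha>\<^sub>B = \<delta>\<^sub>B \<otimes>\<^bsub>T_B\<^esub> inv\<^bsub>T_B\<^esub> (conj_\<alpha> \<delta>\<^sub>B)"
proof -
  interpret T: group T_B by (rule group_T_B)
  note g = generators_dyadic
  have c: "\<delta>\<^sub>B \<in> carrier T_B" "\<alpha>\<^sub>B \<in> carrier T_B" using g by (auto simp: T_B_carrier)
  have "\<sigma> \<in> dyadic_rearrangements" unfolding \<sigma>_def using dyadic_compose g by blast
  hence "\<sigma> \<otimes>\<^bsub>T_B\<^esub> \<sigma> = \<one>\<^bsub>T_B\<^esub>" using \<sigma>_involution by (simp add: T_B_mult T_B_one)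
  hence "(\<delta>\<^sub>B \<otimes>\<^bsub>T_B\<^esub> \<alpha>\<^sub>B) \<otimes>\<^bsub>T_B\<^esub> (\<delta>\<^sub>B \<otimes>\<^bsub>T_B\<^esub> \<alpha>\<^sub>B) = \<one>\<^bsub>T_B\<^esub>" using g by (simp add: \<sigma>_def T_B_mult)
  hence "\<delta>\<^sub>B \<otimes>\<^bsub>T_B\<^esub> (\<alpha>\<^sub>B \<otimes>\<^bsub>T_B\<^esub> \<delta>\<^sub>B \<otimes>\<^bsub>T_B\<^esub> \<alpha>\<^sub>B) = \<delta>\<^sub>B \<otimes>\<^bsub>T_B\<^esub> \<delta>\<^sub>B" using c \<delta>_T_B by (simp add: T.m_assoc)
  hence ada: "\<alpha>\<^sub>B \<otimes>\<^bsub>T_B\<^esub> \<delta>\<^sub>B \<otimes>\<^bsub>T_B\<^esub> \<alpha>\<^sub>B = \<delta>\<^sub>B" using c by simp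
  let ?e = "conj_\<alpha> \<delta>\<^sub>B"
  have e: "?e = inv\<^bsub>T_B\<^esub> \<alpha>\<^sub>B \<otimes>\<^bsub>T_B\<^esub> \<delta>\<^sub>B \<otimes>\<^bsub>T_B\<^esub> \<alpha>\<^sub>B" using conj_\<alpha>_T_B g by simp
  have ec: "?e \<in> carrier T_B" using e c by simp
  have "(\<alpha>\<^sub>B \<otimes>\<^bsub>T_B\<^esub> \<alpha>\<^sub>B) \<otimes>\<^bsub>T_B\<^esub> ?e = \<alpha>\<^sub>B \<otimes>\<^bsub>T_B\<^esub> (\<alpha>\<^sub>B \<otimes>\<^bsub>T_B\<^esub> inv\<^bsub>T_B\<^esub> \<alpha>\<^sub>B) \<otimes>\<^bsub>T_B\<^esub> \<delta>\<^sub>B \<otimes>\<^bsub>T_B\<^esub> \<alpha>\<^sub>B"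
    unfolding e using c by (simp only: T.m_assoc T.m_closed T.inv_closed)
  also have "\<dots> = \<delta>\<^sub>B" using c ada by simp
  finally have "(\<alpha>\<^sub>B \<otimes>\<^bsub>T_B\<^esub> \<alpha>\<^sub>B) \<otimes>\<^bsub>T_B\<^esub> ?e = \<delta>\<^sub>B" .
  thus ?thesis using c ec T.inv_solve_right[of "\<alpha>\<^sub>B \<otimes>\<^bsub>T_B\<^esub> \<alpha>\<^sub>B" \<delta>\<^sub>B ?e] by simp
qed

abbreviation basilica_generators :: "(complex \<Rightarrow> complex) set" where
  "basilica_generators \<equiv> {\<beta>\<^sub>B, \<gamma>\<^sub>B, \<delta>\<^sub>B, conj_\<alpha> \<beta>\<^sub>B, conj_\<alpha> \<gamma>\<^sub>B, conj_\<alpha> \<delta>\<^sub>B}"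

lemma basilica_generators_derived: "basilica_generators \<subseteq> T_B'"
proof -
  interpret T: group T_B by (rule group_T_B)
  have a: "\<alpha>\<^sub>B \<in> carrier T_B" using generators_dyadic by (simp add: T_B_carrier)
  have "conj_\<alpha> g \<in> T_B'" if g: "g \<in> T_B'" for g
  proof -
    have gd: "g \<in> dyadic_rearrangements" using T.derived_mem[OF g] by (simp add: T_B_carrier)
    have "inv\<^bsub>T_B\<^esub> \<alpha>\<^sub>B \<otimes>\<^bsub>T_B\<^esub> g \<otimes>\<^bsub>T_B\<^esub> inv\<^bsub>T_B\<^esub> (inv\<^bsub>T_B\<^esub> \<alpha>\<^sub>B) \<in> T_B'"
      using T.conjugate_in_derived[OF g T.inv_closed[OF a]] .
    thus ?thesis using conj_\<alpha>_T_B[OF gd] T.inv_inv[OF a] by simp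
  qed
  thus ?thesis using \<beta>_derived \<gamma>_derived \<delta>_derived by simp
qed

text \<open>The group \<open>H\<close> generated by the six elements contains \<open>\<alpha>\<^sup>2\<close> and is normalized by \<open>\<alpha>\<close>, so \<open>H \<union> \<alpha> H\<close> is
a subgroup that contains all generators of \<open>T\<^sub>B\<close>.\<close>

lemma T_B_cosets:
  "dyadic_rearrangements \<subseteq> generate T_B basilica_generators \<union> (\<lambda>h. \<alpha>\<^sub>B \<otimes>\<^bsub>T_B\<^esub> h) ` generate T_B basilica_generators"
    (is "_ \<subseteq> ?K")
proof -
  interpret T: group T_B by (rule group_T_B)
  note g = generators_dyadic
  let ?S = basilica_generators and ?a = "\<alpha>\<^sub>B"
  let ?H = "generate T_B ?S"
  have a: "?a \<in> carrier T_B" using g by (simp add: T_B_carrier)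
  have S: "?S \<subseteq> carrier T_B" using basilica_generators_derived T.derived_in_carrier[of "carrier T_B"] by auto
  have H: "subgroup ?H T_B" using T.generate_is_subgroup[OF S] .
  have inc: "s \<in> ?H" if "s \<in> ?S" for s using generate.incl[OF that] .
  have aa: "?a \<otimes>\<^bsub>T_B\<^esub> ?a \<in> ?H"
    unfolding \<alpha>_square using subgroup.m_closed[OF H] subgroup.m_inv_closed[OF H] inc by simp
  have conj: "inv\<^bsub>T_B\<^esub> ?a \<otimes>\<^bsub>T_B\<^esub> s \<otimes>\<^bsub>T_B\<^esub> ?a \<in> ?H" if s: "s \<in> ?S" for s
  proof -
    have once: "inv\<^bsub>T_B\<^esub> ?a \<otimes>\<^bsub>T_B\<^esub> s \<otimes>\<^bsub>T_B\<^esub> ?a \<in> ?H" if "s \<in> {\<beta>\<^sub>B, \<gamma>\<^sub>B, \<delta>\<^sub>B}" for s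
    proof -
      have "inv\<^bsub>T_B\<^esub> ?a \<otimes>\<^bsub>T_B\<^esub> s \<otimes>\<^bsub>T_B\<^esub> ?a = conj_\<alpha> s" using conj_\<alpha>_T_B g that by auto
      thus ?thesis using inc that by auto
    qed
    \<comment> \<open>Conjugating twice by \<open>\<alpha>\<close> is conjugation by \<open>\<alpha>\<^sup>2\<close>, which lies in the subgroup.\<close>
    have twice: "inv\<^bsub>T_B\<^esub> ?a \<otimes>\<^bsub>T_B\<^esub> conj_\<alpha> s \<otimes>\<^bsub>T_B\<^esub> ?a \<in> ?H" if s: "s \<in> {\<beta>\<^sub>B, \<gamma>\<^sub>B, \<delta>\<^sub>B}" for s
    proof -
      have c: "s \<in> carrier T_B" using g s by (auto simp: T_B_carrier)
      have "conj_\<alpha> s = inv\<^bsub>T_B\<^esub> ?a \<otimes>\<^bsub>T_B\<^esub> s \<otimes>\<^bsub>T_B\<^esub> ?a" using conj_\<alpha>_T_B g s by auto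
      hence "inv\<^bsub>T_B\<^esub> ?a \<otimes>\<^bsub>T_B\<^esub> conj_\<alpha> s \<otimes>\<^bsub>T_B\<^esub> ?a = inv\<^bsub>T_B\<^esub> (?a \<otimes>\<^bsub>T_B\<^esub> ?a) \<otimes>\<^bsub>T_B\<^esub> s \<otimes>\<^bsub>T_B\<^esub> (?a \<otimes>\<^bsub>T_B\<^esub> ?a)"
        using a c by (simp add: T.m_assoc T.inv_mult_group)
      moreover have "inv\<^bsub>T_B\<^esub> (?a \<otimes>\<^bsub>T_B\<^esub> ?a) \<otimes>\<^bsub>T_B\<^esub> s \<otimes>\<^bsub>T_B\<^esub> (?a \<otimes>\<^bsub>T_B\<^esub> ?a) \<in> ?H"
        using subgroup.m_closed[OF H] subgroup.m_inv_closed[OF H] aa inc[of s] s by auto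
      ultimately show ?thesis by simp
    qed
    show ?thesis using s once[of s] twice[of \<beta>\<^sub>B] twice[of \<gamma>\<^sub>B] twice[of \<delta>\<^sub>B] by auto
  qed
  have conjH: "inv\<^bsub>T_B\<^esub> ?a \<otimes>\<^bsub>T_B\<^esub> h \<otimes>\<^bsub>T_B\<^esub> ?a \<in> ?H" if "h \<in> ?H" for h
    by (rule T.generate_conjugate[OF S a H _ that]) (use conj in blast)
  have K: "subgroup ?K T_B" by (rule T.index_two_union[OF H a aa conjH])
  have "?a = ?a \<otimes>\<^bsub>T_B\<^esub> \<one>\<^bsub>T_B\<^esub>" using a by simp
  hence aK: "?a \<in> ?K" using subgroup.one_closed[OF H] by blast
  have "generator_subgroup ?K"
  proof (rule generator_subgroup.intro)
    show "subgroup ?K (BijGroup circle)"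
      using group.incl_subgroup[OF group_BijGroup dyadic_subgroup, of ?K] K by (simp add: T_B_def)
    show "?K \<subseteq> dyadic_rearrangements" using subgroup.subset[OF K] by (simp add: T_B_carrier)
  qed (use aK inc in auto)
  thus ?thesis by (rule generator_subgroup.dyadic_in_K)
qed

section \<open>Separating arcs and the colours of the gaps\<close>

lemma lamination_arcs: "\<And>e. e \<in> lamination \<Longrightarrow> is_arc e"
  by (rule lamination_is_arc)

lemma gaps_regions: "gaps = region lamination ` open_cells lamination"
  unfolding gaps_def by (rule complementary_regions_eq[OF lamination_arcs])

lemma side_nonzero: "x \<in> open_cells lamination \<Longrightarrow> e \<in> lamination \<Longrightarrow> side e x \<noteq> 0"
  using open_cells_side[OF lamination_arcs] by blast

lemma centre_open: "0 \<in> open_cells lamination"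
proof -
  have "side e 0 \<noteq> 0" if e: "e \<in> lamination" for e
  proof -
    obtain a b where ab: "beneath a b" "e = {point a, point b}" using e lamination_beneath by blast
    thus ?thesis using side_arc_side(3)[OF lamination_is_arc[OF e] ab(2)] beneath_centre[OF ab(1)] by simp
  qed
  thus ?thesis using open_cells_side[OF lamination_arcs] by simp
qed

lemma central_gap_region: "central_gap = region lamination 0"
  unfolding central_gap_def
proof (rule the_equality)
  show "region lamination 0 \<in> gaps \<and> 0 \<in> region lamination 0"
    using gaps_regions centre_open region_self[OF lamination_arcs centre_open] by blast
next
  fix G assume G: "G \<in> gaps \<and> 0 \<in> G"
  then obtain x where "G = region lamination x" unfolding gaps_regions by blast
  thus "G = region lamination 0" using region_eq[of 0 lamination x] G by simp
qed

lemma separates_iff_side: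
  assumes e: "e \<in> lamination" and x: "x \<in> open_cells lamination" and y: "y \<in> open_cells lamination"
  shows "separates e (region lamination x) (region lamination y) \<longleftrightarrow> side e x * side e y < 0"
proof -
  have arcs: "\<And>e'. e' \<in> {e} \<Longrightarrow> is_arc e'" using lamination_is_arc[OF e] by simp
  have oc: "open_cells {e} = ball 0 1 - geodesic e" by (simp add: open_cells_def)
  have conn: "connected_component (ball 0 1 - geodesic e) u v \<longleftrightarrow> side e u * side e v > 0"
    if u: "u \<in> region lamination x'" "x' \<in> open_cells lamination"
      and v: "v \<in> region lamination y'" "y' \<in> open_cells lamination" for u v x' y'
  proof -
    have "u \<in> open_cells lamination" using region_subset[OF lamination_arcs] u by blast
    hence "u \<in> open_cells {e}" using e unfolding open_cells_def by blast
    hence "connected_component (ball 0 1 - geodesic e) u v \<longleftrightarrow> v \<in> region {e} u"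
      using connected_component_region[OF arcs] oc by (metis mem_Collect_eq)
    moreover have "v \<in> ball 0 1" using v by (simp add: region_def)
    ultimately show ?thesis by (simp add: region_def)
  qed
  have same: "side e x * side e u > 0" if "u \<in> region lamination x" for u x using that e by (simp add: region_def)
  show ?thesis
  proof
    assume "separates e (region lamination x) (region lamination y)"
    hence "\<not> side e x * side e y > 0"
      using conn[OF region_self[OF lamination_arcs x] x region_self[OF lamination_arcs y] y]
        region_self[OF lamination_arcs x] region_self[OF lamination_arcs y] unfolding separates_def by blast
    moreover have "side e x * side e y \<noteq> 0" using side_nonzero[OF x e] side_nonzero[OF y e] by simp
    ultimately show "side e x * side e y < 0" by linarith
  next
    assume neg: "side e x * side e y < 0"
    show "separates e (region lamination x) (region lamination y)"
      unfolding separates_def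
    proof (intro ballI notI)
      fix u v assume u: "u \<in> region lamination x" and v: "v \<in> region lamination y"
      assume "connected_component (ball 0 1 - geodesic e) u v"
      hence "side e u * side e v > 0" using conn[OF u x v y] by blast
      hence "side e x * side e v > 0" using same[OF u] same_sign_trans by blast
      moreover have "side e v * side e y > 0" using same[OF v] by (simp add: mult.commute)
      ultimately have "side e x * side e y > 0" using same_sign_trans by blast
      thus False using neg by simp
    qed
  qed
qed

definition separating :: "complex \<Rightarrow> complex \<Rightarrow> complex set set" where
  "separating x y = {e \<in> lamination. side e x * side e y < 0}"

lemma color_region:
  assumes "x \<in> open_cells lamination" shows "color (region lamination x) \<longleftrightarrow> even (card (separating x 0))"
proof -
  have "{e \<in> lamination. separates e (region lamination x) (region lamination 0)} = separating x 0"
    unfolding separating_def using separates_iff_side[OF _ assms centre_open] by blast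
  thus ?thesis by (simp add: color_def central_gap_region)
qed

text \<open>The centre is on the lower side of every arc, so the separating arcs are those with \<open>x\<close> on the
upper side.\<close>

lemma finite_separating_centre:
  assumes x: "x \<in> open_cells lamination" shows "finite (separating x 0)"
proof (rule finite_subset)
  have nx: "norm x < 1" using x by (simp add: open_cells_def)
  show "finite ((\<lambda>(a, b). {point a, point b}) ` {(a, b). beneath a b \<and> arc_side a b x > 0})"
    by (rule finite_imageI[OF finite_above[OF nx]])
  show "separating x 0 \<subseteq> (\<lambda>(a, b). {point a, point b}) ` {(a, b). beneath a b \<and> arc_side a b x > 0}"
  proof
    fix e assume "e \<in> separating x 0"
    hence e: "e \<in> lamination" "side e x * side e 0 < 0" by (auto simp: separating_def)
    obtain a b where ab: "beneath a b" "e = {point a, point b}" using e lamination_beneath by blast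
    have "\<not> arc_side a b x * arc_side a b 0 \<ge> 0" using side_arc_side(2)[OF lamination_is_arc[OF e(1)] ab(2), of x 0] e(2) by simp
    hence "arc_side a b x > 0" using beneath_centre[OF ab(1)] by (simp add: not_le mult_less_0_iff)
    thus "e \<in> (\<lambda>(a, b). {point a, point b}) ` {(a, b). beneath a b \<and> arc_side a b x > 0}" using ab by blast
  qed
qed

lemma separating_triangle:
  assumes "x \<in> open_cells lamination" "y \<in> open_cells lamination" "z \<in> open_cells lamination"
  shows "separating x z = (separating x y - separating y z) \<union> (separating y z - separating x y)"
proof -
  have "side e x * side e z < 0 \<longleftrightarrow> (side e x * side e y < 0) \<noteq> (side e y * side e z < 0)" if e: "e \<in> lamination" for e
    using side_nonzero[OF assms(1) e] side_nonzero[OF assms(2) e] side_nonzero[OF assms(3) e]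
    by (auto simp: mult_less_0_iff)
  thus ?thesis unfolding separating_def by blast
qed

lemma separating_sym: "separating x y = separating y x"
  unfolding separating_def by (simp add: mult.commute)

lemma finite_separating:
  assumes "x \<in> open_cells lamination" "y \<in> open_cells lamination" shows "finite (separating x y)"
  unfolding separating_triangle[OF assms(1) centre_open assms(2)] separating_sym[of 0 y]
  using finite_separating_centre assms by simp

lemma even_card_symmetric_difference:
  assumes "finite A" "finite B"
  shows "even (card ((A - B) \<union> (B - A))) \<longleftrightarrow> (even (card A) \<longleftrightarrow> even (card B))"
proof -
  have "card ((A - B) \<union> (B - A)) = card (A - B) + card (B - A)" using assms by (intro card_Un_disjoint) auto
  moreover have "card A = card (A - B) + card (A \<inter> B)" "card B = card (B - A) + card (A \<inter> B)"
    using card_Int_Diff[OF assms(1), of B] card_Int_Diff[OF assms(2), of A] by (simp_all add: Int_commute)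
  ultimately show ?thesis by auto
qed

lemma even_separating:
  assumes "x \<in> open_cells lamination" "y \<in> open_cells lamination" "z \<in> open_cells lamination"
  shows "even (card (separating x z)) \<longleftrightarrow> (even (card (separating x y)) \<longleftrightarrow> even (card (separating y z)))"
  unfolding separating_triangle[OF assms]
  by (rule even_card_symmetric_difference) (use finite_separating assms in auto)

section \<open>The action on the gaps\<close>

lemma bordering_arcs_region:
  assumes "x \<in> open_cells lamination"
  shows "bordering_arcs (region lamination x) = {e \<in> lamination. e \<subseteq> closure (region lamination x)}"
  unfolding bordering_arcs_def
  using geodesic_closure_region[OF lamination_arcs assms lamination_is_arc] by blast

lemma arc_subset_eq:
  assumes "is_arc e" "is_arc e'" "e' \<subseteq> e" shows "e' = e"
  using assms by (auto simp: is_arc_def)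

text \<open>A common bordering arc lies on both closed sides of the separating arc, hence on the arc itself.\<close>

lemma bordering_separated:
  assumes x: "x \<in> open_cells lamination" and y: "y \<in> open_cells lamination" and e: "e \<in> separating x y"
    and "e' \<in> bordering_arcs (region lamination x)" "e' \<in> bordering_arcs (region lamination y)"
  shows "e' = e"
proof -
  have e': "e' \<in> lamination" "e' \<subseteq> closure (region lamination x)" "e' \<subseteq> closure (region lamination y)"
    using assms(4,5) bordering_arcs_region[OF x] bordering_arcs_region[OF y] by auto
  have el: "e \<in> lamination" "side e x * side e y < 0" using e by (auto simp: separating_def)
  have "e' \<subseteq> e"
  proof
    fix p assume p: "p \<in> e'"
    have "side e x * side e p \<ge> 0" "side e y * side e p \<ge> 0"
      using closure_region[OF lamination_arcs x] closure_region[OF lamination_arcs y] e'(2,3) p el(1) by blast+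
    hence "side e p = 0" using el(2) by (auto simp: mult_less_0_iff zero_le_mult_iff)
    moreover have "p \<in> circle" using arc_subset_circle[OF lamination_is_arc[OF e'(1)]] p by blast
    ultimately show "p \<in> e" using side_circle_zero[OF lamination_is_arc[OF el(1)]] by blast
  qed
  thus ?thesis using arc_subset_eq lamination_is_arc el(1) e'(1) by blast
qed

text \<open>Two different gaps are separated by an arc, so they have at most one bordering arc in common, but
each gap has at least two.\<close>

lemma bordering_arcs_inj:
  assumes G: "G \<in> gaps" and H: "H \<in> gaps" and eq: "bordering_arcs G = bordering_arcs H"
  shows "G = H"
proof -
  obtain x y where x: "x \<in> open_cells lamination" "G = region lamination x"
    and y: "y \<in> open_cells lamination" "H = region lamination y" using G H unfolding gaps_regions by blast
  have none: "e \<notin> separating x y" for e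
  proof
    assume e: "e \<in> separating x y"
    obtain e1 e2 where 12: "e1 \<in> lamination" "e2 \<in> lamination" "e1 \<noteq> e2"
      "e1 \<subseteq> closure (region lamination x)" "e2 \<subseteq> closure (region lamination x)"
      using region_two_arcs[OF subset_refl x(1)] by blast
    have b: "e1 \<in> bordering_arcs G" "e2 \<in> bordering_arcs G" using 12 bordering_arcs_region[OF x(1)] x(2) by auto
    hence "e1 = e" "e2 = e" using bordering_separated[OF x(1) y(1) e] x(2) y(2) eq by auto
    thus False using 12 by simp
  qed
  have "side e x * side e y > 0" if e: "e \<in> lamination" for e
  proof -
    have "\<not> side e x * side e y < 0" using none[of e] e by (simp add: separating_def)
    thus ?thesis using side_nonzero[OF x(1) e] side_nonzero[OF y(1) e] by (metis linorder_neqE_linordered_idom mult_eq_0_iff)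
  qed
  hence "y \<in> region lamination x" using y(1) unfolding region_def open_cells_def by blast
  thus ?thesis using region_eq x(2) y(2) by simp
qed

lemma gap_image_eqI:
  assumes "H \<in> gaps" "bordering_arcs H = (`) f ` bordering_arcs G" shows "gap_image f G = H"
  unfolding gap_image_def
  by (rule the_equality) (use assms bordering_arcs_inj in auto)

text \<open>Besides the image gap itself, the sides of a representative point are needed to follow the
separating arcs.\<close>

lemma gap_image_region:
  assumes f: "f \<in> dyadic_rearrangements" and x: "x \<in> open_cells lamination"
  obtains y where "y \<in> open_cells lamination" "gap_image f (region lamination x) = region lamination y"
    "\<And>e p. e \<in> lamination \<Longrightarrow> p \<in> circle \<Longrightarrow> side (f ` e) y * side (f ` e) (f p) > 0 \<longleftrightarrow> side e x * side e p > 0"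
    "bordering_arcs (region lamination y) = (`) f ` bordering_arcs (region lamination x)"
proof -
  obtain D R where r: "rearranges f D R" using f dyadic_iff_rearranges by blast
  have fB: "f \<in> Bij circle" using dyadic_Bij[OF f] .
  have L: "(`) f ` lamination = lamination" by (rule rearranges_lamination[OF r])
  obtain y where y: "y \<in> open_cells lamination"
    "\<And>e p. e \<in> lamination \<Longrightarrow> p \<in> circle \<Longrightarrow> side (f ` e) y * side (f ` e) (f p) > 0 \<longleftrightarrow> side e x * side e p > 0"
    "closure (region lamination y) \<inter> circle = f ` (closure (region lamination x) \<inter> circle)"
    using rearranges_region[OF r subset_refl x] unfolding L by blast
  have sub: "f ` e \<subseteq> closure (region lamination y) \<longleftrightarrow> e \<subseteq> closure (region lamination x)" if e: "e \<in> lamination" for e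
  proof -
    have ec: "e \<subseteq> circle" using arc_subset_circle[OF lamination_is_arc[OF e]] .
    hence fe: "f ` e \<subseteq> circle" using Bij_image[OF fB] by blast
    have "f ` e \<subseteq> closure (region lamination y) \<longleftrightarrow> f ` e \<subseteq> closure (region lamination y) \<inter> circle" using fe by blast
    also have "\<dots> \<longleftrightarrow> e \<subseteq> closure (region lamination x) \<inter> circle"
      unfolding y(3) by (rule inj_on_image_subset_iff[OF Bij_inj[OF fB] ec]) blast
    finally show ?thesis using ec by blast
  qed
  have b: "bordering_arcs (region lamination y) = (`) f ` bordering_arcs (region lamination x)"
  proof -
    have "{e \<in> (`) f ` lamination. e \<subseteq> closure (region lamination y)} = (`) f ` {e \<in> lamination. e \<subseteq> closure (region lamination x)}"
      using sub by blast
    thus ?thesis unfolding L bordering_arcs_region[OF x] bordering_arcs_region[OF y(1)] .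
  qed
  have "gap_image f (region lamination x) = region lamination y"
    by (rule gap_image_eqI[OF _ b]) (use gaps_regions y(1) in blast)
  thus ?thesis using that y(1,2) b by blast
qed

text \<open>The sides of \<open>f ` e\<close> are compared by means of the image of a point of the circle off \<open>e\<close>.\<close>

lemma card_separating_image:
  assumes f: "f \<in> dyadic_rearrangements"
    and open_cells: "x \<in> open_cells lamination" "x' \<in> open_cells lamination" "y \<in> open_cells lamination" "y' \<in> open_cells lamination"
    and xy: "\<And>e p. e \<in> lamination \<Longrightarrow> p \<in> circle \<Longrightarrow> side (f ` e) y * side (f ` e) (f p) > 0 \<longleftrightarrow> side e x * side e p > 0"
    and xy': "\<And>e p. e \<in> lamination \<Longrightarrow> p \<in> circle \<Longrightarrow> side (f ` e) y' * side (f ` e) (f p) > 0 \<longleftrightarrow> side e x' * side e p > 0"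
  shows "card (separating y y') = card (separating x x')"
proof -
  have fB: "f \<in> Bij circle" using dyadic_Bij[OF f] .
  have L: "(`) f ` lamination = lamination" using f dyadic_iff_rearranges rearranges_lamination by blast
  have iff: "side (f ` e) y * side (f ` e) y' < 0 \<longleftrightarrow> side e x * side e x' < 0" if e: "e \<in> lamination" for e
  proof -
    have fe: "f ` e \<in> lamination" using e L by blast
    have arc: "is_arc e" using lamination_is_arc[OF e] .
    obtain a b where ab: "a < b" "b < a + 1" "e = {point a, point b}" using is_arc_ends[OF arc] by metis
    obtain p where p: "p \<in> circle" "p \<notin> e"
    proof
      have "arc_side a b (point ((a + b) / 2)) > 0" using ab(1,2) by (intro arc_side_point_pos) (auto simp: field_simps)
      hence "side e (point ((a + b) / 2)) \<noteq> 0" using side_arc_side(3)[OF arc ab(3)] by simp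
      thus "point ((a + b) / 2) \<notin> e" using side_circle_zero[OF arc point_in_circle] by blast
    qed (rule point_in_circle)
    have fp: "f p \<in> circle" "f p \<notin> f ` e"
      using Bij_in[OF fB p(1)] inj_on_image_mem_iff[OF Bij_inj[OF fB] p(1) arc_subset_circle[OF arc]] p(2) by blast+
    have nz: "side e p \<noteq> 0" "side (f ` e) (f p) \<noteq> 0"
      using side_circle_zero[OF arc p(1)] side_circle_zero[OF lamination_is_arc[OF fe] fp(1)] p(2) fp(2) by blast+
    have sign: "u * v < 0 \<longleftrightarrow> (u * w > 0) \<noteq> (v * w > 0)" if "u \<noteq> 0" "v \<noteq> 0" "w \<noteq> 0" for u v w :: real
      using that by (auto simp: mult_less_0_iff zero_less_mult_iff)
    show ?thesis
      using sign[OF side_nonzero[OF open_cells(3) fe] side_nonzero[OF open_cells(4) fe] nz(2)]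
        sign[OF side_nonzero[OF open_cells(1) e] side_nonzero[OF open_cells(2) e] nz(1)] xy[OF e p(1)] xy'[OF e p(1)] by simp
  qed
  have "{e \<in> (`) f ` lamination. side e y * side e y' < 0} = (`) f ` {e \<in> lamination. side e x * side e x' < 0}"
    using iff by blast
  hence img: "separating y y' = (`) f ` separating x x'" unfolding separating_def L .
  have "inj_on ((`) f) (separating x x')"
  proof (rule inj_onI)
    fix e e' assume ee: "e \<in> separating x x'" "e' \<in> separating x x'" "f ` e = f ` e'"
    have "e \<subseteq> circle" "e' \<subseteq> circle" using ee arc_subset_circle[OF lamination_is_arc] by (auto simp: separating_def simp del: mem_sphere)
    thus "e = e'" using inj_on_image_eq_iff[OF Bij_inj[OF fB]] ee(3) by blast
  qed
  thus ?thesis unfolding img by (rule card_image)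
qed

text \<open>Modulo 2, the number of arcs between \<open>gap_image f G\<close> and \<open>central_gap\<close> is the sum of the numbers
between each of them and \<open>gap_image f central_gap\<close>; the first of these is the number of arcs
between \<open>G\<close> and \<open>central_gap\<close>.\<close>

lemma color_gap_image:
  assumes f: "f \<in> dyadic_rearrangements" and G: "G \<in> gaps"
  shows "color (gap_image f G) \<longleftrightarrow> (color G \<longleftrightarrow> color (gap_image f central_gap))" "gap_image f G \<in> gaps"
proof -
  obtain x where x: "x \<in> open_cells lamination" "G = region lamination x" using G unfolding gaps_regions by blast
  obtain y where y: "y \<in> open_cells lamination" "gap_image f (region lamination x) = region lamination y"
    "\<And>e p. e \<in> lamination \<Longrightarrow> p \<in> circle \<Longrightarrow> side (f ` e) y * side (f ` e) (f p) > 0 \<longleftrightarrow> side e x * side e p > 0"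
    using gap_image_region[OF f x(1)] by metis
  obtain c where c: "c \<in> open_cells lamination" "gap_image f (region lamination 0) = region lamination c"
    "\<And>e p. e \<in> lamination \<Longrightarrow> p \<in> circle \<Longrightarrow> side (f ` e) c * side (f ` e) (f p) > 0 \<longleftrightarrow> side e 0 * side e p > 0"
    using gap_image_region[OF f centre_open] by metis
  have "card (separating y c) = card (separating x 0)" by (rule card_separating_image[OF f x(1) centre_open y(1) c(1) y(3) c(3)])
  thus "color (gap_image f G) \<longleftrightarrow> (color G \<longleftrightarrow> color (gap_image f central_gap))"
    using even_separating[OF y(1) c(1) centre_open] color_region[OF x(1)] color_region[OF y(1)] color_region[OF c(1)]
    by (simp add: x(2) y(2) c(2) central_gap_region)
  show "gap_image f G \<in> gaps" using y(1,2) x(2) gaps_regions by blast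
qed

lemma central_gap_gap: "central_gap \<in> gaps"
  unfolding central_gap_region gaps_regions using centre_open by blast

lemma color_central_gap: "color central_gap"
proof -
  have "separating 0 0 = {}" unfolding separating_def by (simp add: not_less)
  thus ?thesis using color_region[OF centre_open] central_gap_region by simp
qed

lemma preserves_coloring_iff:
  assumes "f \<in> dyadic_rearrangements"
  shows "preserves_coloring f \<longleftrightarrow> color (gap_image f central_gap)"
  unfolding preserves_coloring_def
  using color_gap_image(1)[OF assms] central_gap_gap color_central_gap by blast

lemma bordering_arcs_gap_image:
  assumes f: "f \<in> dyadic_rearrangements" and G: "G \<in> gaps"
  shows "bordering_arcs (gap_image f G) = (`) f ` bordering_arcs G"
proof -
  obtain x where x: "x \<in> open_cells lamination" "G = region lamination x" using G unfolding gaps_regions by blast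
  show ?thesis using gap_image_region[OF f x(1)] x(2) by metis
qed

lemma preserves_coloring_compose:
  assumes g: "g \<in> dyadic_rearrangements" and f: "f \<in> dyadic_rearrangements"
  shows "preserves_coloring (compose circle g f) \<longleftrightarrow> (preserves_coloring g \<longleftrightarrow> preserves_coloring f)"
proof -
  have 1: "gap_image f central_gap \<in> gaps" using color_gap_image(2)[OF f central_gap_gap] .
  have img: "compose circle g f ` e = g ` f ` e" if "e \<in> bordering_arcs central_gap" for e
  proof -
    have "e \<subseteq> circle" using that arc_subset_circle[OF lamination_is_arc] unfolding bordering_arcs_def by blast
    thus ?thesis unfolding image_image by (intro image_cong) (auto simp: compose_def simp del: mem_sphere)
  qed
  have "gap_image (compose circle g f) central_gap = gap_image g (gap_image f central_gap)"
  proof (rule gap_image_eqI[OF color_gap_image(2)[OF g 1]])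
    have "bordering_arcs (gap_image g (gap_image f central_gap)) = (`) g ` (`) f ` bordering_arcs central_gap"
      using bordering_arcs_gap_image[OF g 1] bordering_arcs_gap_image[OF f central_gap_gap] by simp
    also have "\<dots> = (`) (compose circle g f) ` bordering_arcs central_gap"
      unfolding image_image[of "(`) g"] by (rule image_cong) (simp_all add: img)
    finally show "bordering_arcs (gap_image g (gap_image f central_gap)) = (`) (compose circle g f) ` bordering_arcs central_gap" .
  qed
  thus ?thesis
    using preserves_coloring_iff[OF dyadic_compose[OF g f]] preserves_coloring_iff[OF f] preserves_coloring_iff[OF g]
      color_gap_image(1)[OF g 1] by metis
qed

lemma central_vertex_closure:
  assumes t: "t \<in> {1/3, 2/3, 5/6, 7/6}" shows "point t \<in> closure (region lamination 0)"
proof -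
  have "arc_side c d 0 * arc_side c d (point t) \<ge> 0" if "beneath c d" for c d
    using central_vertex_outside[OF t that] beneath_centre[OF that] by (simp add: mult_nonpos_nonpos)
  thus ?thesis unfolding closure_region_beneath[OF subset_refl centre_open] by simp
qed

text \<open>The arc \<open>{5/6, 7/6}\<close>, which is the image of \<open>{1/3, 2/3}\<close> under \<open>\<alpha>\<close>, borders both the central gap and
its image and separates them: the point 0 of the circle is fixed, and it lies on the side of the
centre for \<open>{1/3, 2/3}\<close> but not for \<open>{5/6, 7/6}\<close>.  A common bordering arc that separates is the
only separating arc.\<close>

lemma \<alpha>_not_preserves_coloring: "\<not> preserves_coloring \<alpha>\<^sub>B"
proof -
  note f = generators_dyadic(1)
  let ?e = "{point (5/6), point (7/6)}"
  have eL: "?e \<in> lamination" using primary_arc_lamination[OF pieceB] unfolding primary_arcs(1) .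
  have bA: "arcA \<in> bordering_arcs central_gap" and be: "?e \<in> bordering_arcs central_gap"
    unfolding central_gap_region bordering_arcs_region[OF centre_open]
    using eL arcA_lamination central_vertex_closure by auto
  have "\<alpha>\<^sub>B (point (1/3)) = point (1/6)" "\<alpha>\<^sub>B (point (2/3)) = point (5/6)"
    using maps_linearly_ends[OF \<alpha>_lin(3)] by auto
  moreover have "point (1/6) = point (7/6)" unfolding point_eq_iff by (rule exI[of _ "-1"]) simp
  ultimately have img: "\<alpha>\<^sub>B ` arcA = ?e" by auto
  have fix0: "\<alpha>\<^sub>B (point 0) = point 0" using maps_linearlyD[OF \<alpha>_lin(2), of 0] by simp
  obtain c where c: "c \<in> open_cells lamination" "gap_image \<alpha>\<^sub>B (region lamination 0) = region lamination c"
    "\<And>e p. e \<in> lamination \<Longrightarrow> p \<in> circle \<Longrightarrow> side (\<alpha>\<^sub>B ` e) c * side (\<alpha>\<^sub>B ` e) (\<alpha>\<^sub>B p) > 0 \<longleftrightarrow> side e 0 * side e p > 0"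
    "bordering_arcs (region lamination c) = (`) \<alpha>\<^sub>B ` bordering_arcs (region lamination 0)"
    using gap_image_region[OF f centre_open] by metis
  have bc: "?e \<in> bordering_arcs (region lamination c)" using bA img unfolding c(4) central_gap_region by blast
  have cos: "cos (pi / 3) = 1 / 2" by (rule cos_60)
  have p01: "point 0 = point 1" unfolding point_eq_iff by (rule exI[of _ "-1"]) simp
  have A: "arc_side (1/3) (2/3) 0 < 0" "arc_side (5/6) (7/6) 0 < 0" using cos by (simp_all add: arc_side_def)
  have "arc_side (1/3) (2/3) (point 0) < 0" unfolding p01 by (rule arc_side_point_neg) auto
  hence "side arcA 0 * side arcA (point 0) > 0"
    using side_arc_side(1)[OF lamination_is_arc[OF arcA_lamination] refl] A(1) by (simp add: mult_neg_neg)
  hence "side ?e c * side ?e (point 0) > 0" using c(3)[OF arcA_lamination point_in_circle] img fix0 by metis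
  moreover have "\<not> side ?e (point 0) * side ?e 0 \<ge> 0"
  proof -
    have "arc_side (5/6) (7/6) (point 0) > 0" unfolding p01 by (rule arc_side_point_pos) auto
    hence "\<not> arc_side (5/6) (7/6) (point 0) * arc_side (5/6) (7/6) 0 \<ge> 0" using A(2) by (simp add: not_le mult_pos_neg)
    thus ?thesis using side_arc_side(2)[OF lamination_is_arc[OF eL] refl] by blast
  qed
  ultimately have "side ?e c * side ?e 0 < 0" by (auto simp: not_le mult_less_0_iff zero_less_mult_iff)
  hence e: "?e \<in> separating c 0" using eL by (simp add: separating_def)
  have "?e = e" if "e \<in> separating c 0" for e
    using bordering_separated[OF c(1) centre_open that bc] be unfolding central_gap_region by blast
  hence "separating c 0 = {?e}" using e by blast
  hence "\<not> color (region lamination c)" using color_region[OF c(1)] by simp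
  thus ?thesis using preserves_coloring_iff[OF f] c(2) unfolding central_gap_region by simp
qed

section \<open>Subgroups of index two given by a sign\<close>

text \<open>A homomorphism \<open>\<epsilon>\<close> to the group of order two, written as a predicate that holds on its kernel.\<close>

locale sign_on_group = group +
  fixes \<epsilon> :: "'a \<Rightarrow> bool"
  assumes \<epsilon>_mult: "g \<in> carrier G \<Longrightarrow> f \<in> carrier G \<Longrightarrow> \<epsilon> (g \<otimes> f) \<longleftrightarrow> (\<epsilon> g \<longleftrightarrow> \<epsilon> f)"
begin

lemma \<epsilon>_one: "\<epsilon> \<one>"
  using \<epsilon>_mult[of \<one> \<one>] by simp

lemma \<epsilon>_inv: "g \<in> carrier G \<Longrightarrow> \<epsilon> (inv g) \<longleftrightarrow> \<epsilon> g"
  using \<epsilon>_mult[of "inv g" g] \<epsilon>_one by simp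

lemma kernel_subgroup: "subgroup {f \<in> carrier G. \<epsilon> f} G"
  by (rule subgroupI) (auto simp: \<epsilon>_mult \<epsilon>_inv intro: \<epsilon>_one)

lemma derived_kernel: "derived G (carrier G) \<subseteq> {f \<in> carrier G. \<epsilon> f}"
  unfolding derived_def
  by (rule generate_subgroup_incl[OF _ kernel_subgroup]) (auto simp: \<epsilon>_mult \<epsilon>_inv)

lemma kernel_index_two:
  assumes a: "a \<in> carrier G" "\<not> \<epsilon> a" shows "card (rcosets {f \<in> carrier G. \<epsilon> f}) = 2"
proof -
  let ?E = "{f \<in> carrier G. \<epsilon> f}" and ?O = "{f \<in> carrier G. \<not> \<epsilon> f}"
  have coset: "?E #> g = {f \<in> carrier G. \<epsilon> f \<longleftrightarrow> \<epsilon> g}" if g: "g \<in> carrier G" for g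
  proof
    show "?E #> g \<subseteq> {f \<in> carrier G. \<epsilon> f \<longleftrightarrow> \<epsilon> g}" using g by (auto simp: r_coset_def \<epsilon>_mult)
    show "{f \<in> carrier G. \<epsilon> f \<longleftrightarrow> \<epsilon> g} \<subseteq> ?E #> g"
    proof
      fix f assume f: "f \<in> {f \<in> carrier G. \<epsilon> f \<longleftrightarrow> \<epsilon> g}"
      hence "f \<otimes> inv g \<in> ?E" "f = (f \<otimes> inv g) \<otimes> g" using g by (auto simp: \<epsilon>_mult \<epsilon>_inv m_assoc)
      thus "f \<in> ?E #> g" unfolding r_coset_def by blast
    qed
  qed
  have "rcosets ?E = {?E, ?O}"
  proof
    show "rcosets ?E \<subseteq> {?E, ?O}" using coset by (auto simp: RCOSETS_def)
    show "{?E, ?O} \<subseteq> rcosets ?E" proof -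
      have "?E = ?E #> \<one>" "?O = ?E #> a" using coset[OF one_closed] coset[OF a(1)] \<epsilon>_one a by auto
      thus ?thesis using a(1) one_closed unfolding RCOSETS_def by blast
    qed
  qed
  moreover have "?E \<noteq> ?O" using \<epsilon>_one by blast
  ultimately show ?thesis by simp
qed

end

interpretation colour: sign_on_group T_B preserves_coloring
proof (rule sign_on_group.intro[OF group_T_B sign_on_group_axioms.intro])
  fix g f assume "g \<in> carrier T_B" "f \<in> carrier T_B"
  thus "preserves_coloring (g \<otimes>\<^bsub>T_B\<^esub> f) \<longleftrightarrow> (preserves_coloring g \<longleftrightarrow> preserves_coloring f)"
    using preserves_coloring_compose by (simp add: T_B_carrier T_B_mult)
qed

theorem theorem8p1:
  shows "group T_B \<and>
    derived T_B (carrier T_B) = {f \<in> carrier T_B. preserves_coloring f} \<and>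
    subgroup (derived T_B (carrier T_B)) T_B \<and>
    card (rcosets\<^bsub>T_B\<^esub> (derived T_B (carrier T_B))) = 2 \<and>
    derived T_B (carrier T_B) =
      generate T_B {\<beta>\<^sub>B, \<gamma>\<^sub>B, \<delta>\<^sub>B, conj_\<alpha> \<beta>\<^sub>B, conj_\<alpha> \<gamma>\<^sub>B, conj_\<alpha> \<delta>\<^sub>B}"
proof -
  let ?H = "generate T_B basilica_generators" and ?E = "{f \<in> carrier T_B. preserves_coloring f}"
  have a: "\<alpha>\<^sub>B \<in> carrier T_B" using generators_dyadic by (simp add: T_B_carrier)
  have HD: "?H \<subseteq> T_B'"
    by (rule colour.generate_subgroup_incl[OF basilica_generators_derived colour.derived_is_subgroup]) simp
  have DE: "T_B' \<subseteq> ?E" by (rule colour.derived_kernel)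
  have EH: "?E \<subseteq> ?H"
  proof
    fix f assume f: "f \<in> ?E"
    show "f \<in> ?H"
    proof (rule ccontr)
      assume "f \<notin> ?H"
      then obtain h where h: "h \<in> ?H" "f = \<alpha>\<^sub>B \<otimes>\<^bsub>T_B\<^esub> h" using T_B_cosets f unfolding T_B_carrier by blast
      hence "h \<in> ?E" using HD DE by blast
      thus False using f h(2) colour.\<epsilon>_mult[OF a] \<alpha>_not_preserves_coloring by blast
    qed
  qed
  have eq: "T_B' = ?E" "T_B' = ?H" using HD DE EH by blast+
  have "card (rcosets\<^bsub>T_B\<^esub> T_B') = 2"
    unfolding eq(1) by (rule colour.kernel_index_two[OF a \<alpha>_not_preserves_coloring])
  moreover have "subgroup T_B' T_B" unfolding eq(1) by (rule colour.kernel_subgroup)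
  ultimately show ?thesis by (intro conjI group_T_B eq)
qed

end
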